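(* The class of parallel poly-pushdown ($\mathcal P$) groups is closed under direct product and free product: if $G$ and $G'$ are $\mathcal P$ groups, then $G\times G'$ and $G*G'$ are $\mathcal P$ groups.
   Context: **Languages.** For a finite alphabet $A$, $A^*$ is the free monoid on $A$ (words), $\epsilon$ is the empty word, and a language is a subset of $A^*$. **Deterministic pushdown automata.** A deterministic pushdown automaton is a 7-tuple $M=(S,A,B,\tau,s_0,Z_0,Y)$ with $S$ a finite set of states, $A$ a finite input alphabet, $B$ a finite stack alphabet, $s_0\in S$ the start state, $Z_0\in B$ the start symbol, $Y\subseteq S$ the final states, and $\tau:\Sigma\to S\times B^*$ a map with $\Sigma\subseteq (A\cup\{\epsilon\})\times B\times S$ such that for every $(b,s)\in B\times S$ either $(\epsilon,b,s)\in\Sigma$ and $(a,b,s)\notin\Sigma$ for all $a\in A$, or $(\epsilon,b,s)\notin\Sigma$ and $(a,b,s)\in\Sigma$ for all $a\in A$. An instantaneous description is a triple $(u,z,s)\in A^*\times B^*\times S$ (unread input, stack with top at the right end, state). $M$ makes the transition $(av,yb,s)\to(v,y\alpha,t)$ if $a\in A\cup\{\epsilon\}$, $b\in B$, $(a,b,s)\in \Sigma$ and $\tau(a,b,s)=(t,\alpha)$; $\to^*$ is the reflexive transitive closure. $M$ accepts $w$ by final state if $(w,Z_0,s_0)\to^*(\epsilon,z,s)$ for some $z\in B^*$, $s\in Y$; it accepts $w$ by empty stack if $(w,Z_0,s_0)\to^*(\epsilon,\epsilon,s)$ for some $s\in S$. A language is the language of a deterministic pushdown automaton if it is the set of words accepted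 by some such $M$ in either one of these two modes. **$\mathcal P$ languages.** $L\subseteq A^*$ is parallel poly-pushdown ($\mathcal P$) if it is an intersection of finitely many languages over $A$ of deterministic pushdown automata. **Two-tape version.** Let $\$$ be a symbol not in $A$, and let $(A\cup\{\$\})^\sharp$, $(A\cup\{\$\})^\flat$ be two disjoint copies of $A\cup\{\$\}$, with induced maps on words $u\mapsto u^\sharp$, $v\mapsto v^\flat$. A shuffle $\sigma(u,v)$ of words $u,v$ is a word $u_1^\sharp v_1^\flat\cdots u_k^\sharp v_k^\flat$ with $u=u_1\cdots u_k$, $v=v_1\cdots v_k$, $u_i\ne\epsilon$ for $i>1$, $v_j\neq\epsilon$ for $j<k$. An asynchronous two-tape pushdown automaton over $A$ is a deterministic pushdown automaton $T$ with input alphabet $(A\cup\{\$\})^\sharp\sqcup (A\cup\{\$\})^\flat$ whose states are partitioned into two sets $S_\sharp,S_\flat$. A pair $(u,v)\in A^*\times A^*$ is accepted by $T$ if some shuffle $\sigma(u\$,v\$)$ is accepted by $T$ and, while reading it, $T$ reads letters of $(A\cup\{\$\})^\sharp$ only in states of $S_\sharp$ and letters of $(A\cup\{\$\})^\flat$ only in states of $S_\flat$. The language of $T$ is the set of accepted pairs. A subset of $A^*\times A^*$ is AT$\mathcal P$ (asynchronous two-tape parallel poly-pushdown) if it is the intersection of the languages of finitely many asynchronous two-tape pushdown automata over $A$. **$\mathcal P$ groups.** Let $G$ be a group and $A$ a finite set with a map $A\to G$ such that the induced monoid homomorphism $A^*\to G$, $w\mapsto\overline w$, is surjective. A language $L\subseteq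 A^*$ is a parallel poly-pushdown structure for $G$ if (1) $w\mapsto \overline w$ restricts to a bijection $L\to G$; (2) $L$ is $\mathcal P$; (3) for each $a\in A$ the set $\{(w,w')\in L\times L: \overline{w'}=\overline{wa}\}$ is AT$\mathcal P$. $G$ is parallel poly-pushdown (a $\mathcal P$ group) if it has such a structure for some such $A$. *)

theory Defs
  imports "HOL-Algebra.Group"
begin

section \<open>Deterministic pushdown automata\<close>

text \<open>
  In the transition map the letter \<^term>\<open>None\<close> stands for the empty word, and the
  set $\Sigma$ on which $\tau$ is defined is the domain of the partial map.
\<close>

record ('s, 'a, 'b) dpda =
  states :: "'s set"
  input_alphabet :: "'a set"
  stack_alphabet :: "'b set"
  transition :: "'a option \<times> 'b \<times> 's \<rightharpoonup> 's \<times> 'b list"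
  start_state :: 's
  start_symbol :: 'b
  final_states :: "'s set"

definition wf_dpda :: "('s, 'a, 'b, 'z) dpda_scheme \<Rightarrow> bool" where
  "wf_dpda M \<longleftrightarrow>
     finite (states M) \<and> finite (input_alphabet M) \<and> finite (stack_alphabet M) \<and>
     start_state M \<in> states M \<and> start_symbol M \<in> stack_alphabet M \<and>
     final_states M \<subseteq> states M \<and>
     dom (transition M) \<subseteq>
       (insert None (Some ` input_alphabet M)) \<times> stack_alphabet M \<times> states M \<and>
     ran (transition M) \<subseteq> states M \<times> lists (stack_alphabet M) \<and>
     (\<forall>b \<in> stack_alphabet M. \<forall>s \<in> states M.
        ((None, b, s) \<in> dom (transition M) \<and>
           (\<forall>a \<in> input_alphabet M. (Some a, b, s) \<notin> dom (transition M))) \<or>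
        ((None, b, s) \<notin> dom (transition M) \<and>
           (\<forall>a \<in> input_alphabet M. (Some a, b, s) \<in> dom (transition M))))"

text \<open>
  Instantaneous descriptions are triples of unread input, stack and state; the top of the stack
  is the right end of the list. The second argument of \<open>dpda_step\<close> records the letter that is
  read, if any.
\<close>

inductive dpda_step ::
  "('s, 'a, 'b, 'z) dpda_scheme \<Rightarrow> 'a option \<Rightarrow>
    'a list \<times> 'b list \<times> 's \<Rightarrow> 'a list \<times> 'b list \<times> 's \<Rightarrow> bool"
  for M where
  dpda_read: "transition M (Some a, b, s) = Some (t, \<alpha>) \<Longrightarrow>
     dpda_step M (Some a) (a # v, y @ [b], s) (v, y @ \<alpha>, t)"
| dpda_eps: "transition M (None, b, s) = Some (t, \<alpha>) \<Longrightarrow>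
     dpda_step M None (v, y @ [b], s) (v, y @ \<alpha>, t)"

definition dpda_move ::
  "('s, 'a, 'b, 'z) dpda_scheme \<Rightarrow>
    'a list \<times> 'b list \<times> 's \<Rightarrow> 'a list \<times> 'b list \<times> 's \<Rightarrow> bool" where
  "dpda_move M c c' \<longleftrightarrow> (\<exists>a. dpda_step M a c c')"

datatype acceptance_mode = Final_State | Empty_Stack

definition accepting ::
  "acceptance_mode \<Rightarrow> ('s, 'a, 'b, 'z) dpda_scheme \<Rightarrow> ('a list \<times> 'b list \<times> 's) set" where
  "accepting m M = (case m of
     Final_State \<Rightarrow> {([], z, s) | z s. z \<in> lists (stack_alphabet M) \<and> s \<in> final_states M}
   | Empty_Stack \<Rightarrow> {([], [], s) | s. s \<in> states M})"

definition dpda_language ::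
  "acceptance_mode \<Rightarrow> ('s, 'a, 'b, 'z) dpda_scheme \<Rightarrow> 'a list set" where
  "dpda_language m M =
     {w \<in> lists (input_alphabet M).
        \<exists>c \<in> accepting m M. (dpda_move M)\<^sup>*\<^sup>* (w, [start_symbol M], start_state M) c}"

text \<open>
  States and stack symbols are taken in \<^typ>\<open>nat\<close>, since one cannot quantify over types
  inside a definition. This is no restriction: both sets are finite.
\<close>

definition is_dpda_language :: "'a set \<Rightarrow> 'a list set \<Rightarrow> bool" where
  "is_dpda_language A L \<longleftrightarrow>
     (\<exists>(M :: (nat, 'a, nat) dpda) m.
        wf_dpda M \<and> input_alphabet M = A \<and> L = dpda_language m M)"

text \<open>
  Intersections are over nonempty finite families; the empty one would give all
  words over \<open>A\<close>, which is the language of a single automaton anyway.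
\<close>

definition parallel_poly_pushdown :: "'a set \<Rightarrow> 'a list set \<Rightarrow> bool" where
  "parallel_poly_pushdown A L \<longleftrightarrow>
     (\<exists>\<F>. finite \<F> \<and> \<F> \<noteq> {} \<and> (\<forall>K \<in> \<F>. is_dpda_language A K) \<and> L = \<Inter>\<F>)"


section \<open>Asynchronous two-tape pushdown automata\<close>

text \<open>
  The end marker $\$$ is \<^term>\<open>None\<close>, a letter \<open>a\<close> of the alphabet is \<open>Some a\<close>, and the two
  disjoint copies (sharp and flat) of the extended alphabet are formed with \<^term>\<open>Inl\<close> and
  \<^term>\<open>Inr\<close>.
\<close>

definition end_marked :: "'a list \<Rightarrow> 'a option list" where
  "end_marked u = map Some u @ [None]"

definition is_shuffle :: "'x list \<Rightarrow> 'x list \<Rightarrow> ('x + 'x) list \<Rightarrow> bool" where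
  "is_shuffle u v w \<longleftrightarrow>
     (\<exists>us vs. length us = length vs \<and> concat us = u \<and> concat vs = v \<and>
        (\<forall>i < length us. i > 0 \<longrightarrow> us ! i \<noteq> []) \<and>
        (\<forall>j < length vs. Suc j < length vs \<longrightarrow> vs ! j \<noteq> []) \<and>
        w = concat (map2 (\<lambda>x y. map Inl x @ map Inr y) us vs))"

record ('s, 'a, 'b) two_tape_pda = "('s, 'a option + 'a option, 'b) dpda" +
  sharp_states :: "'s set"
  flat_states :: "'s set"

definition wf_two_tape_pda :: "'a set \<Rightarrow> ('s, 'a, 'b, 'z) two_tape_pda_scheme \<Rightarrow> bool" where
  "wf_two_tape_pda A T \<longleftrightarrow>
     wf_dpda T \<and>
     input_alphabet T = insert None (Some ` A) <+> insert None (Some ` A) \<and>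
     sharp_states T \<union> flat_states T = states T \<and> sharp_states T \<inter> flat_states T = {}"

definition two_tape_move ::
  "('s, 'a, 'b, 'z) two_tape_pda_scheme \<Rightarrow>
    ('a option + 'a option) list \<times> 'b list \<times> 's \<Rightarrow>
    ('a option + 'a option) list \<times> 'b list \<times> 's \<Rightarrow> bool" where
  "two_tape_move T c c' \<longleftrightarrow>
     (\<exists>x. dpda_step T x c c' \<and>
        (case x of
           None \<Rightarrow> True
         | Some (Inl _) \<Rightarrow> snd (snd c) \<in> sharp_states T
         | Some (Inr _) \<Rightarrow> snd (snd c) \<in> flat_states T))"

definition two_tape_language ::
  "'a set \<Rightarrow> acceptance_mode \<Rightarrow> ('s, 'a, 'b, 'z) two_tape_pda_scheme \<Rightarrow>
    ('a list \<times> 'a list) set" where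
  "two_tape_language A m T =
     {(u, v) \<in> lists A \<times> lists A.
        \<exists>w. is_shuffle (end_marked u) (end_marked v) w \<and>
          (\<exists>c \<in> accepting m T.
             (two_tape_move T)\<^sup>*\<^sup>* (w, [start_symbol T], start_state T) c)}"

definition is_two_tape_language :: "'a set \<Rightarrow> ('a list \<times> 'a list) set \<Rightarrow> bool" where
  "is_two_tape_language A R \<longleftrightarrow>
     (\<exists>(T :: (nat, 'a, nat) two_tape_pda) m.
        wf_two_tape_pda A T \<and> R = two_tape_language A m T)"

definition async_two_tape_parallel_poly_pushdown ::
  "'a set \<Rightarrow> ('a list \<times> 'a list) set \<Rightarrow> bool" where
  "async_two_tape_parallel_poly_pushdown A R \<longleftrightarrow>
     (\<exists>\<F>. finite \<F> \<and> \<F> \<noteq> {} \<and> (\<forall>K \<in> \<F>. is_two_tape_language A K) \<and> R = \<Inter>\<F>)"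


section \<open>Parallel poly-pushdown groups\<close>

definition word_value :: "('g, 'm) monoid_scheme \<Rightarrow> ('a \<Rightarrow> 'g) \<Rightarrow> 'a list \<Rightarrow> 'g" where
  "word_value G f w = foldr (\<lambda>a x. f a \<otimes>\<^bsub>G\<^esub> x) w \<one>\<^bsub>G\<^esub>"

definition parallel_poly_pushdown_structure ::
  "('g, 'm) monoid_scheme \<Rightarrow> 'a set \<Rightarrow> ('a \<Rightarrow> 'g) \<Rightarrow> 'a list set \<Rightarrow> bool" where
  "parallel_poly_pushdown_structure G A f L \<longleftrightarrow>
     L \<subseteq> lists A \<and>
     bij_betw (word_value G f) L (carrier G) \<and>
     parallel_poly_pushdown A L \<and>
     (\<forall>a \<in> A. async_two_tape_parallel_poly_pushdown A
        {(w, w'). w \<in> L \<and> w' \<in> L \<and> word_value G f w' = word_value G f (w @ [a])})"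

text \<open>
  The alphabet is a finite subset of \<^typ>\<open>nat\<close>, again without loss of generality.
\<close>

definition parallel_poly_pushdown_group :: "('g, 'm) monoid_scheme \<Rightarrow> bool" where
  "parallel_poly_pushdown_group G \<longleftrightarrow>
     group G \<and>
     (\<exists>(A :: nat set) f L.
        finite A \<and> f \<in> A \<rightarrow> carrier G \<and> word_value G f ` lists A = carrier G \<and>
        parallel_poly_pushdown_structure G A f L)"


section \<open>Free products\<close>

text \<open>
  The free product is realised by reduced words, i.e. words in the nontrivial elements of the
  factors in which neighbouring letters come from different factors. Two words are multiplied
  by adding the letters of the first one, from right to left, to the front of the second, merging
  letters of the same factor and dropping identities. The results \<open>group_free_product\<close>,
  \<open>free_product_inj_hom\<close>, \<open>free_product_universal\<close> and \<open>free_product_universal_unique\<close> below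
  establish the universal property.
\<close>

definition free_product_letters ::
  "('g, 'm) monoid_scheme \<Rightarrow> ('h, 'n) monoid_scheme \<Rightarrow> ('g + 'h) set" where
  "free_product_letters G H = (carrier G - {\<one>\<^bsub>G\<^esub>}) <+> (carrier H - {\<one>\<^bsub>H\<^esub>})"

definition reduced_words ::
  "('g, 'm) monoid_scheme \<Rightarrow> ('h, 'n) monoid_scheme \<Rightarrow> ('g + 'h) list set" where
  "reduced_words G H =
     {w \<in> lists (free_product_letters G H). successively (\<lambda>x y. isl x \<noteq> isl y) w}"

definition push_letter ::
  "('g, 'm) monoid_scheme \<Rightarrow> ('h, 'n) monoid_scheme \<Rightarrow>
    'g + 'h \<Rightarrow> ('g + 'h) list \<Rightarrow> ('g + 'h) list" where
  "push_letter G H x w = (if x = Inl \<one>\<^bsub>G\<^esub> \<or> x = Inr \<one>\<^bsub>H\<^esub> then w else x # w)"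

fun merge_letter ::
  "('g, 'm) monoid_scheme \<Rightarrow> ('h, 'n) monoid_scheme \<Rightarrow>
    'g + 'h \<Rightarrow> ('g + 'h) list \<Rightarrow> ('g + 'h) list" where
  "merge_letter G H (Inl g) (Inl g' # w) = push_letter G H (Inl (g \<otimes>\<^bsub>G\<^esub> g')) w"
| "merge_letter G H (Inr h) (Inr h' # w) = push_letter G H (Inr (h \<otimes>\<^bsub>H\<^esub> h')) w"
| "merge_letter G H x w = push_letter G H x w"

definition free_product ::
  "('g, 'm) monoid_scheme \<Rightarrow> ('h, 'n) monoid_scheme \<Rightarrow> ('g + 'h) list monoid" where
  "free_product G H =
     \<lparr>carrier = reduced_words G H,
      mult = (\<lambda>v w. foldr (merge_letter G H) v w),
      one = []\<rparr>"

lemma free_product_simps [simp]: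
  "carrier (free_product G H) = reduced_words G H"
  "x \<otimes>\<^bsub>free_product G H\<^esub> y = foldr (merge_letter G H) x y"
  "\<one>\<^bsub>free_product G H\<^esub> = []"
  by (simp_all add: free_product_def)

lemma Nil_reduced [simp]: "[] \<in> reduced_words G H"
  by (simp add: reduced_words_def)

lemma Cons_reduced:
  "x # w \<in> reduced_words G H \<longleftrightarrow>
     x \<in> free_product_letters G H \<and> w \<in> reduced_words G H \<and> (w = [] \<or> isl x \<noteq> isl (hd w))"
  by (cases w) (auto simp: reduced_words_def)

lemma free_product_letters_iff [simp]:
  "Inl g \<in> free_product_letters G H \<longleftrightarrow> g \<in> carrier G \<and> g \<noteq> \<one>\<^bsub>G\<^esub>"
  "Inr h \<in> free_product_letters G H \<longleftrightarrow> h \<in> carrier H \<and> h \<noteq> \<one>\<^bsub>H\<^esub>"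
  by (auto simp: free_product_letters_def)

locale two_groups = G: group G + H: group H
  for G :: "('g, 'm) monoid_scheme" and H :: "('h, 'n) monoid_scheme"
begin

abbreviation "mg \<equiv> merge_letter G H"
abbreviation "RW \<equiv> reduced_words G H"
abbreviation "cG \<equiv> carrier G <+> carrier H"

lemma mg_reduced: "x \<in> cG \<Longrightarrow> w \<in> RW \<Longrightarrow> mg x w \<in> RW"
  by (cases "(G, H, x, w)" rule: merge_letter.cases)
     (auto simp: push_letter_def Cons_reduced)

lemma mg_Inl_Inl:
  assumes "a \<in> carrier G" "b \<in> carrier G" "w \<in> RW"
  shows "mg (Inl a) (mg (Inl b) w) = mg (Inl (a \<otimes>\<^bsub>G\<^esub> b)) w"
proof (cases "\<exists>c v. w = Inl c # v")
  case True
  then obtain c v where w: "w = Inl c # v" by blast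
  have c: "c \<in> carrier G" "c \<noteq> \<one>\<^bsub>G\<^esub>" and v: "v = [] \<or> (\<exists>d v'. v = Inr d # v')"
    using assms(3) w by (auto simp: Cons_reduced) (metis list.exhaust_sel sum.collapse(2))
  show ?thesis
  proof (cases "b \<otimes>\<^bsub>G\<^esub> c = \<one>\<^bsub>G\<^esub>")
    case True
    then have "(a \<otimes>\<^bsub>G\<^esub> b) \<otimes>\<^bsub>G\<^esub> c = a"
      using assms c by (simp add: G.m_assoc)
    then show ?thesis using True v w by (auto simp: push_letter_def)
  next
    case False
    then show ?thesis using assms c w by (auto simp: push_letter_def G.m_assoc)
  qed
next
  case False
  then have w: "w = [] \<or> (\<exists>d v. w = Inr d # v)"
    by (metis list.exhaust sum.exhaust)
  then show ?thesis using assms by (auto simp: push_letter_def)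
qed

lemma mg_Inr_Inr:
  assumes "a \<in> carrier H" "b \<in> carrier H" "w \<in> RW"
  shows "mg (Inr a) (mg (Inr b) w) = mg (Inr (a \<otimes>\<^bsub>H\<^esub> b)) w"
proof (cases "\<exists>c v. w = Inr c # v")
  case True
  then obtain c v where w: "w = Inr c # v" by blast
  have c: "c \<in> carrier H" "c \<noteq> \<one>\<^bsub>H\<^esub>" and v: "v = [] \<or> (\<exists>d v'. v = Inl d # v')"
    using assms(3) w by (auto simp: Cons_reduced) (metis list.exhaust_sel sum.collapse(1))
  show ?thesis
  proof (cases "b \<otimes>\<^bsub>H\<^esub> c = \<one>\<^bsub>H\<^esub>")
    case True
    then have "(a \<otimes>\<^bsub>H\<^esub> b) \<otimes>\<^bsub>H\<^esub> c = a"
      using assms c by (simp add: H.m_assoc)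
    then show ?thesis using True v w by (auto simp: push_letter_def)
  next
    case False
    then show ?thesis using assms c w by (auto simp: push_letter_def H.m_assoc)
  qed
next
  case False
  then have w: "w = [] \<or> (\<exists>d v. w = Inl d # v)"
    by (metis list.exhaust sum.exhaust)
  then show ?thesis using assms by (auto simp: push_letter_def)
qed

lemma mg_one:
  assumes "w \<in> RW"
  shows "mg (Inl \<one>\<^bsub>G\<^esub>) w = w" "mg (Inr \<one>\<^bsub>H\<^esub>) w = w"
proof -
  consider "w = []" | g v where "w = Inl g # v" | h v where "w = Inr h # v"
    by (metis list.exhaust sum.exhaust)
  then have "mg (Inl \<one>\<^bsub>G\<^esub>) w = w \<and> mg (Inr \<one>\<^bsub>H\<^esub>) w = w"
    using assms by cases (auto simp: push_letter_def Cons_reduced)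
  then show "mg (Inl \<one>\<^bsub>G\<^esub>) w = w" "mg (Inr \<one>\<^bsub>H\<^esub>) w = w" by auto
qed

lemma letters_cG: "x \<in> free_product_letters G H \<Longrightarrow> x \<in> cG"
  by (auto simp: free_product_letters_def)

lemma foldr_reduced: "v \<in> lists cG \<Longrightarrow> w \<in> RW \<Longrightarrow> foldr mg v w \<in> RW"
  by (induction v) (auto intro!: mg_reduced)

lemma reduced_lists: "v \<in> RW \<Longrightarrow> v \<in> lists cG"
  by (auto simp: reduced_words_def letters_cG)

lemma foldr_mg:
  assumes "x \<in> cG" "v \<in> RW" "w \<in> RW"
  shows "foldr mg (mg x v) w = mg x (foldr mg v w)"
proof -
  have push: "foldr mg (push_letter G H y v') w = mg y (foldr mg v' w)"
    if "y \<in> cG" "v' \<in> RW" for y v'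
    using that assms(3) foldr_reduced[OF reduced_lists[of v'] assms(3)]
    by (auto simp: push_letter_def mg_one)
  consider g g' u where "x = Inl g" "v = Inl g' # u"
    | h h' u where "x = Inr h" "v = Inr h' # u"
    | "mg x v = push_letter G H x v"
    by (cases "(G, H, x, v)" rule: merge_letter.cases) auto
  then show ?thesis
  proof cases
    case 1
    then have "g \<in> carrier G" "g' \<in> carrier G" "u \<in> RW"
      using assms by (auto simp: Cons_reduced)
    then show ?thesis
      using 1 push[of "Inl (g \<otimes>\<^bsub>G\<^esub> g')" u] foldr_reduced[OF reduced_lists[of u] assms(3)]
      by (simp add: mg_Inl_Inl InlI)
  next
    case 2
    then have "h \<in> carrier H" "h' \<in> carrier H" "u \<in> RW"
      using assms by (auto simp: Cons_reduced)
    then show ?thesis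
      using 2 push[of "Inr (h \<otimes>\<^bsub>H\<^esub> h')" u] foldr_reduced[OF reduced_lists[of u] assms(3)]
      by (simp add: mg_Inr_Inr InrI)
  next
    case 3
    then show ?thesis using assms push[of x v] by simp
  qed
qed

lemma foldr_assoc:
  assumes "u \<in> lists cG" "v \<in> RW" "w \<in> RW"
  shows "foldr mg (foldr mg u v) w = foldr mg u (foldr mg v w)"
  using assms(1)
proof (induction u)
  case (Cons x u)
  then show ?case using assms foldr_reduced[of u v] by (auto simp: foldr_mg)
qed simp

lemma foldr_Nil: "v \<in> RW \<Longrightarrow> foldr mg v [] = v"
proof (induction v)
  case (Cons x v)
  then show ?case
    by (cases "(G, H, x, v)" rule: merge_letter.cases) (auto simp: Cons_reduced push_letter_def)
qed simp

lemma ex_left_inverse: "v \<in> RW \<Longrightarrow> \<exists>u \<in> RW. foldr mg u v = []"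
proof (induction v)
  case Nil
  then show ?case by (auto intro: bexI[of _ "[]"])
next
  case (Cons x v)
  then obtain u where u: "u \<in> RW" "foldr mg u v = []" and v: "v \<in> RW"
    by (auto simp: Cons_reduced)
  obtain y where y: "y \<in> free_product_letters G H" "mg y (x # v) = v"
  proof (cases x)
    case (Inl g)
    then have "g \<in> carrier G" "g \<noteq> \<one>\<^bsub>G\<^esub>" using Cons.prems by (auto simp: Cons_reduced)
    then show ?thesis using that[of "Inl (inv\<^bsub>G\<^esub> g)"] Inl
      by (simp add: push_letter_def G.l_inv G.inv_eq_1_iff)
  next
    case (Inr h)
    then have "h \<in> carrier H" "h \<noteq> \<one>\<^bsub>H\<^esub>" using Cons.prems by (auto simp: Cons_reduced)
    then show ?thesis using that[of "Inr (inv\<^bsub>H\<^esub> h)"] Inr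
      by (simp add: push_letter_def H.l_inv H.inv_eq_1_iff)
  qed
  have yr: "[y] \<in> RW" using y by (simp add: Cons_reduced)
  have "foldr mg (foldr mg u [y]) (x # v) = []"
    using foldr_assoc[OF reduced_lists[OF u(1)] yr Cons.prems] y u by simp
  moreover have "foldr mg u [y] \<in> RW" using foldr_reduced[OF reduced_lists[OF u(1)] yr] .
  ultimately show ?case by blast
qed

lemma group_free_product: "group (free_product G H)"
proof (rule groupI)
  fix x assume "x \<in> carrier (free_product G H)"
  then show "\<exists>y \<in> carrier (free_product G H). y \<otimes>\<^bsub>free_product G H\<^esub> x = \<one>\<^bsub>free_product G H\<^esub>"
    using ex_left_inverse by simp
qed (simp_all add: foldr_assoc reduced_lists foldr_reduced)

lemma free_product_inj_hom:
  "(\<lambda>g. push_letter G H (Inl g) []) \<in> hom G (free_product G H)"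
  "(\<lambda>h. push_letter G H (Inr h) []) \<in> hom H (free_product G H)"
  "inj_on (\<lambda>g. push_letter G H (Inl g) []) (carrier G)"
  "inj_on (\<lambda>h. push_letter G H (Inr h) []) (carrier H)"
  by (auto simp: hom_def push_letter_def Cons_reduced inj_on_def split: if_splits)

definition free_product_lift ::
  "('k, 'r) monoid_scheme \<Rightarrow> ('g \<Rightarrow> 'k) \<Rightarrow> ('h \<Rightarrow> 'k) \<Rightarrow> ('g + 'h) list \<Rightarrow> 'k" where
  "free_product_lift K p q w = foldr (\<lambda>x k. case_sum p q x \<otimes>\<^bsub>K\<^esub> k) w \<one>\<^bsub>K\<^esub>"

lemma free_product_universal:
  assumes "group K" "p \<in> hom G K" "q \<in> hom H K"
  shows "free_product_lift K p q \<in> hom (free_product G H) K"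
    and "g \<in> carrier G \<Longrightarrow> free_product_lift K p q (push_letter G H (Inl g) []) = p g"
    and "h \<in> carrier H \<Longrightarrow> free_product_lift K p q (push_letter G H (Inr h) []) = q h"
proof -
  interpret K: group K by fact
  interpret p: group_hom G K p by unfold_locales fact
  interpret q: group_hom H K q by unfold_locales fact
  let ?l = "free_product_lift K p q" and ?c = "case_sum p q"
  have c: "?c x \<in> carrier K" if "x \<in> cG" for x using that by auto
  have l: "?l w \<in> carrier K" if "w \<in> lists cG" for w
    using that unfolding free_product_lift_def by (induction w) (auto intro!: K.m_closed)
  have lC: "?l (x # w) = ?c x \<otimes>\<^bsub>K\<^esub> ?l w" for x w by (simp add: free_product_lift_def)
  have push: "?l (push_letter G H x w) = ?c x \<otimes>\<^bsub>K\<^esub> ?l w" if "w \<in> lists cG" for x w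
    using l[OF that] by (auto simp: push_letter_def lC)
  have mg: "?l (mg x w) = ?c x \<otimes>\<^bsub>K\<^esub> ?l w" if "x \<in> cG" "w \<in> lists cG" for x w
    using that l[unfolded in_lists_conv_set]
    by (cases "(G, H, x, w)" rule: merge_letter.cases) (auto simp: push lC K.m_assoc)
  have fold: "?l (foldr mg v w) = ?l v \<otimes>\<^bsub>K\<^esub> ?l w" if "v \<in> lists cG" "w \<in> RW" for v w
    using that(1)
  proof (induction v)
    case Nil
    then show ?case using l[OF reduced_lists[OF that(2)]] by (simp add: free_product_lift_def)
  next
    case (Cons x v)
    then have xv: "x \<in> cG" "v \<in> lists cG" by auto
    have "foldr mg v w \<in> lists cG"
      using foldr_reduced[OF xv(2) that(2)] reduced_lists by blast
    then have "?l (foldr mg (x # v) w) = ?c x \<otimes>\<^bsub>K\<^esub> (?l v \<otimes>\<^bsub>K\<^esub> ?l w)"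
      using mg[OF xv(1)] Cons.IH by simp
    then show ?case
      using c[OF xv(1)] l[OF xv(2)] l[OF reduced_lists[OF that(2)]] by (simp add: lC K.m_assoc)
  qed
  show "?l \<in> hom (free_product G H) K"
    by (rule homI) (simp_all add: l fold reduced_lists)
  show "g \<in> carrier G \<Longrightarrow> ?l (push_letter G H (Inl g) []) = p g"
    using push[of "[]" "Inl g"] by (simp add: free_product_lift_def)
  show "h \<in> carrier H \<Longrightarrow> ?l (push_letter G H (Inr h) []) = q h"
    using push[of "[]" "Inr h"] by (simp add: free_product_lift_def)
qed

lemma free_product_universal_unique:
  assumes "group K" "r \<in> hom (free_product G H) K" "r' \<in> hom (free_product G H) K"
    and "\<And>g. g \<in> carrier G \<Longrightarrow> r (push_letter G H (Inl g) []) = r' (push_letter G H (Inl g) [])"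
    and "\<And>h. h \<in> carrier H \<Longrightarrow> r (push_letter G H (Inr h) []) = r' (push_letter G H (Inr h) [])"
    and "w \<in> carrier (free_product G H)"
  shows "r w = r' w"
  using assms(6)
proof (induction w)
  case Nil
  show ?case
    using hom_one[OF assms(2) group_free_product assms(1)]
      hom_one[OF assms(3) group_free_product assms(1)] by simp
next
  case (Cons x w)
  then have xr: "[x] \<in> RW" and wr: "w \<in> RW" by (auto simp: Cons_reduced)
  have eq: "x # w = [x] \<otimes>\<^bsub>free_product G H\<^esub> w"
    using Cons.prems
    by (cases "(G, H, x, w)" rule: merge_letter.cases) (auto simp: Cons_reduced push_letter_def)
  have "r [x] = r' [x]"
  proof (cases x)
    case (Inl g)
    then show ?thesis using xr assms(4)[of g] by (simp add: Cons_reduced push_letter_def)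
  next
    case (Inr h)
    then show ?thesis using xr assms(5)[of h] by (simp add: Cons_reduced push_letter_def)
  qed
  then show ?case
    using Cons.IH wr xr hom_mult[OF assms(2), of "[x]" w] hom_mult[OF assms(3), of "[x]" w]
    unfolding eq by (simp del: free_product_simps(2))
qed

end

end

theory Submission
  imports Defs "HOL-Library.Countable"
begin

text \<open>
  Generators may represent the neutral element, so normal forms can carry markers: every word ends
  with an end letter and every block in it with a delimiter. A finite control can then cut the
  blocks out of its input deterministically and feed them to a given automaton, whose acceptance is
  tested at each delimiter. Hence ``all blocks lie in $K$'' is a deterministic pushdown condition if
  $K$ is, and likewise with two tapes.

  Normal forms of $G \times G'$ are pairs of normal forms. Normal forms of $G * G'$ are alternating
  sequences of blocks, the last one announced by a marker at its beginning. Right multiplication by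
  a generator of one factor changes at most the last block if it belongs to that factor (or appends
  a block), so it is described by two conditions: the last blocks are related as in the factor, the
  neutral element standing in for a missing block, and the other blocks agree.
\<close>

section \<open>Accepting runs\<close>

text \<open>A machine has one stack and can run only one given automaton at a time, whereas a normal
  form carries data of two factors and each factor comes with several automata. Closure under finite
  intersection removes this obstacle: each condition runs a single automaton, and the conjunction is
  formed outside the machines. This requires that all machines cut the same word into the same
  blocks, which holds because a sequence of delimited blocks is determined by its concatenation.

  The end letter of a normal form is forced by determinism: a control must know from its state alone
  whether it halts or reads on. Hence transducers on one tape have no transition from a final state.
  On two tapes the symbol \<open>$\<close> has the same effect, so that arbitrary final states are
  allowed there.

  Two-tape automata choose the order in which they consume their tapes. A control that translates
  both tapes for such an automaton must therefore have the next letter of either tape at hand, and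
  it determines the shuffle of its own input by the order in which it refills its buffers.\<close>

inductive accepts_from ::
  "('s, 'a, 'b, 'z) dpda_scheme \<Rightarrow> acceptance_mode \<Rightarrow> ('s \<Rightarrow> 'a \<Rightarrow> bool) \<Rightarrow>
    'a list \<Rightarrow> 'b list \<Rightarrow> 's \<Rightarrow> bool"
  for M m ok where
  accept: "(case m of Final_State \<Rightarrow> s \<in> final_states M | Empty_Stack \<Rightarrow> z = []) \<Longrightarrow>
    accepts_from M m ok [] z s"
| eps: "transition M (None, b, s) = Some (t, \<alpha>) \<Longrightarrow> accepts_from M m ok v (y @ \<alpha>) t \<Longrightarrow>
    accepts_from M m ok v (y @ [b]) s"
| read: "transition M (Some a, b, s) = Some (t, \<alpha>) \<Longrightarrow> ok s a \<Longrightarrow>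
    accepts_from M m ok v (y @ \<alpha>) t \<Longrightarrow> accepts_from M m ok (a # v) (y @ [b]) s"

text \<open>The guard lets one notion of run serve both kinds of automata: it is constantly true on
  one tape and expresses the partition into sharp and flat states on two.\<close>

definition guarded_move ::
  "('s, 'a, 'b, 'z) dpda_scheme \<Rightarrow> ('s \<Rightarrow> 'a \<Rightarrow> bool) \<Rightarrow>
    'a list \<times> 'b list \<times> 's \<Rightarrow> 'a list \<times> 'b list \<times> 's \<Rightarrow> bool" where
  "guarded_move M ok c c' \<longleftrightarrow>
     (\<exists>x. dpda_step M x c c' \<and> (case x of None \<Rightarrow> True | Some a \<Rightarrow> ok (snd (snd c)) a))"

lemma wf_transitionD:
  assumes "wf_dpda M" "transition M (x, b, s) = Some (t, \<alpha>)"
  shows "b \<in> stack_alphabet M" "s \<in> states M" "t \<in> states M" "\<alpha> \<in> lists (stack_alphabet M)"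
    and "x = Some a \<Longrightarrow> a \<in> input_alphabet M"
proof -
  have "(x, b, s) \<in> dom (transition M)" "(t, \<alpha>) \<in> ran (transition M)"
    using assms(2) by (auto simp: ran_def)
  then show "b \<in> stack_alphabet M" "s \<in> states M" "t \<in> states M"
    "\<alpha> \<in> lists (stack_alphabet M)" "x = Some a \<Longrightarrow> a \<in> input_alphabet M"
    using assms(1) unfolding wf_dpda_def by blast+
qed

text \<open>\<open>accepts_from\<close> unfolds a run from its first step, which suits the
  inductions below. The membership conditions in \<open>accepting\<close> are recovered from the
  initial description, since a well-formed transition map preserves them along the run.\<close>

lemma accepts_from_guarded_move:
  assumes wf: "wf_dpda M" and "z \<in> lists (stack_alphabet M)" "s \<in> states M"
  shows "(\<exists>c \<in> accepting m M. (guarded_move M ok)\<^sup>*\<^sup>* (w, z, s) c) \<longleftrightarrow> accepts_from M m ok w z s"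
proof
  assume "\<exists>c \<in> accepting m M. (guarded_move M ok)\<^sup>*\<^sup>* (w, z, s) c"
  then obtain c where c: "c \<in> accepting m M" and "(guarded_move M ok)\<^sup>*\<^sup>* (w, z, s) c" by blast
  from this(2) show "accepts_from M m ok w z s"
  proof (induction "(w, z, s)" arbitrary: w z s rule: converse_rtranclp_induct)
    case base
    then show ?case using c by (cases m) (auto simp: accepting_def intro: accepts_from.accept)
  next
    case (step c')
    obtain w' z' s' where c': "c' = (w', z', s')" by (cases c')
    from step(1) obtain x where
      x: "dpda_step M x (w, z, s) (w', z', s')" "case x of None \<Rightarrow> True | Some a \<Rightarrow> ok s a"
      unfolding guarded_move_def c' fst_conv snd_conv by blast
    from x(1) show ?case
      using x(2) step(3)[OF c']
      by cases (auto intro: accepts_from.eps accepts_from.read)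
  qed
next
  assume "accepts_from M m ok w z s"
  then show "\<exists>c \<in> accepting m M. (guarded_move M ok)\<^sup>*\<^sup>* (w, z, s) c"
    using assms(2,3)
  proof induction
    case (accept s z)
    then have "([], z, s) \<in> accepting m M" by (cases m) (auto simp: accepting_def)
    then show ?case by blast
  next
    case (eps b s t \<alpha> v y)
    have "guarded_move M ok (v, y @ [b], s) (v, y @ \<alpha>, t)"
      unfolding guarded_move_def using dpda_eps[OF eps(1)] by fastforce
    moreover have "y @ \<alpha> \<in> lists (stack_alphabet M)" "t \<in> states M"
      using eps.prems wf_transitionD[OF wf eps(1)] by auto
    ultimately show ?case
      using eps.IH by (blast intro: converse_rtranclp_into_rtranclp)
  next
    case (read a b s t \<alpha> v y)
    have "guarded_move M ok (a # v, y @ [b], s) (v, y @ \<alpha>, t)"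
      unfolding guarded_move_def using dpda_read[OF read(1)] read(2) by fastforce
    moreover have "y @ \<alpha> \<in> lists (stack_alphabet M)" "t \<in> states M"
      using read.prems wf_transitionD[OF wf read(1)] by auto
    ultimately show ?case
      using read.IH by (blast intro: converse_rtranclp_into_rtranclp)
  qed
qed

lemma accepts_from_lists:
  assumes "wf_dpda M" "accepts_from M m ok w z s"
  shows "w \<in> lists (input_alphabet M)"
  using assms(2) by induction (auto dest: wf_transitionD[OF assms(1)])

lemma dpda_language_accepts_from:
  assumes "wf_dpda M"
  shows "dpda_language m M =
    {w. accepts_from M m (\<lambda>_ _. True) w [start_symbol M] (start_state M)}"
proof -
  have "dpda_move M = guarded_move M (\<lambda>_ _. True)"
    by (intro ext) (simp only: dpda_move_def guarded_move_def option.case_eq_if if_cancel simp_thms)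
  moreover have "[start_symbol M] \<in> lists (stack_alphabet M)" "start_state M \<in> states M"
    using assms by (auto simp: wf_dpda_def)
  ultimately show ?thesis
    using accepts_from_lists[OF assms]
    by (simp add: dpda_language_def accepts_from_guarded_move[OF assms]
        del: in_lists_conv_set) blast
qed

section \<open>Shuffles and the two-tape language\<close>

definition tape_ok :: "('s, 'a, 'b, 'z) two_tape_pda_scheme \<Rightarrow> 's \<Rightarrow> 'a option + 'a option \<Rightarrow> bool"
  where "tape_ok T s x \<longleftrightarrow> (if isl x then s \<in> sharp_states T else s \<in> flat_states T)"

fun lefts :: "('x + 'y) list \<Rightarrow> 'x list" where
  "lefts [] = []"
| "lefts (Inl x # w) = x # lefts w"
| "lefts (Inr y # w) = lefts w"

fun rights :: "('x + 'y) list \<Rightarrow> 'y list" where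
  "rights [] = []"
| "rights (Inl x # w) = rights w"
| "rights (Inr y # w) = y # rights w"

lemma lefts_append [simp]: "lefts (v @ w) = lefts v @ lefts w"
  by (induction v rule: lefts.induct) auto

lemma rights_append [simp]: "rights (v @ w) = rights v @ rights w"
  by (induction v rule: rights.induct) auto

lemma lefts_map [simp]: "lefts (map Inl u) = u" "lefts (map Inr v) = []"
  by (induction u, simp_all) (induction v, simp_all)

lemma rights_map [simp]: "rights (map Inl u) = []" "rights (map Inr v) = v"
  by (induction u, simp_all) (induction v, simp_all)

lemma lefts_rights_lists: "w \<in> lists (A <+> B) \<longleftrightarrow> lefts w \<in> lists A \<and> rights w \<in> lists B"
  by (induction w rule: lefts.induct) auto

lemma lefts_rights_interleave:
  assumes "length us = length vs"
  shows "lefts (concat (map2 (\<lambda>x y. map Inl x @ map Inr y) us vs)) = concat us"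
    and "rights (concat (map2 (\<lambda>x y. map Inl x @ map Inr y) us vs)) = concat vs"
  using assms by (induction us vs rule: list_induct2) simp_all

text \<open>Factors are collected from the right end of the word. A sharp letter always joins the
  first sharp factor; a flat letter joins the first flat factor if the sharp factor before it is
  empty, and otherwise opens a new pair with empty sharp factor. So only the first sharp and the
  last flat factor can be empty.\<close>

lemma ex_interleave:
  "\<exists>us vs. length us = length vs \<and> [] \<notin> set (tl us) \<and> [] \<notin> set (butlast vs) \<and>
     w = concat (map2 (\<lambda>x y. map Inl x @ map Inr y) us vs)" (is "\<exists>us vs. ?P w us vs")
proof (induction w rule: lefts.induct)
  case 1
  have "?P [] [] []" by simp
  then show ?case by blast
next
  case (2 x w)
  then obtain us vs where *: "?P w us vs" by blast
  show ?case
  proof (cases us)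
    case Nil
    then have "?P (Inl x # w) [[x]] [[]]" using * by simp
    then show ?thesis by blast
  next
    case (Cons u1 us')
    then obtain v1 vs' where "vs = v1 # vs'" using * by (cases vs) simp_all
    then have "?P (Inl x # w) ((x # u1) # us') vs" using * Cons by simp
    then show ?thesis by blast
  qed
next
  case (3 y w)
  then obtain us vs where *: "?P w us vs" by blast
  show ?case
  proof (cases us)
    case Nil
    then have "?P (Inr y # w) [[]] [[y]]" using * by simp
    then show ?thesis by blast
  next
    case (Cons u1 us')
    then obtain v1 vs' where vs: "vs = v1 # vs'" using * by (cases vs) simp_all
    show ?thesis
    proof (cases "u1 = []")
      case True
      then have "?P (Inr y # w) us ((y # v1) # vs')"
        using * Cons vs by (cases vs') simp_all
      then show ?thesis by blast
    next
      case False
      then have "?P (Inr y # w) ([] # us) ([y] # vs)" using * Cons vs by simp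
      then show ?thesis by blast
    qed
  qed
qed

text \<open>Every interleaving can be cut into maximal runs that satisfy the nonemptiness
  conditions. From here on a shuffle is a word with prescribed projections.\<close>

lemma is_shuffle_iff: "is_shuffle u v w \<longleftrightarrow> lefts w = u \<and> rights w = v"
proof
  assume "is_shuffle u v w"
  then show "lefts w = u \<and> rights w = v"
    unfolding is_shuffle_def using lefts_rights_interleave by blast
next
  assume w: "lefts w = u \<and> rights w = v"
  obtain us vs where *: "length us = length vs" "[] \<notin> set (tl us)" "[] \<notin> set (butlast vs)"
    "w = concat (map2 (\<lambda>x y. map Inl x @ map Inr y) us vs)"
    using ex_interleave by blast
  have "us ! i \<noteq> []" if "i < length us" "i > 0" for i
    using *(2) that by (cases us) (auto simp: in_set_conv_nth gr0_conv_Suc)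
  moreover have "vs ! j \<noteq> []" if "Suc j < length vs" for j
  proof -
    have "j < length (butlast vs)" using that by simp
    then show ?thesis using *(3) nth_mem nth_butlast by metis
  qed
  moreover have "concat us = u" "concat vs = v"
    using lefts_rights_interleave[OF *(1)] *(4) w by simp_all
  ultimately show "is_shuffle u v w"
    unfolding is_shuffle_def using *(1,4) by (intro exI[of _ us] exI[of _ vs]) simp
qed

lemma two_tape_language_accepts_from:
  assumes "wf_dpda T"
  shows "two_tape_language A m T = {(u, v) \<in> lists A \<times> lists A.
    \<exists>w. lefts w = end_marked u \<and> rights w = end_marked v \<and>
      accepts_from T m (tape_ok T) w [start_symbol T] (start_state T)}"
proof -
  have "two_tape_move T = guarded_move T (tape_ok T)"
    unfolding two_tape_move_def guarded_move_def tape_ok_def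
    by (intro ext ex_cong1 conj_cong refl) (simp split: option.split sum.split)
  moreover have "[start_symbol T] \<in> lists (stack_alphabet T)" "start_state T \<in> states T"
    using assms by (auto simp: wf_dpda_def)
  ultimately show ?thesis
    unfolding two_tape_language_def is_shuffle_iff
    by (auto simp: accepts_from_guarded_move[OF assms])
qed

section \<open>Deterministic machines over arbitrary countable types\<close>

text \<open>\<open>act s b\<close> is \<open>Inl f\<close> where the machine reads and
  \<open>Inr r\<close> where it moves silently, so the dichotomy demanded of a deterministic
  transition map is built into the type.\<close>

inductive run_accepts ::
  "('s \<Rightarrow> 'b \<Rightarrow> ('y \<Rightarrow> 's \<times> 'b list) + ('s \<times> 'b list)) \<Rightarrow> 's set \<Rightarrow> ('s \<Rightarrow> 'y \<Rightarrow> bool) \<Rightarrow>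
    'y list \<Rightarrow> 'b list \<Rightarrow> 's \<Rightarrow> bool"
  for act F ok where
  accept: "s \<in> F \<Longrightarrow> run_accepts act F ok [] z s"
| eps: "act s b = Inr (t, \<alpha>) \<Longrightarrow> run_accepts act F ok v (y @ \<alpha>) t \<Longrightarrow>
    run_accepts act F ok v (y @ [b]) s"
| read: "act s b = Inl f \<Longrightarrow> f a = (t, \<alpha>) \<Longrightarrow> ok s a \<Longrightarrow> run_accepts act F ok v (y @ \<alpha>) t \<Longrightarrow>
    run_accepts act F ok (a # v) (y @ [b]) s"

definition code_target :: "'s::countable \<times> 'b::countable list \<Rightarrow> nat \<times> nat list" where
  "code_target r = (to_nat (fst r), map to_nat (snd r))"

definition coded_transition ::
  "'y set \<Rightarrow> 's::countable set \<Rightarrow> 'b::countable set \<Rightarrow>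
    ('s \<Rightarrow> 'b \<Rightarrow> ('y \<Rightarrow> 's \<times> 'b list) + ('s \<times> 'b list)) \<Rightarrow>
    'y option \<times> nat \<times> nat \<rightharpoonup> nat \<times> nat list" where
  "coded_transition Y S B act = (\<lambda>(x, b, s).
     if b \<in> to_nat ` B \<and> s \<in> to_nat ` S
     then (case (act (from_nat s) (from_nat b), x) of
         (Inl f, Some y) \<Rightarrow> if y \<in> Y then Some (code_target (f y)) else None
       | (Inr r, None) \<Rightarrow> Some (code_target r)
       | _ \<Rightarrow> None)
     else None)"

text \<open>The extension \<open>z\<close> of the record is left open: with \<open>()\<close> the
  result is a one-tape automaton, with sharp and flat states it is a two-tape automaton.\<close>

definition coded_dpda ::
  "'y set \<Rightarrow> 's::countable set \<Rightarrow> 'b::countable set \<Rightarrow>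
    ('s \<Rightarrow> 'b \<Rightarrow> ('y \<Rightarrow> 's \<times> 'b list) + ('s \<times> 'b list)) \<Rightarrow> 's \<Rightarrow> 'b \<Rightarrow> 's set \<Rightarrow> 'z \<Rightarrow>
    (nat, 'y, nat, 'z) dpda_scheme" where
  "coded_dpda Y S B act s0 b0 F z =
     \<lparr>states = to_nat ` S, input_alphabet = Y, stack_alphabet = to_nat ` B,
      transition = coded_transition Y S B act, start_state = to_nat s0,
      start_symbol = to_nat b0, final_states = to_nat ` F, \<dots> = z\<rparr>"

lemma coded_dpda_simps [simp]:
  "states (coded_dpda Y S B act s0 b0 F z) = to_nat ` S"
  "input_alphabet (coded_dpda Y S B act s0 b0 F z) = Y"
  "stack_alphabet (coded_dpda Y S B act s0 b0 F z) = to_nat ` B"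
  "transition (coded_dpda Y S B act s0 b0 F z) = coded_transition Y S B act"
  "start_state (coded_dpda Y S B act s0 b0 F z) = to_nat s0"
  "start_symbol (coded_dpda Y S B act s0 b0 F z) = to_nat b0"
  "final_states (coded_dpda Y S B act s0 b0 F z) = to_nat ` F"
  by (simp_all add: coded_dpda_def)

text \<open>The types of states and stack symbols may be infinite; finite sets \<open>S\<close> and
  \<open>B\<close> closed under \<open>act\<close> cut the automaton out of them.\<close>

locale closed_machine =
  fixes Y :: "'y set" and S :: "'s::countable set" and B :: "'b::countable set"
    and act :: "'s \<Rightarrow> 'b \<Rightarrow> ('y \<Rightarrow> 's \<times> 'b list) + ('s \<times> 'b list)"
    and s0 :: 's and b0 :: 'b and F :: "'s set"
  assumes fin: "finite Y" "finite S" "finite B"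
    and start: "s0 \<in> S" "b0 \<in> B" "F \<subseteq> S"
    and closed_read: "s \<in> S \<Longrightarrow> b \<in> B \<Longrightarrow> act s b = Inl f \<Longrightarrow> y \<in> Y \<Longrightarrow> f y \<in> S \<times> lists B"
    and closed_eps: "s \<in> S \<Longrightarrow> b \<in> B \<Longrightarrow> act s b = Inr r \<Longrightarrow> r \<in> S \<times> lists B"
begin

lemma coded_transition_Some:
  "coded_transition Y S B act (x, b, s) = Some (t, \<alpha>) \<longleftrightarrow>
    (\<exists>b' s' t' \<alpha>'. b = to_nat b' \<and> s = to_nat s' \<and> t = to_nat t' \<and> \<alpha> = map to_nat \<alpha>' \<and>
      b' \<in> B \<and> s' \<in> S \<and> t' \<in> S \<and> \<alpha>' \<in> lists B \<and>
      (case x of None \<Rightarrow> act s' b' = Inr (t', \<alpha>')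
       | Some y \<Rightarrow> y \<in> Y \<and> (\<exists>f. act s' b' = Inl f \<and> f y = (t', \<alpha>'))))" (is "?l \<longleftrightarrow> ?r")
proof
  assume l: ?l
  then obtain b' s' where bs: "b = to_nat b'" "s = to_nat s'" "b' \<in> B" "s' \<in> S"
    by (auto simp: coded_transition_def split: if_splits)
  show ?r
  proof (cases "act s' b'")
    case (Inl f)
    then obtain y where "x = Some y" "y \<in> Y" "code_target (f y) = (t, \<alpha>)"
      using l bs by (auto simp: coded_transition_def split: option.splits if_splits)
    then show ?thesis
      using closed_read[OF bs(4,3) Inl, of y] bs Inl
      by (intro exI[of _ b'] exI[of _ s'] exI[of _ "fst (f y)"] exI[of _ "snd (f y)"])
        (auto simp: code_target_def)
  next
    case (Inr r)
    then have "x = None" "code_target r = (t, \<alpha>)"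
      using l bs by (auto simp: coded_transition_def split: option.splits if_splits)
    then show ?thesis
      using closed_eps[OF bs(4,3) Inr] bs Inr
      by (intro exI[of _ b'] exI[of _ s'] exI[of _ "fst r"] exI[of _ "snd r"])
        (auto simp: code_target_def)
  qed
next
  assume ?r
  then show ?l
    by (cases x) (auto simp: coded_transition_def code_target_def)
qed

lemma wf_coded_dpda: "wf_dpda (coded_dpda Y S B act s0 b0 F z)"
proof -
  have "dom (coded_transition Y S B act) \<subseteq> insert None (Some ` Y) \<times> to_nat ` B \<times> to_nat ` S"
    by (auto simp: coded_transition_Some split: option.splits)
  moreover have "ran (coded_transition Y S B act) \<subseteq> to_nat ` S \<times> lists (to_nat ` B)"
  proof
    fix r assume "r \<in> ran (coded_transition Y S B act)"
    then obtain x b s where "coded_transition Y S B act (x, b, s) = Some (fst r, snd r)"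
      by (auto simp: ran_def)
    then show "r \<in> to_nat ` S \<times> lists (to_nat ` B)"
      unfolding coded_transition_Some by (cases r) auto
  qed
  moreover have "((None, b, s) \<in> dom (coded_transition Y S B act) \<and>
           (\<forall>a \<in> Y. (Some a, b, s) \<notin> dom (coded_transition Y S B act))) \<or>
        ((None, b, s) \<notin> dom (coded_transition Y S B act) \<and>
           (\<forall>a \<in> Y. (Some a, b, s) \<in> dom (coded_transition Y S B act)))"
    if "b \<in> to_nat ` B" "s \<in> to_nat ` S" for b s
    using that by (cases "act (from_nat s) (from_nat b)") (auto simp: coded_transition_def dom_def)
  ultimately show ?thesis
    using fin start by (auto simp: wf_dpda_def)
qed

text \<open>The condition \<open>y \<in> Y\<close> enters the guard because the functions in
  \<open>act\<close> are total on the type of letters, while the coded automaton reads only letters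
  of \<open>Y\<close>.\<close>

lemma accepts_coded_dpda:
  assumes "z \<in> lists B" "s \<in> S"
    and ok: "\<And>s y. s \<in> S \<Longrightarrow> y \<in> Y \<Longrightarrow> ok (to_nat s) y \<longleftrightarrow> ok' s y"
  shows "accepts_from (coded_dpda Y S B act s0 b0 F u) Final_State ok w (map to_nat z) (to_nat s)
    \<longleftrightarrow> run_accepts act F (\<lambda>s y. y \<in> Y \<and> ok' s y) w z s"
proof
  assume "accepts_from (coded_dpda Y S B act s0 b0 F u) Final_State ok w (map to_nat z) (to_nat s)"
  then show "run_accepts act F (\<lambda>s y. y \<in> Y \<and> ok' s y) w z s"
    using assms(1,2)
  proof (induction w "map to_nat z" "to_nat s" arbitrary: z s)
    case accept
    then show ?case by (auto intro: run_accepts.accept)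
  next
    case (eps b t \<alpha> v y)
    obtain z' b' where z: "z = z' @ [b']" "y = map to_nat z'" "b = to_nat b'"
      using eps(4) by (cases z rule: rev_cases) auto
    obtain t' \<alpha>' where *: "t = to_nat t'" "\<alpha> = map to_nat \<alpha>'" "t' \<in> S" "\<alpha>' \<in> lists B"
      "act s b' = Inr (t', \<alpha>')"
      using eps(1) unfolding coded_dpda_simps coded_transition_Some z by auto
    then show ?case
      using eps(3)[of "z' @ \<alpha>'" t'] eps(5) z by (auto intro: run_accepts.eps)
  next
    case (read a b t \<alpha> v y)
    obtain z' b' where z: "z = z' @ [b']" "y = map to_nat z'" "b = to_nat b'"
      using read(5) by (cases z rule: rev_cases) auto
    obtain t' \<alpha>' f where *: "t = to_nat t'" "\<alpha> = map to_nat \<alpha>'" "t' \<in> S" "\<alpha>' \<in> lists B"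
      "act s b' = Inl f" "f a = (t', \<alpha>')" "a \<in> Y"
      using read(1) unfolding coded_dpda_simps coded_transition_Some z by auto
    then show ?case
      using read(4)[of "z' @ \<alpha>'" t'] read(2,6,7) z ok by (auto intro: run_accepts.read)
  qed
next
  assume "run_accepts act F (\<lambda>s y. y \<in> Y \<and> ok' s y) w z s"
  then show "accepts_from (coded_dpda Y S B act s0 b0 F u) Final_State ok w (map to_nat z) (to_nat s)"
    using assms(1,2)
  proof induction
    case (accept s z)
    then show ?case by (auto intro: accepts_from.accept)
  next
    case (eps s b t \<alpha> v y)
    then have "t \<in> S" "\<alpha> \<in> lists B" using closed_eps[of s b] by auto
    then have "coded_transition Y S B act (None, to_nat b, to_nat s) = Some (to_nat t, map to_nat \<alpha>)"
      unfolding coded_transition_Some using eps by fastforce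
    then show ?case
      using eps \<open>t \<in> S\<close> \<open>\<alpha> \<in> lists B\<close> accepts_from.eps[of "coded_dpda Y S B act s0 b0 F u"] by auto
  next
    case (read s b f a t \<alpha> v y)
    then have "t \<in> S" "\<alpha> \<in> lists B" using closed_read[of s b f a] by auto
    then have "coded_transition Y S B act (Some a, to_nat b, to_nat s) = Some (to_nat t, map to_nat \<alpha>)"
      unfolding coded_transition_Some using read by fastforce
    then show ?case
      using read \<open>t \<in> S\<close> \<open>\<alpha> \<in> lists B\<close> accepts_from.read[of "coded_dpda Y S B act s0 b0 F u"] ok
      by auto
  qed
qed

lemma language_coded_dpda:
  "dpda_language Final_State (coded_dpda Y S B act s0 b0 F z) =
    {w. run_accepts act F (\<lambda>s y. y \<in> Y) w [b0] s0}"
  using accepts_coded_dpda[of "[b0]" s0 "\<lambda>_ _. True" "\<lambda>_ _. True" z] start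
  by (simp add: dpda_language_accepts_from wf_coded_dpda)

end

section \<open>Finite control over a simulated automaton\<close>

text \<open>
  The argument of \<open>Feed\<close> is the tape the simulated automaton wants to read (\<^term>\<open>True\<close> for the
  sharp one). \<open>Check\<close> demands that the word fed since the last check be accepted and starts the
  simulation afresh.
\<close>

datatype ('q, 'x, 'y) control =
    Read "'y \<Rightarrow> 'q option"
  | Feed "bool \<Rightarrow> ('x \<times> 'q) option"
  | Check 'q
  | Halt

text \<open>The head of \<open>bs\<close> is the word fed up to the next check. The tape
  \<open>k\<close> of a \<open>Feed\<close> is free here; in a simulation the state of the simulated
  automaton determines it through \<open>kind\<close>.\<close>

inductive produces :: "('q \<Rightarrow> ('q, 'x, 'y) control) \<Rightarrow> 'q \<Rightarrow> 'y list \<Rightarrow> 'x list list \<Rightarrow> bool"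
  for ctl where
  Halt: "ctl q = Halt \<Longrightarrow> produces ctl q [] []"
| Read: "ctl q = Read f \<Longrightarrow> f y = Some q' \<Longrightarrow> produces ctl q' w bs \<Longrightarrow> produces ctl q (y # w) bs"
| Feed: "ctl q = Feed e \<Longrightarrow> e k = Some (x, q') \<Longrightarrow> produces ctl q' w (b # bs) \<Longrightarrow>
    produces ctl q w ((x # b) # bs)"
| Check: "ctl q = Check q' \<Longrightarrow> produces ctl q' w bs \<Longrightarrow> produces ctl q w ([] # bs)"

locale control_machine =
  fixes M :: "(nat, 'x, nat, 'z) dpda_scheme" and m :: acceptance_mode
    and ok :: "nat \<Rightarrow> 'x \<Rightarrow> bool" and kind :: "nat \<Rightarrow> bool"
    and ctl :: "'q::countable \<Rightarrow> ('q, 'x, 'y) control" and Q :: "'q set" and q0 :: 'q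
    and Y :: "'y set" and ok' :: "'q option \<Rightarrow> 'y \<Rightarrow> bool"
  assumes wf: "wf_dpda M" and finite_Y: "finite Y" and finite_Q: "finite Q" and q0: "q0 \<in> Q"
    and closed_Read: "q \<in> Q \<Longrightarrow> ctl q = Read f \<Longrightarrow> y \<in> Y \<Longrightarrow> f y = Some q' \<Longrightarrow> q' \<in> Q"
    and closed_Feed: "q \<in> Q \<Longrightarrow> ctl q = Feed e \<Longrightarrow> e k = Some (x, q') \<Longrightarrow> q' \<in> Q"
    and closed_Check: "q \<in> Q \<Longrightarrow> ctl q = Check q' \<Longrightarrow> q' \<in> Q"
    and Feed_ok: "ctl q = Feed e \<Longrightarrow> e k = Some (x, q') \<Longrightarrow> s \<in> states M \<Longrightarrow>
      ok s x \<longleftrightarrow> kind s = k"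
    and Read_ok: "ctl q = Read f \<Longrightarrow> f y = Some q' \<Longrightarrow> ok' (Some q) y"
begin

text \<open>With the bottom marker on top the simulated stack is empty and no move is possible,
  hence the dead state. Silent moves come before \<open>alt\<close>, as determinism of
  \<open>M\<close> excludes reading where a silent move exists.\<close>

definition simulate ::
  "'q \<Rightarrow> nat \<Rightarrow> nat option \<Rightarrow> (nat \<Rightarrow> ('q \<times> nat option) option \<times> nat option list) \<Rightarrow>
    ('q \<times> nat option) option \<times> nat option list" where
  "simulate q s tos alt = (case tos of
     None \<Rightarrow> (None, [tos])
   | Some b \<Rightarrow> (case transition M (None, b, s) of
       Some (t, \<alpha>) \<Rightarrow> (Some (q, Some t), map Some \<alpha>)
     | None \<Rightarrow> alt b))"

text \<open>A simulation starts lazily, at the first \<open>Feed\<close> or \<open>Check\<close> of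
  a block, so empty blocks are covered as well. The symbol \<open>tos\<close> is put back because
  every move pops one symbol.\<close>

definition initiate :: "'q \<Rightarrow> nat option \<Rightarrow> ('q \<times> nat option) option \<times> nat option list" where
  "initiate q tos = (Some (q, Some (start_state M)), [tos, None, Some (start_symbol M)])"

text \<open>
  The state \<^term>\<open>None\<close> is a dead state; in \<^term>\<open>Some (q, c)\<close> the component \<open>c\<close> is the state of the
  simulated automaton, if one is running. Each simulated automaton works on tos of its own bottom
  marker \<^term>\<open>None\<close>, so what earlier ones left on the stack is never seen again.
\<close>

definition action ::
  "('q \<times> nat option) option \<Rightarrow> nat option \<Rightarrow>
    ('y \<Rightarrow> ('q \<times> nat option) option \<times> nat option list) +
    (('q \<times> nat option) option \<times> nat option list)" where
  "action st tos = (case st of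
     None \<Rightarrow> Inr (None, [tos])
   | Some (q, c) \<Rightarrow> (case ctl q of
       Halt \<Rightarrow> Inr (None, [tos])
     | Read f \<Rightarrow> Inl (\<lambda>y. (map_option (\<lambda>q'. (q', c)) (f y), [tos]))
     | Feed e \<Rightarrow> Inr (case c of
         None \<Rightarrow> initiate q tos
       | Some s \<Rightarrow> simulate q s tos (\<lambda>b. case e (kind s) of
           None \<Rightarrow> (None, [tos])
         | Some (x, q') \<Rightarrow> (case transition M (Some x, b, s) of
             None \<Rightarrow> (None, [tos])
           | Some (t, \<alpha>) \<Rightarrow> (Some (q', Some t), map Some \<alpha>))))
     | Check q' \<Rightarrow> Inr (case c of
         None \<Rightarrow> initiate q tos
       | Some s \<Rightarrow>
           if (case m of Final_State \<Rightarrow> s \<in> final_states M | Empty_Stack \<Rightarrow> tos = None)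
           then (Some (q', None), [tos])
           else simulate q s tos (\<lambda>b. (None, [tos])))))"

definition control_states :: "('q \<times> nat option) option set" where
  "control_states = insert None (Some ` (Q \<times> insert None (Some ` states M)))"

definition control_stack :: "nat option set" where
  "control_stack = insert None (Some ` stack_alphabet M)"

text \<open>The component \<open>None\<close> ensures that no block is left unchecked when the
  control halts.\<close>

definition control_final :: "('q \<times> nat option) option set" where
  "control_final = {Some (q, None) | q. q \<in> Q \<and> ctl q = Halt}"

lemma transition_closed:
  assumes "transition M (x, b, s) = Some (t, \<alpha>)" "q \<in> Q"
  shows "(Some (q, Some t), map Some \<alpha>) \<in> control_states \<times> lists control_stack"
  using wf_transitionD(3,4)[OF wf assms(1)] assms(2)
  by (auto simp: control_states_def control_stack_def)

lemma simulate_closed: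
  assumes "q \<in> Q" "tos \<in> control_stack" "\<And>b. alt b \<in> control_states \<times> lists control_stack"
  shows "simulate q s tos alt \<in> control_states \<times> lists control_stack"
  using assms transition_closed
  by (auto simp: simulate_def control_states_def control_stack_def
      simp del: in_lists_conv_set split: option.splits)

lemma initiate_closed:
  "q \<in> Q \<Longrightarrow> tos \<in> control_stack \<Longrightarrow> initiate q tos \<in> control_states \<times> lists control_stack"
  using wf by (auto simp: initiate_def control_states_def control_stack_def wf_dpda_def)

sublocale closed_machine Y control_states control_stack action "Some (q0, None)" None control_final
proof
  show "finite Y" "finite control_states" "finite control_stack"
    using finite_Y finite_Q wf by (auto simp: control_states_def control_stack_def wf_dpda_def)
  show "Some (q0, None) \<in> control_states" "None \<in> control_stack" "control_final \<subseteq> control_states"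
    using q0 by (auto simp: control_states_def control_stack_def control_final_def)
  fix s b assume sb: "s \<in> control_states" "b \<in> control_stack"
  show "f y \<in> control_states \<times> lists control_stack" if f: "action s b = Inl f" "y \<in> Y" for f y
  proof -
    obtain q c where s: "s = Some (q, c)" "q \<in> Q" "c \<in> insert None (Some ` states M)"
      using sb f by (cases s) (auto simp: control_states_def action_def)
    obtain g where g: "ctl q = Read g" "f = (\<lambda>y. (map_option (\<lambda>q'. (q', c)) (g y), [b]))"
      using f s by (auto simp: action_def split: control.splits)
    then show ?thesis
      using closed_Read[OF s(2) g(1) f(2)] s(3) sb(2)
      by (cases "g y") (auto simp: control_states_def)
  qed
  show "r \<in> control_states \<times> lists control_stack" if r: "action s b = Inr r" for r
  proof (cases s)
    case None
    then show ?thesis using sb r by (auto simp: action_def)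
  next
    case (Some qc)
    obtain q c where s: "s = Some (q, c)" "q \<in> Q" "c \<in> insert None (Some ` states M)"
      using sb Some by (cases qc) (auto simp: control_states_def)
    have dead: "(None, [b]) \<in> control_states \<times> lists control_stack"
      using sb by (auto simp: control_states_def)
    show ?thesis
    proof (cases "ctl q")
      case (Feed e)
      have "(case e (kind t) of
           None \<Rightarrow> (None, [b])
         | Some (x, q') \<Rightarrow> (case transition M (Some x, d, t) of
             None \<Rightarrow> (None, [b])
           | Some (t, \<alpha>) \<Rightarrow> (Some (q', Some t), map Some \<alpha>)))
          \<in> control_states \<times> lists control_stack" for d t
        using dead closed_Feed[OF s(2) Feed] transition_closed
        by (simp del: in_lists_conv_set mem_Times_iff split: option.split) blast
      then show ?thesis
        using r sb s Feed initiate_closed simulate_closed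
        by (cases c) (auto simp: action_def)
    next
      case (Check q')
      have "(Some (q', None), [b]) \<in> control_states \<times> lists control_stack"
        using sb closed_Check[OF s(2) Check] by (auto simp: control_states_def)
      then show ?thesis
        using r sb s Check initiate_closed simulate_closed[OF s(2) sb(2), of "\<lambda>_. (None, [b])"] dead
        by (cases c) (auto simp: action_def split: if_splits)
    qed (use r s dead in \<open>auto simp: action_def\<close>)
  qed
qed

section \<open>Correctness of the simulation\<close>

abbreviation "guard st y \<equiv> y \<in> Y \<and> ok' (map_option fst st) y"

abbreviation "sim_accepts \<equiv> run_accepts action control_final guard"

abbreviation "block_accepted b \<equiv> accepts_from M m ok b [start_symbol M] (start_state M)"

text \<open>As \<open>map Some z\<close> contains no \<open>None\<close>, the top symbol tells
  whether the simulated stack \<open>z\<close> is empty.\<close>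

lemma marked_stack_eq_snoc:
  "J @ None # map Some z = y @ [tos] \<longleftrightarrow>
    (case tos of None \<Rightarrow> z = [] \<and> y = J
     | Some b \<Rightarrow> (\<exists>z'. z = z' @ [b] \<and> y = J @ None # map Some z'))"
  by (cases z rule: rev_cases) (auto split: option.splits)

text \<open>While a simulation is running, the invariant speaks of the stack above the last bottom
  marker, and \<open>b\<close> is the part of the block still to be fed. Between blocks the claim
  holds for every stack content.\<close>

lemma sim_accepts_sound:
  assumes "sim_accepts w Z st"
  shows "w \<in> lists Y \<and> (case st of None \<Rightarrow> False
    | Some (q, None) \<Rightarrow> \<exists>bs. produces ctl q w bs \<and> (\<forall>b \<in> set bs. block_accepted b)
    | Some (q, Some s) \<Rightarrow> (\<forall>J z. Z = J @ None # map Some z \<longrightarrow>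
        (\<exists>b bs. produces ctl q w (b # bs) \<and> accepts_from M m ok b z s \<and>
          (\<forall>b \<in> set bs. block_accepted b))))"
  using assms
proof induction
  case (accept s z)
  then obtain q where "s = Some (q, None)" "produces ctl q [] []"
    unfolding control_final_def by (blast intro: produces.Halt)
  then show ?case by (auto intro!: exI[of _ "[]"])
next
  case (eps st tos t \<alpha> v y)
  obtain q c where st: "st = Some (q, c)"
    using eps(1,3) by (cases st) (auto simp: action_def)
  \<comment> \<open>Lazy start: the fresh bottom marker turns the whole previous stack
    \<open>y @ [tos]\<close> into the \<open>J\<close> of the invariant.\<close>
  have init: "\<exists>bs. produces ctl q v bs \<and> (\<forall>b \<in> set bs. block_accepted b)"
    if "(t, \<alpha>) = initiate q tos"
  proof -
    have t: "t = Some (q, Some (start_state M))" "\<alpha> = [tos, None, Some (start_symbol M)]"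
      using that by (simp_all add: initiate_def)
    have "y @ \<alpha> = (y @ [tos]) @ None # map Some [start_symbol M]" using t by simp
    then obtain b bs where "produces ctl q v (b # bs)" "block_accepted b"
      "\<forall>b \<in> set bs. block_accepted b"
      using eps(3) unfolding t(1) prod.case option.case by blast
    then show ?thesis by (intro exI[of _ "b # bs"]) simp
  qed
  \<comment> \<open>A silent move of \<open>M\<close> changes neither the control state nor the
    input nor the rest of the block.\<close>
  have sim: "\<exists>b bs. produces ctl q v (b # bs) \<and> accepts_from M m ok b z s \<and>
          (\<forall>b \<in> set bs. block_accepted b)"
    if step: "y @ [tos] = J @ None # map Some z" "tos = Some b"
      "transition M (None, b, s) = Some (u, \<beta>)" "t = Some (q, Some u)" "\<alpha> = map Some \<beta>"
    for J z s b u \<beta>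
  proof -
    obtain z' where z: "z = z' @ [b]" "y = J @ None # map Some z'"
      using step(1)[symmetric] step(2) unfolding marked_stack_eq_snoc by auto
    have t: "t = Some (q, Some u)" using step(4) .
    have "y @ \<alpha> = J @ None # map Some (z' @ \<beta>)" using z(2) step(5) by simp
    then obtain b' bs where "produces ctl q v (b' # bs)" "accepts_from M m ok b' (z' @ \<beta>) u"
      "\<forall>b \<in> set bs. block_accepted b"
      using eps(3) unfolding t prod.case option.case by blast
    then show ?thesis
      using accepts_from.eps[OF step(3), of m ok b' z'] z(1) by blast
  qed
  show ?case
  proof (cases "ctl q")
    case (Feed e)
    show ?thesis
    proof (cases c)
      case None
      then show ?thesis using init eps(1,3) Feed st by (simp add: action_def)
    next
      case (Some s)
      have "\<exists>b bs. produces ctl q v (b # bs) \<and> accepts_from M m ok b z s \<and>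
          (\<forall>b \<in> set bs. block_accepted b)" if Z: "y @ [tos] = J @ None # map Some z" for J z
      proof -
        consider b u \<beta> where "tos = Some b" "transition M (None, b, s) = Some (u, \<beta>)"
            "t = Some (q, Some u)" "\<alpha> = map Some \<beta>"
          | b x q' u \<beta> where "tos = Some b" "e (kind s) = Some (x, q')"
            "transition M (Some x, b, s) = Some (u, \<beta>)"
            "t = Some (q', Some u)" "\<alpha> = map Some \<beta>"
          using eps(1,3) st Feed Some
          by (auto simp: action_def simulate_def split: option.splits)
        then show ?thesis
        proof cases
          case 1
          then show ?thesis using sim[OF Z] by blast
        next
          case 2
          obtain z' where z: "z = z' @ [b]" "y = J @ None # map Some z'"
            using Z[symmetric] 2(1) unfolding marked_stack_eq_snoc by auto
          \<comment> \<open>The control offered a letter of the tape that the state \<open>s\<close>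
            asks for, which is what the guard of \<open>M\<close> demands.\<close>
          have "ok s x" using Feed_ok[OF Feed 2(2)] wf_transitionD(2)[OF wf 2(3)] by simp
          have "y @ \<alpha> = J @ None # map Some (z' @ \<beta>)" using z(2) 2(5) by simp
          then obtain b' bs where b': "produces ctl q' v (b' # bs)"
            "accepts_from M m ok b' (z' @ \<beta>) u" "\<forall>b \<in> set bs. block_accepted b"
            using eps(3) unfolding 2(4) prod.case option.case by blast
          have "accepts_from M m ok (x # b') z s"
            using accepts_from.read[OF 2(3) \<open>ok s x\<close> b'(2)] z by simp
          then show ?thesis using produces.Feed[of ctl, OF Feed 2(2) b'(1)] b'(3) by blast
        qed
      qed
      then show ?thesis using Some st eps(3) by simp
    qed
  next
    case (Check q')
    show ?thesis
    proof (cases c)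
      case None
      then show ?thesis using init eps(1,3) Check st by (simp add: action_def)
    next
      case (Some s)
      have "\<exists>b bs. produces ctl q v (b # bs) \<and> accepts_from M m ok b z s \<and>
          (\<forall>b \<in> set bs. block_accepted b)" if Z: "y @ [tos] = J @ None # map Some z" for J z
      proof -
        consider b u \<beta> where "tos = Some b" "transition M (None, b, s) = Some (u, \<beta>)"
            "t = Some (q, Some u)" "\<alpha> = map Some \<beta>"
          | "case m of Final_State \<Rightarrow> s \<in> final_states M | Empty_Stack \<Rightarrow> tos = None"
            "t = Some (q', None)"
          using eps(1,3) st Check Some
          by (auto simp: action_def simulate_def split: option.splits if_splits)
        then show ?thesis
        proof cases
          case 1
          then show ?thesis using sim[OF Z] by blast
        next
          case 2
          have "accepts_from M m ok [] z s"
            using 2(1) Z[symmetric] unfolding marked_stack_eq_snoc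
            by (cases m) (auto intro!: accepts_from.accept)
          moreover obtain bs where "produces ctl q' v bs" "\<forall>b \<in> set bs. block_accepted b"
            using eps(3) unfolding 2(2) prod.case option.case by blast
          ultimately show ?thesis using produces.Check[of ctl, OF Check] by blast
        qed
      qed
      then show ?thesis using Some st eps(3) by simp
    qed
  qed (use eps(1,3) st in \<open>auto simp: action_def\<close>)
next
  case (read st tos f a t \<alpha> v y)
  obtain q c where st: "st = Some (q, c)"
    using read(1) by (cases st) (auto simp: action_def)
  obtain g where g: "ctl q = Read g" "f = (\<lambda>y. (map_option (\<lambda>q'. (q', c)) (g y), [tos]))"
    using read(1) st by (auto simp: action_def split: control.splits)
  obtain q' where q': "g a = Some q'" "t = Some (q', c)" "\<alpha> = [tos]"
    using read(2,5) g by (cases "g a") auto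
  have "a # v \<in> lists Y" using read(3,5) by simp
  moreover have "\<exists>b bs. produces ctl q (a # v) (b # bs) \<and> accepts_from M m ok b z s \<and>
      (\<forall>b \<in> set bs. block_accepted b)" if "c = Some s" "y @ [tos] = J @ None # map Some z" for s J z
    using read(5) that unfolding q'(2,3) by simp (blast intro: produces.Read[of ctl, OF g(1) q'(1)])
  moreover have "\<exists>bs. produces ctl q (a # v) bs \<and> (\<forall>b \<in> set bs. block_accepted b)" if "c = None"
    using read(5) that unfolding q'(2,3) by simp (blast intro: produces.Read[of ctl, OF g(1) q'(1)])
  ultimately show ?case unfolding st by (cases c) simp_all
qed

lemma sim_accepts_eps:
  "action st d = Inr (t, \<alpha>) \<Longrightarrow> sim_accepts w (y @ \<alpha>) t \<Longrightarrow> sim_accepts w (y @ [d]) st"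
  by (rule run_accepts.eps)

lemma sim_accepts_read:
  "action st d = Inl f \<Longrightarrow> f a = (t, \<alpha>) \<Longrightarrow> guard st a \<Longrightarrow> sim_accepts w (y @ \<alpha>) t \<Longrightarrow>
    sim_accepts (a # w) (y @ [d]) st"
  by (rule run_accepts.read)

text \<open>Induction along the accepting run of \<open>M\<close> up to the reading of
  \<open>x\<close>: the silent moves before it are copied, and \<open>assms(5)\<close> takes over
  right after it.\<close>

lemma sim_accepts_feed:
  assumes "accepts_from M m ok v z s" "v = x # b" "ctl q = Feed e" "e k = Some (x, q')"
    and "\<And>z s. accepts_from M m ok b z s \<Longrightarrow> sim_accepts w (J @ None # map Some z) (Some (q', Some s))"
  shows "sim_accepts w (J @ None # map Some z) (Some (q, Some s))"
  using assms(1,2)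
proof induction
  case (eps d s t \<alpha> v y)
  have "action (Some (q, Some s)) (Some d) = Inr (Some (q, Some t), map Some \<alpha>)"
    using assms(3) eps(1) by (simp add: action_def simulate_def)
  from sim_accepts_eps[OF this, of _ "J @ None # map Some y"] show ?case
    using eps by simp
next
  case (read a d s t \<alpha> v y)
  have st: "s \<in> states M" "d \<in> stack_alphabet M" "a \<in> input_alphabet M"
    using wf_transitionD[OF wf read(1)] by auto
  \<comment> \<open>Here determinism enters: where \<open>M\<close> reads there is no silent move,
    so \<open>simulate\<close> reaches its alternative.\<close>
  then have "transition M (None, d, s) = None"
    using wf read(1) unfolding wf_dpda_def by blast
  moreover have "kind s = k" using Feed_ok[OF assms(3,4) st(1)] read(2,5) by simp
  ultimately have "action (Some (q, Some s)) (Some d) = Inr (Some (q', Some t), map Some \<alpha>)"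
    using assms(3,4) read(1,5) by (simp add: action_def simulate_def)
  from sim_accepts_eps[OF this, of _ "J @ None # map Some y"] show ?case
    using assms(5)[of "y @ \<alpha>" t] read by simp
qed simp

text \<open>After the end of a block \<open>M\<close> may need silent moves before it accepts, so
  the test is repeated in every configuration on the way. It may succeed earlier than the given run
  does; this is harmless because the continuation works on any nonempty stack.\<close>

lemma sim_accepts_check:
  assumes "accepts_from M m ok v z s" "v = []" "ctl q = Check q'"
    and "\<And>Z. Z \<noteq> [] \<Longrightarrow> sim_accepts w Z (Some (q', None))"
  shows "sim_accepts w (J @ None # map Some z) (Some (q, Some s))"
  using assms(1,2)
proof induction
  case (accept s z)
  obtain y tos where y: "J @ None # map Some z = y @ [tos]"
    by (cases "J @ None # map Some z" rule: rev_cases) auto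
  have "case m of Final_State \<Rightarrow> s \<in> final_states M | Empty_Stack \<Rightarrow> tos = None"
    using accept(1) y unfolding marked_stack_eq_snoc by (auto split: acceptance_mode.splits option.splits)
  then have "action (Some (q, Some s)) tos = Inr (Some (q', None), [tos])"
    using assms(3) by (simp add: action_def)
  from sim_accepts_eps[OF this, of _ y] show ?case
    using assms(4) y by simp
next
  case (eps d s t \<alpha> v y)
  show ?case
  proof (cases "case m of Final_State \<Rightarrow> s \<in> final_states M | Empty_Stack \<Rightarrow> Some d = None")
    case True
    then have "action (Some (q, Some s)) (Some d) = Inr (Some (q', None), [Some d])"
      using assms(3) by (simp add: action_def)
    from sim_accepts_eps[OF this, of _ "J @ None # map Some y"] show ?thesis
      using assms(4) eps by simp
  next
    case False
    then have "action (Some (q, Some s)) (Some d) = Inr (Some (q, Some t), map Some \<alpha>)"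
      using assms(3) eps(1) by (simp add: action_def simulate_def)
    from sim_accepts_eps[OF this, of _ "J @ None # map Some y"] show ?thesis
      using eps by simp
  qed
qed simp

lemma sim_accepts_initiate:
  assumes "sim_accepts w (Z @ None # map Some [start_symbol M]) (Some (q, Some (start_state M)))"
    and "Z \<noteq> []" "\<exists>e q'. ctl q = Feed e \<or> ctl q = Check q'"
  shows "sim_accepts w Z (Some (q, None))"
proof -
  obtain y tos where y: "Z = y @ [tos]" using assms(2) by (cases Z rule: rev_cases) auto
  have "action (Some (q, None)) tos = Inr (initiate q tos)"
    using assms(3) by (auto simp: action_def)
  then have "action (Some (q, None)) tos =
      Inr (Some (q, Some (start_state M)), [tos, None, Some (start_symbol M)])"
    by (simp add: initiate_def)
  from sim_accepts_eps[OF this, of _ y] show ?thesis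
    using assms(1) y by simp
qed

text \<open>Both statements are proved in one induction: the first for a control without a running
  simulation, the second for one within a block whose remainder is the head of \<open>bs\<close>.
  The lazy start leads from the first to the second.\<close>

lemma sim_accepts_complete:
  assumes "produces ctl q w bs" "q \<in> Q" "w \<in> lists Y"
  shows "(\<forall>b \<in> set bs. block_accepted b) \<Longrightarrow> Z \<noteq> [] \<Longrightarrow> sim_accepts w Z (Some (q, None))"
    and "bs = b # bs' \<Longrightarrow> (\<forall>b \<in> set bs'. block_accepted b) \<Longrightarrow> accepts_from M m ok b z s \<Longrightarrow>
      sim_accepts w (J @ None # map Some z) (Some (q, Some s))"
  using assms
proof (induction arbitrary: Z b bs' z s J)
  case (Halt q)
  {
    case 1
    then show ?case using Halt by (auto simp: control_final_def intro: run_accepts.accept)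
  next
    case 2
    then show ?case by simp
  }
next
  case (Read q f y q' w bs)
  have q': "q' \<in> Q" if "q \<in> Q" "y \<in> Y" using closed_Read[OF that(1) Read(1) that(2) Read(2)] .
  have "action (Some (q, c)) tos = Inl (\<lambda>y. (map_option (\<lambda>q'. (q', c)) (f y), [tos]))" for c tos
    using Read(1) by (simp add: action_def)
  from sim_accepts_read[OF this] have
    *: "sim_accepts (y # w) (Z @ [tos]) (Some (q, c))"
    if "sim_accepts w (Z @ [tos]) (Some (q', c))" "y \<in> Y" for Z tos c
    using that Read(2) Read_ok[OF Read(1,2)] by simp
  {
    case 1
    then show ?case using *[of "butlast Z" "last Z" None] Read(4)[of Z] q' by simp
  next
    case 2
    obtain Z' tos where Z': "J @ None # map Some z = Z' @ [tos]"
      by (cases "J @ None # map Some z" rule: rev_cases) auto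
    show ?case using *[of Z' tos "Some s"] Read(5)[OF 2(1-3), of J] 2 q' Z' by simp
  }
next
  case (Feed q e k x q' w b0 bs0)
  have q': "q' \<in> Q" if "q \<in> Q" using closed_Feed[OF that Feed(1,2)] .
  have *: "sim_accepts w (J @ None # map Some z) (Some (q, Some s))"
    if "\<forall>b \<in> set bs0. block_accepted b" "accepts_from M m ok (x # b0) z s" "q \<in> Q" "w \<in> lists Y"
    for z s J
  proof (rule sim_accepts_feed[OF that(2) refl Feed(1,2)])
    show "sim_accepts w (J @ None # map Some z) (Some (q', Some s))" if "accepts_from M m ok b0 z s"
      for z s
      by (rule Feed(5)[OF refl _ that]) (use \<open>\<forall>b \<in> set bs0. block_accepted b\<close> q' \<open>q \<in> Q\<close> \<open>w \<in> lists Y\<close> in auto)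
  qed
  {
    case 1
    then have "sim_accepts w (Z @ None # map Some [start_symbol M]) (Some (q, Some (start_state M)))"
      by (intro *) simp_all
    then show ?case by (rule sim_accepts_initiate) (use 1 Feed(1) in blast)+
  next
    case 2
    then show ?case using *[of z s J] by simp
  }
next
  case (Check q q' w bs)
  have q': "q' \<in> Q" if "q \<in> Q" using closed_Check[OF that Check(1)] .
  have *: "sim_accepts w (J @ None # map Some z) (Some (q, Some s))"
    if "\<forall>b \<in> set bs. block_accepted b" "accepts_from M m ok [] z s" "q \<in> Q" "w \<in> lists Y"
    for z s J
    by (rule sim_accepts_check[OF that(2) refl Check(1)], rule Check(3)) (use q' that in auto)
  {
    case 1
    then have "sim_accepts w (Z @ None # map Some [start_symbol M]) (Some (q, Some (start_state M)))"
      by (intro *) simp_all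
    then show ?case by (rule sim_accepts_initiate) (use 1 Check(1) in blast)+
  next
    case 2
    then show ?case using *[of z s J] by simp
  }
qed

lemma sim_accepts_iff:
  "sim_accepts w [None] (Some (q0, None)) \<longleftrightarrow>
    w \<in> lists Y \<and> (\<exists>bs. produces ctl q0 w bs \<and> (\<forall>b \<in> set bs. block_accepted b))"
proof
  assume "sim_accepts w [None] (Some (q0, None))"
  then show "w \<in> lists Y \<and> (\<exists>bs. produces ctl q0 w bs \<and> (\<forall>b \<in> set bs. block_accepted b))"
    using sim_accepts_sound[of w "[None]" "Some (q0, None)"] by simp
next
  assume "w \<in> lists Y \<and> (\<exists>bs. produces ctl q0 w bs \<and> (\<forall>b \<in> set bs. block_accepted b))"
  then show "sim_accepts w [None] (Some (q0, None))"
    using sim_accepts_complete(1)[OF _ q0] by blast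
qed

end

lemma is_dpda_language_control:
  assumes "control_machine M ok kind ctl Q q0 Y (\<lambda>_ _. True)"
  shows "is_dpda_language Y {w \<in> lists Y. \<exists>bs. produces ctl q0 w bs \<and>
    (\<forall>b \<in> set bs. accepts_from M m ok b [start_symbol M] (start_state M))}"
proof -
  interpret control_machine M m ok kind ctl Q q0 Y "\<lambda>_ _. True" by fact
  let ?M = "coded_dpda Y control_states control_stack action (Some (q0, None)) None control_final ()"
  have "dpda_language Final_State ?M = {w \<in> lists Y. \<exists>bs. produces ctl q0 w bs \<and>
      (\<forall>b \<in> set bs. block_accepted b)}"
    using sim_accepts_iff by (simp add: language_coded_dpda del: in_lists_conv_set)
  then show ?thesis
    unfolding is_dpda_language_def by (metis wf_coded_dpda coded_dpda_simps(2))
qed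

text \<open>The control state alone fixes the tape to be read, through \<open>side\<close>, so the
  states of the constructed automaton can be partitioned accordingly. The dead state is put on the
  flat side.\<close>

lemma is_two_tape_language_control:
  assumes "control_machine M ok kind ctl Q q0 (insert None (Some ` A) <+> insert None (Some ` A))
    (\<lambda>q y. isl y = (case q of None \<Rightarrow> False | Some q \<Rightarrow> side q))"
  shows "is_two_tape_language A {(u, v) \<in> lists A \<times> lists A.
    \<exists>w bs. lefts w = end_marked u \<and> rights w = end_marked v \<and> produces ctl q0 w bs \<and>
      (\<forall>b \<in> set bs. accepts_from M m ok b [start_symbol M] (start_state M))}"
proof -
  let ?Y = "insert None (Some ` A) <+> insert None (Some ` A)"
  let ?side = "\<lambda>q. case q of None \<Rightarrow> False | Some q \<Rightarrow> side q"
  interpret control_machine M m ok kind ctl Q q0 ?Y "\<lambda>q y. isl y = ?side q" by (fact assms)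
  let ?sharp = "{st \<in> control_states. ?side (map_option fst st)}"
  let ?T = "coded_dpda ?Y control_states control_stack action (Some (q0, None)) None control_final
    (two_tape_pda.fields (to_nat ` ?sharp) (to_nat ` (control_states - ?sharp)))"
  have sf: "sharp_states ?T = to_nat ` ?sharp" "flat_states ?T = to_nat ` (control_states - ?sharp)"
    by (simp_all add: coded_dpda_def two_tape_pda.defs)
  have "wf_two_tape_pda A ?T"
    unfolding wf_two_tape_pda_def sf using wf_coded_dpda by (auto simp: inj_image_mem_iff)
  moreover have "two_tape_language A Final_State ?T = {(u, v) \<in> lists A \<times> lists A.
    \<exists>w bs. lefts w = end_marked u \<and> rights w = end_marked v \<and> produces ctl q0 w bs \<and>
      (\<forall>b \<in> set bs. block_accepted b)}" (is "_ = ?R")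
  proof -
    have tape: "tape_ok ?T (to_nat s) y \<longleftrightarrow> isl y = ?side (map_option fst s)" if "s \<in> control_states" for s y
      using that unfolding tape_ok_def sf by (auto simp: inj_image_mem_iff)
    have acc: "accepts_from ?T Final_State (tape_ok ?T) w (map to_nat [None :: nat option])
        (to_nat (Some (q0, None :: nat option))) \<longleftrightarrow> sim_accepts w [None] (Some (q0, None))" for w
      by (rule accepts_coded_dpda[where ok' = "\<lambda>s y. isl y = ?side (map_option fst s)"])
        (use start tape in auto)
    have "end_marked u \<in> lists (insert None (Some ` A))" if "u \<in> lists A" for u
      using that by (auto simp: end_marked_def)
    then have "w \<in> lists ?Y" if "lefts w = end_marked u" "rights w = end_marked v" "u \<in> lists A" "v \<in> lists A"
      for u v w
      unfolding lefts_rights_lists using that by simp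
    then show ?thesis
      unfolding two_tape_language_accepts_from[OF wf_coded_dpda] coded_dpda_simps
        acc[unfolded list.map] sim_accepts_iff by blast
  qed
  ultimately show ?thesis
    unfolding is_two_tape_language_def by metis
qed

section \<open>Transducers\<close>

fun transduce ::
  "('q \<Rightarrow> 'y \<Rightarrow> ('x list \<times> 'q) option) \<Rightarrow> ('q \<Rightarrow> bool) \<Rightarrow> 'q \<Rightarrow> 'y list \<Rightarrow> 'x list option" where
  "transduce tr fin q [] = (if fin q then Some [] else None)"
| "transduce tr fin q (y # w) = (case tr q y of
     None \<Rightarrow> None
   | Some (xs, q') \<Rightarrow> map_option ((@) xs) (transduce tr fin q' w))"

definition finite_transducer ::
  "'y set \<Rightarrow> 'x set \<Rightarrow> ('q \<Rightarrow> 'y \<Rightarrow> ('x list \<times> 'q) option) \<Rightarrow> 'q set \<Rightarrow> bool" where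
  "finite_transducer Y X tr Q \<longleftrightarrow> finite Q \<and>
     (\<forall>q \<in> Q. \<forall>y \<in> Y. \<forall>xs q'. tr q y = Some (xs, q') \<longrightarrow> xs \<in> lists X \<and> q' \<in> Q)"

lemma finite_transducerD:
  assumes "finite_transducer Y X tr Q" "q \<in> Q" "y \<in> Y" "tr q y = Some (xs, q')"
  shows "xs \<in> lists X" "q' \<in> Q"
  using assms by (auto simp: finite_transducer_def)

lemma transduce_lists:
  assumes "finite_transducer Y X tr Q" "q \<in> Q" "w \<in> lists Y" "transduce tr fin q w = Some v"
  shows "v \<in> lists X"
  using assms(2-)
proof (induction w arbitrary: q v)
  case (Cons y w)
  then obtain xs q' v' where *: "tr q y = Some (xs, q')" "transduce tr fin q' w = Some v'" "v = xs @ v'"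
    by (auto split: option.splits)
  then show ?case
    using Cons.IH[of q' v'] Cons.prems finite_transducerD[OF assms(1) _ _ *(1)] by auto
qed (auto split: if_splits)

text \<open>Bounds the buffers in which the controls below keep output not yet fed, and thereby
  makes their sets of states finite.\<close>

lemma finite_transducer_output_bound:
  assumes "finite_transducer Y X tr Q" "finite Y"
  obtains N where "\<And>q y xs q'. q \<in> Q \<Longrightarrow> y \<in> Y \<Longrightarrow> tr q y = Some (xs, q') \<Longrightarrow> length xs \<le> N"
proof -
  let ?f = "\<lambda>(q, y). case tr q y of None \<Rightarrow> 0 | Some (xs, _) \<Rightarrow> length xs"
  have "finite (?f ` (Q \<times> Y))" using assms by (auto simp: finite_transducer_def)
  then obtain N where N: "\<forall>n \<in> ?f ` (Q \<times> Y). n \<le> N"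
    unfolding finite_nat_set_iff_bounded_le by blast
  have "length xs \<le> N" if "q \<in> Q" "y \<in> Y" "tr q y = Some (xs, q')" for q y xs q'
  proof -
    have "?f (q, y) \<in> ?f ` (Q \<times> Y)" using that by (intro imageI) simp
    then show ?thesis using N that(3) by fastforce
  qed
  then show ?thesis using that by blast
qed

lemma wf_dpda_finite_input: "wf_dpda M \<Longrightarrow> finite (input_alphabet M)"
  unfolding wf_dpda_def by blast

subsection \<open>Blocks of one tape\<close>

text \<open>A state consists of the output not yet fed and the state of the transducer. In the
  output, \<open>Some x\<close> is a letter and \<open>None\<close> ends a block. The simulated
  automaton has a single tape, which is named \<open>True\<close>.\<close>

fun block_control ::
  "('q \<Rightarrow> 'y \<Rightarrow> ('x option list \<times> 'q) option) \<Rightarrow> ('q \<Rightarrow> bool) \<Rightarrow>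
    'x option list \<times> 'q \<Rightarrow> ('x option list \<times> 'q, 'x, 'y) control" where
  "block_control tr fin ([], q) = (if fin q then Halt else Read (tr q))"
| "block_control tr fin (Some x # xs, q) = Feed (\<lambda>k. if k then Some (x, (xs, q)) else None)"
| "block_control tr fin (None # xs, q) = Check (xs, q)"

lemma block_control_inv:
  "block_control tr fin (ys, q) = Halt \<longleftrightarrow> ys = [] \<and> fin q"
  "block_control tr fin (ys, q) = Read f \<longleftrightarrow> ys = [] \<and> \<not> fin q \<and> f = tr q"
  "block_control tr fin (ys, q) = Feed e \<longleftrightarrow>
    (\<exists>x xs. ys = Some x # xs \<and> e = (\<lambda>k. if k then Some (x, (xs, q)) else None))"
  "block_control tr fin (ys, q) = Check c \<longleftrightarrow> (\<exists>xs. ys = None # xs \<and> c = (xs, q))"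
  by (cases "(tr, fin, (ys, q))" rule: block_control.cases; auto)+

lemma produces_block_control_sound:
  assumes "produces (block_control tr fin) c w bs"
  shows "\<exists>xs. transduce tr fin (snd c) w = Some xs \<and> fst c @ xs = concat (map end_marked bs)"
  using assms
proof induction
  case (Halt c)
  then show ?case by (cases c) (simp add: block_control_inv)
next
  case (Read c f y c' w bs)
  then show ?case by (cases c; cases c') (auto simp: block_control_inv)
next
  case (Feed c e k x c' w b bs)
  then show ?case
    by (cases c; cases c') (auto simp: block_control_inv end_marked_def split: if_splits)
next
  case (Check c c' w bs)
  then show ?case by (cases c) (auto simp: block_control_inv end_marked_def)
qed

lemma produces_block_control_buffer:
  assumes "\<And>bs. xs = concat (map end_marked bs) \<Longrightarrow> produces (block_control tr fin) ([], q) w bs"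
    and "ys @ xs = concat (map end_marked bs)"
  shows "produces (block_control tr fin) (ys, q) w bs"
  using assms(2)
proof (induction ys arbitrary: bs)
  case Nil
  then show ?case using assms(1) by simp
next
  case (Cons y ys)
  then obtain b bs' where bs: "bs = b # bs'" by (cases bs) auto
  show ?case
  proof (cases y)
    case None
    then have "b = []" using Cons(2) bs by (cases b) (auto simp: end_marked_def)
    then show ?thesis
      using Cons bs None produces.Check[of "block_control tr fin" "(y # ys, q)" "(ys, q)" w bs']
      by (simp add: end_marked_def)
  next
    case (Some x)
    then obtain b' where "b = x # b'" using Cons(2) bs by (cases b) (auto simp: end_marked_def)
    then show ?thesis
      using Cons bs Some
        produces.Feed[of "block_control tr fin" "(y # ys, q)" _ True x "(ys, q)" w b' bs']
      by (simp add: end_marked_def)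
  qed
qed

text \<open>Halting in a final state loses no word, because by assumption no transition leaves such
  a state. \<open>end_marked\<close> is reused to delimit blocks, so that a sequence of blocks
  becomes one output word.\<close>

lemma produces_block_control_iff:
  assumes prefix_free: "\<And>q y. fin q \<Longrightarrow> tr q y = None"
  shows "produces (block_control tr fin) ([], q) w bs \<longleftrightarrow>
    transduce tr fin q w = Some (concat (map end_marked bs))"
proof
  show "produces (block_control tr fin) ([], q) w bs \<Longrightarrow>
      transduce tr fin q w = Some (concat (map end_marked bs))"
    using produces_block_control_sound[of tr fin "([], q)" w bs] by simp
next
  assume "transduce tr fin q w = Some (concat (map end_marked bs))"
  then show "produces (block_control tr fin) ([], q) w bs"
  proof (induction w arbitrary: q bs)
    case Nil
    then have "fin q" "bs = []" by (auto simp: end_marked_def split: if_splits)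
    then show ?case by (simp add: produces.Halt)
  next
    case (Cons y w)
    then obtain ys q' xs where *: "tr q y = Some (ys, q')" "transduce tr fin q' w = Some xs"
      "ys @ xs = concat (map end_marked bs)"
      by (auto split: option.splits)
    have "produces (block_control tr fin) (ys, q') w bs"
      by (rule produces_block_control_buffer[OF Cons.IH *(3)]) (use *(2) in simp)
    moreover have "block_control tr fin ([], q) = Read (tr q)"
      using prefix_free *(1) by fastforce
    ultimately show ?case
      using *(1) by (auto intro: produces.Read)
  qed
qed

lemma control_machine_block_control:
  fixes tr :: "'q::countable \<Rightarrow> 'y \<Rightarrow> ('x::countable option list \<times> 'q) option"
    and M :: "(nat, 'x, nat, 'z) dpda_scheme"
  assumes "wf_dpda M" "finite Y" "finite X" "finite_transducer Y X tr Q" "q0 \<in> Q"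
    and ok': "\<And>q y xs q'. tr q y = Some (xs, q') \<Longrightarrow> ok' (Some ([], q)) y"
  shows "\<exists>Q'. control_machine M (\<lambda>_ _. True) (\<lambda>_. True) (block_control tr fin) Q' ([], q0) Y ok'"
proof -
  obtain N where N: "\<And>q y xs q'. q \<in> Q \<Longrightarrow> y \<in> Y \<Longrightarrow> tr q y = Some (xs, q') \<Longrightarrow> length xs \<le> N"
    using finite_transducer_output_bound[OF assms(4,2)] by blast
  let ?Q = "{xs. set xs \<subseteq> X \<and> length xs \<le> N} \<times> Q"
  have "control_machine M (\<lambda>_ _. True) (\<lambda>_. True) (block_control tr fin) ?Q ([], q0) Y ok'"
  proof
    show "finite ?Q"
      using assms(4) finite_lists_length_le[OF assms(3), of N]
      unfolding finite_transducer_def by blast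
    show "c' \<in> ?Q" if step: "c \<in> ?Q" "block_control tr fin c = Read f" "y \<in> Y" "f y = Some c'" for c f y c'
    proof -
      obtain q xs q' where c: "c = ([], q)" "c' = (xs, q')" "tr q y = Some (xs, q')" "q \<in> Q"
        using step by (cases c; cases c') (auto simp: block_control_inv)
      then show ?thesis
        using N[OF c(4) step(3) c(3)] finite_transducerD[OF assms(4) c(4) step(3) c(3)] by auto
    qed
  next
    show "c' \<in> ?Q" if "c \<in> ?Q" "block_control tr fin c = Feed e" "e k = Some (x, c')" for c e k x c'
      using that by (cases c) (auto simp: block_control_inv split: if_splits)
  next
    show "c' \<in> ?Q" if "c \<in> ?Q" "block_control tr fin c = Check c'" for c c'
      using that by (cases c) (auto simp: block_control_inv)
  next
    show "True \<longleftrightarrow> True = k" if "block_control tr fin c = Feed e" "e k = Some (x, c')" for c e k x c'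
      using that by (cases c) (auto simp: block_control_inv split: if_splits)
  next
    show "ok' (Some c) y" if step: "block_control tr fin c = Read f" "f y = Some c'" for c f y c'
    proof -
      obtain q where "c = ([], q)" "tr q y = Some (fst c', snd c')"
        using step by (cases c) (simp add: block_control_inv)
      then show ?thesis using ok' by blast
    qed
  qed (use assms(1,2,5) in simp_all)
  then show ?thesis by blast
qed

text \<open>Each block is tested by a fresh simulation above the remains of the earlier ones, so one
  stack suffices for any number of blocks.\<close>

theorem is_dpda_language_blocks:
  fixes tr :: "'q::countable \<Rightarrow> 'y \<Rightarrow> ('x::countable option list \<times> 'q) option"
  assumes "is_dpda_language X K" "finite Y" "finite_transducer Y (insert None (Some ` X)) tr Q" "q0 \<in> Q"
    and "\<And>q y. fin q \<Longrightarrow> tr q y = None"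
  shows "is_dpda_language Y {w \<in> lists Y. \<exists>bs.
    transduce tr fin q0 w = Some (concat (map end_marked bs)) \<and> set bs \<subseteq> K}"
proof -
  obtain M :: "(nat, 'x, nat) dpda" and m where
    M: "wf_dpda M" "input_alphabet M = X" "K = dpda_language m M"
    using assms(1) unfolding is_dpda_language_def by blast
  have K: "(\<forall>b \<in> set bs. accepts_from M m (\<lambda>_ _. True) b [start_symbol M] (start_state M)) \<longleftrightarrow>
      set bs \<subseteq> K" for bs
    unfolding M(3) dpda_language_accepts_from[OF M(1)] by blast
  have "finite (insert None (Some ` X))"
    using wf_dpda_finite_input[OF M(1)] M(2) by simp
  then have "\<exists>Q'. control_machine M (\<lambda>_ _. True) (\<lambda>_. True) (block_control tr fin) Q' ([], q0) Y
      (\<lambda>_ _. True)"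
    by (rule control_machine_block_control[OF M(1) assms(2) _ assms(3,4)]) simp
  then obtain Q' where
    "control_machine M (\<lambda>_ _. True) (\<lambda>_. True) (block_control tr fin) Q' ([], q0) Y (\<lambda>_ _. True)"
    by blast
  from is_dpda_language_control[OF this, of m] show ?thesis
    unfolding K by (simp only: produces_block_control_iff[of fin tr, OF assms(5)])
qed

text \<open>Here the transducer reads the shuffled word itself and prescribes the shuffle through
  \<open>side\<close>. This serves conditions on pairs that only need a one-tape automaton.\<close>

theorem is_two_tape_language_blocks:
  fixes tr :: "'q::countable \<Rightarrow> 'a option + 'a option \<Rightarrow> ('x::countable option list \<times> 'q) option"
  assumes "is_dpda_language X K" "finite A" "q0 \<in> Q"
    and "finite_transducer (insert None (Some ` A) <+> insert None (Some ` A))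
      (insert None (Some ` X)) tr Q"
    and "\<And>q y. fin q \<Longrightarrow> tr q y = None"
    and "\<And>q y xs q'. tr q y = Some (xs, q') \<Longrightarrow> isl y = side q"
  shows "is_two_tape_language A {(u, v) \<in> lists A \<times> lists A. \<exists>w bs.
    lefts w = end_marked u \<and> rights w = end_marked v \<and>
    transduce tr fin q0 w = Some (concat (map end_marked bs)) \<and> set bs \<subseteq> K}"
proof -
  let ?Y = "insert None (Some ` A) <+> insert None (Some ` A)"
  obtain M :: "(nat, 'x, nat) dpda" and m where
    M: "wf_dpda M" "input_alphabet M = X" "K = dpda_language m M"
    using assms(1) unfolding is_dpda_language_def by blast
  have K: "(\<forall>b \<in> set bs. accepts_from M m (\<lambda>_ _. True) b [start_symbol M] (start_state M)) \<longleftrightarrow>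
      set bs \<subseteq> K" for bs
    unfolding M(3) dpda_language_accepts_from[OF M(1)] by blast
  have "finite (insert None (Some ` X))"
    using wf_dpda_finite_input[OF M(1)] M(2) by simp
  moreover have "finite ?Y" using assms(2) by simp
  ultimately have "\<exists>Q'. control_machine M (\<lambda>_ _. True) (\<lambda>_. True) (block_control tr fin) Q' ([], q0) ?Y
      (\<lambda>q y. isl y = (case q of None \<Rightarrow> False | Some q \<Rightarrow> side (snd q)))"
    by (intro control_machine_block_control[OF M(1) _ _ assms(4,3)]) (use assms(6) in auto)
  then obtain Q' where
    "control_machine M (\<lambda>_ _. True) (\<lambda>_. True) (block_control tr fin) Q' ([], q0) ?Y
      (\<lambda>q y. isl y = (case q of None \<Rightarrow> False | Some q \<Rightarrow> side (snd q)))"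
    by blast
  from is_two_tape_language_control[OF this, of m] show ?thesis
    unfolding K by (simp only: produces_block_control_iff[of fin tr, OF assms(5)])
qed

subsection \<open>Two tapes read independently\<close>

text \<open>Both buffers are refilled before anything is fed, since the tape that the simulated
  automaton will ask for is not known in advance. When feeding starts, each buffer is nonempty or
  its transducer has reached a final state. The state \<open>None\<close> follows the only
  check.\<close>

fun tape_control ::
  "('q \<Rightarrow> 'y \<Rightarrow> ('x list \<times> 'q) option) \<Rightarrow> ('q \<Rightarrow> bool) \<Rightarrow> (('x list \<times> 'q) \<times> ('x list \<times> 'q)) option \<Rightarrow>
    ((('x list \<times> 'q) \<times> ('x list \<times> 'q)) option, 'x + 'x, 'y + 'y) control" where
  "tape_control tr fin None = Halt"
| "tape_control tr fin (Some ((xs, p), (ys, q))) =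
    (if xs = [] \<and> \<not> fin p then
       Read (case_sum (\<lambda>a. map_option (\<lambda>c. Some (c, (ys, q))) (tr p a)) (\<lambda>_. None))
     else if ys = [] \<and> \<not> fin q then
       Read (case_sum (\<lambda>_. None) (\<lambda>a. map_option (\<lambda>c. Some ((xs, p), c)) (tr q a)))
     else if xs = [] \<and> ys = [] then Check None
     else Feed (\<lambda>k. if k
       then (case xs of [] \<Rightarrow> None | x # xs' \<Rightarrow> Some (Inl x, Some ((xs', p), (ys, q))))
       else (case ys of [] \<Rightarrow> None | y # ys' \<Rightarrow> Some (Inr y, Some ((xs, p), (ys', q))))))"

fun tape_side :: "('q \<Rightarrow> bool) \<Rightarrow> (('x list \<times> 'q) \<times> ('x list \<times> 'q)) option \<Rightarrow> bool" where
  "tape_side fin None = False"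
| "tape_side fin (Some ((xs, p), (ys, q))) \<longleftrightarrow> xs = [] \<and> \<not> fin p"

lemma tape_control_Read:
  assumes "tape_control tr fin c = Read f" "f z = Some c'"
  obtains (sharp) p ys q a xs' p' where "c = Some (([], p), (ys, q))" "\<not> fin p" "z = Inl a"
      "tr p a = Some (xs', p')" "c' = Some ((xs', p'), (ys, q))"
  | (flat) xs p q a ys' q' where "c = Some ((xs, p), ([], q))" "xs \<noteq> [] \<or> fin p" "\<not> fin q" "z = Inr a"
      "tr q a = Some (ys', q')" "c' = Some ((xs, p), (ys', q'))"
proof (cases c)
  case None
  then show ?thesis using assms by simp
next
  case (Some d)
  obtain xs p ys q where d: "d = ((xs, p), (ys, q))" by (metis surj_pair)
  consider "xs = []" "\<not> fin p" | "xs \<noteq> [] \<or> fin p" "ys = []" "\<not> fin q"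
    using assms(1) Some d by (auto split: if_splits)
  then show ?thesis
  proof cases
    case 1
    then have "f = case_sum (\<lambda>a. map_option (\<lambda>c. Some (c, (ys, q))) (tr p a)) (\<lambda>_. None)"
      using assms(1) Some d by simp
    then obtain a c'' where "z = Inl a" "tr p a = Some c''" "c' = Some (c'', (ys, q))"
      using assms(2) by (cases z) auto
    then show ?thesis using sharp[of p ys q a "fst c''" "snd c''"] 1 Some d by simp
  next
    case 2
    then have "f = case_sum (\<lambda>_. None) (\<lambda>a. map_option (\<lambda>c. Some ((xs, p), c)) (tr q a))"
      using assms(1) Some d by auto
    then obtain a c'' where "z = Inr a" "tr q a = Some c''" "c' = Some ((xs, p), c'')"
      using assms(2) by (cases z) auto
    then show ?thesis using flat[of xs p q a "fst c''" "snd c''"] 2 Some d by simp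
  qed
qed

lemma tape_control_Feed:
  assumes "tape_control tr fin c = Feed e" "e k = Some (x, c')"
  obtains (sharp) a xs p ys q where "c = Some ((a # xs, p), (ys, q))" "k" "x = Inl a"
      "c' = Some ((xs, p), (ys, q))"
  | (flat) a xs p ys q where "c = Some ((xs, p), (a # ys, q))" "\<not> k" "x = Inr a"
      "c' = Some ((xs, p), (ys, q))"
proof (cases c)
  case None
  then show ?thesis using assms by simp
next
  case (Some d)
  obtain xs p ys q where d: "d = ((xs, p), (ys, q))" by (metis surj_pair)
  have e: "e = (\<lambda>k. if k
       then (case xs of [] \<Rightarrow> None | x # xs' \<Rightarrow> Some (Inl x, Some ((xs', p), (ys, q))))
       else (case ys of [] \<Rightarrow> None | y # ys' \<Rightarrow> Some (Inr y, Some ((xs, p), (ys', q)))))"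
    using assms(1) Some d by (simp split: if_splits)
  show ?thesis
  proof (cases k)
    case True
    then show ?thesis
      using assms(2) sharp Some d unfolding e by (cases xs) simp_all
  next
    case False
    then show ?thesis
      using assms(2) flat Some d unfolding e by (cases ys) simp_all
  qed
qed

lemma tape_control_Check:
  assumes "tape_control tr fin c = Check c'"
  obtains p q where "c = Some (([], p), ([], q))" "fin p" "fin q" "c' = None"
proof (cases c)
  case None
  then show ?thesis using assms by simp
next
  case (Some d)
  obtain xs p ys q where d: "d = ((xs, p), (ys, q))" by (metis surj_pair)
  show ?thesis using assms that Some d by (simp split: if_splits)
qed

lemma tape_control_Halt: "tape_control tr fin c = Halt \<longleftrightarrow> c = None"
  by (cases "(tr, fin, c)" rule: tape_control.cases) simp_all

lemma produces_tape_control_sound: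
  assumes "produces (tape_control tr fin) c w bs"
  shows "case c of None \<Rightarrow> w = [] \<and> bs = []
    | Some ((xs, p), (ys, q)) \<Rightarrow> (\<exists>b xs' ys'. bs = [b] \<and>
        transduce tr fin p (lefts w) = Some xs' \<and> transduce tr fin q (rights w) = Some ys' \<and>
        lefts b = xs @ xs' \<and> rights b = ys @ ys')"
  using assms
proof induction
  case (Halt c)
  then show ?case by (simp add: tape_control_Halt)
next
  case (Read c f z c' w bs)
  from Read(1,2) show ?case
    by (cases rule: tape_control_Read) (use Read(4) in auto)
next
  case (Feed c e k x c' w b bs)
  from Feed(1,2) show ?case
    by (cases rule: tape_control_Feed) (use Feed(4) in auto)
next
  case (Check c c' w bs)
  from Check(1) show ?case
    by (cases rule: tape_control_Check) (use Check(3) in auto)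
qed

text \<open>The shuffle \<open>b\<close> of the outputs is given, whereas the shuffle
  \<open>w\<close> of the inputs is built: it is the order in which the control refills its buffers
  while it feeds \<open>b\<close>. Every step before the check shortens \<open>u\<close>,
  \<open>v\<close> or \<open>b\<close>.\<close>

lemma produces_tape_control_complete:
  assumes prefix_free: "\<And>q y. fin q \<Longrightarrow> tr q y = None"
    and "transduce tr fin p u = Some xs'" "transduce tr fin q v = Some ys'"
    and "lefts b = xs @ xs'" "rights b = ys @ ys'"
  shows "\<exists>w. lefts w = u \<and> rights w = v \<and>
    produces (tape_control tr fin) (Some ((xs, p), (ys, q))) w [b]"
  using assms(2-)
proof (induction "length u + length v + length b" arbitrary: u v b p q xs ys xs' ys' rule: less_induct)
  case less
  let ?P = "produces (tape_control tr fin)"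
  \<comment> \<open>A transducer in a final state has no input left and emits nothing more, so an
    empty buffer then means that this tape is exhausted.\<close>
  have final: "u = [] \<and> xs' = []" if "fin p"
    using less.prems(1) that prefix_free by (cases u) auto
  have final': "v = [] \<and> ys' = []" if "fin q"
    using less.prems(2) that prefix_free by (cases v) auto
  consider (read_sharp) "xs = []" "\<not> fin p"
    | (read_flat) "xs \<noteq> [] \<or> fin p" "ys = []" "\<not> fin q"
    | (check) "xs = []" "ys = []" "fin p" "fin q"
    | (feed) "xs \<noteq> [] \<or> ys \<noteq> []" "xs \<noteq> [] \<or> fin p" "ys \<noteq> [] \<or> fin q"
    by blast
  then show ?case
  proof cases
    case read_sharp
    then obtain a u' r p' xs'' where u: "u = a # u'" "tr p a = Some (r, p')"
      "transduce tr fin p' u' = Some xs''" "xs' = r @ xs''"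
      using less.prems(1) by (cases u) (auto split: option.splits)
    obtain w where w: "lefts w = u'" "rights w = v" "?P (Some ((r, p'), (ys, q))) w [b]"
      using less.hyps[OF _ u(3) less.prems(2), of b r ys] less.prems(3,4) u(1,4) read_sharp(1) by auto
    have "tape_control tr fin (Some ((xs, p), (ys, q))) =
        Read (case_sum (\<lambda>a. map_option (\<lambda>c. Some (c, (ys, q))) (tr p a)) (\<lambda>_. None))"
      using read_sharp by simp
    then have "?P (Some ((xs, p), (ys, q))) (Inl a # w) [b]"
      by (rule produces.Read[OF _ _ w(3)]) (use u(2) in simp)
    then show ?thesis using w u(1) by (intro exI[of _ "Inl a # w"]) simp
  next
    case read_flat
    then obtain a v' r q' ys'' where v: "v = a # v'" "tr q a = Some (r, q')"
      "transduce tr fin q' v' = Some ys''" "ys' = r @ ys''"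
      using less.prems(2) by (cases v) (auto split: option.splits)
    obtain w where w: "lefts w = u" "rights w = v'" "?P (Some ((xs, p), (r, q'))) w [b]"
      using less.hyps[OF _ less.prems(1) v(3), of b xs r] less.prems(3,4) v(1,4) read_flat(2) by auto
    have "tape_control tr fin (Some ((xs, p), (ys, q))) =
        Read (case_sum (\<lambda>_. None) (\<lambda>a. map_option (\<lambda>c. Some ((xs, p), c)) (tr q a)))"
      using read_flat by auto
    then have "?P (Some ((xs, p), (ys, q))) (Inr a # w) [b]"
      by (rule produces.Read[OF _ _ w(3)]) (use v(2) in simp)
    then show ?thesis using w v(1) by (intro exI[of _ "Inr a # w"]) simp
  next
    case check
    have "lefts b = []" "rights b = []" using final final' check less.prems(3,4) by simp_all
    then have "b = []" by (cases b rule: lefts.cases) simp_all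
    moreover have "?P (Some ((xs, p), (ys, q))) [] [[]]"
      by (rule produces.Check[of _ _ None]) (use check in \<open>simp_all add: produces.Halt\<close>)
    ultimately show ?thesis using final final' check by (intro exI[of _ "[]"]) simp
  next
    case feed
    have f: "tape_control tr fin (Some ((xs, p), (ys, q))) = Feed (\<lambda>k. if k
       then (case xs of [] \<Rightarrow> None | x # xs' \<Rightarrow> Some (Inl x, Some ((xs', p), (ys, q))))
       else (case ys of [] \<Rightarrow> None | y # ys' \<Rightarrow> Some (Inr y, Some ((xs, p), (ys', q)))))"
      using feed by auto
    show ?thesis
    proof (cases b rule: lefts.cases)
      case 1
      then show ?thesis using feed(1) less.prems(3,4) by simp
    next
      case (2 x b')
      then obtain r where r: "xs = x # r" "lefts b' = r @ xs'"
        using less.prems(3) final feed(2) by (cases xs) auto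
      obtain w where w: "lefts w = u" "rights w = v" "?P (Some ((r, p), (ys, q))) w [b']"
        using less.hyps[OF _ less.prems(1,2) r(2), of ys] less.prems(4) 2 by auto
      have "?P (Some ((xs, p), (ys, q))) w [Inl x # b']"
        by (rule produces.Feed[OF f _ w(3), of True]) (use r in simp)
      then show ?thesis using w 2 by blast
    next
      case (3 y b')
      then obtain r where r: "ys = y # r" "rights b' = r @ ys'"
        using less.prems(4) final' feed(3) by (cases ys) auto
      obtain w where w: "lefts w = u" "rights w = v" "?P (Some ((xs, p), (r, q))) w [b']"
        using less.hyps[OF _ less.prems(1,2) _ r(2), of xs] less.prems(3) 3 by auto
      have "?P (Some ((xs, p), (ys, q))) w [Inr y # b']"
        by (rule produces.Feed[OF f _ w(3), of False]) (use r in simp)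
      then show ?thesis using w 3 by blast
    qed
  qed
qed

lemma control_machine_tape_control:
  fixes tr :: "'q::countable \<Rightarrow> 'y \<Rightarrow> ('x::countable list \<times> 'q) option"
    and T :: "(nat, 'x + 'x, nat, 'z) dpda_scheme"
  assumes "wf_dpda T" "finite Y" "finite X" "finite_transducer Y X tr Q" "q0 \<in> Q"
    and ok: "\<And>s x. s \<in> states T \<Longrightarrow> ok s x \<longleftrightarrow> kind s = isl x"
  shows "\<exists>Q'. control_machine T ok kind (tape_control tr fin) Q' (Some (([], q0), ([], q0))) (Y <+> Y)
    (\<lambda>q y. isl y = (case q of None \<Rightarrow> False | Some q \<Rightarrow> tape_side fin q))"
proof -
  obtain N where N: "\<And>q y xs q'. q \<in> Q \<Longrightarrow> y \<in> Y \<Longrightarrow> tr q y = Some (xs, q') \<Longrightarrow> length xs \<le> N"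
    using finite_transducer_output_bound[OF assms(4,2)] by blast
  define B where "B = {xs. set xs \<subseteq> X \<and> length xs \<le> N} \<times> Q"
  have B: "(xs, q') \<in> B" if "q \<in> Q" "y \<in> Y" "tr q y = Some (xs, q')" for q y xs q'
    using N[OF that] finite_transducerD[OF assms(4) that] by (auto simp: B_def)
  have B_tl: "(xs, q) \<in> B" if "(x # xs, q) \<in> B" for x xs q using that by (simp add: B_def)
  have B_state: "q \<in> Q" if "(xs, q) \<in> B" for xs q using that by (simp add: B_def)
  let ?Q = "insert None (Some ` (B \<times> B))"
  have "control_machine T ok kind (tape_control tr fin) ?Q (Some (([], q0), ([], q0))) (Y <+> Y)
    (\<lambda>q y. isl y = (case q of None \<Rightarrow> False | Some q \<Rightarrow> tape_side fin q))"
  proof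
    have "finite B"
      using assms(4) finite_lists_length_le[OF assms(3), of N]
      unfolding B_def finite_transducer_def by blast
    then show "finite ?Q" by simp
    show "Some (([], q0), ([], q0)) \<in> ?Q" using assms(5) by (simp add: B_def)
    show "c' \<in> ?Q"
      if "c \<in> ?Q" "tape_control tr fin c = Read f" "y \<in> Y <+> Y" "f y = Some c'" for c f y c'
      using that(2,4)
    proof (cases rule: tape_control_Read)
      case (sharp p ys q a xs' p')
      then show ?thesis using that(1,3) B[of p a] B_state by auto
    next
      case (flat xs p q a ys' q')
      then show ?thesis using that(1,3) B[of q a] B_state by auto
    qed
    show "c' \<in> ?Q" if "c \<in> ?Q" "tape_control tr fin c = Feed e" "e k = Some (x, c')" for c e k x c'
      using that(2,3) by (cases rule: tape_control_Feed) (use that(1) B_tl in auto)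
    show "c' \<in> ?Q" if "c \<in> ?Q" "tape_control tr fin c = Check c'" for c c'
      using that(2) by (cases rule: tape_control_Check) simp
    show "ok s x \<longleftrightarrow> kind s = k"
      if "tape_control tr fin c = Feed e" "e k = Some (x, c')" "s \<in> states T" for c e k x c' s
      using that(1,2) by (cases rule: tape_control_Feed) (use ok[OF that(3)] in simp_all)
    show "isl y = (case Some c of None \<Rightarrow> False | Some q \<Rightarrow> tape_side fin q)"
      if "tape_control tr fin c = Read f" "f y = Some c'" for c f y c'
      using that by (cases rule: tape_control_Read) auto
  qed (use assms(1,2) in simp_all)
  then show ?thesis by blast
qed

text \<open>Reading the end marker leads to \<open>None\<close>, a final state without transitions.
  So the restriction on final states holds here whatever \<open>fin\<close> is.\<close>

fun end_marked_transducer ::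
  "('q \<Rightarrow> 'y \<Rightarrow> ('x list \<times> 'q) option) \<Rightarrow> ('q \<Rightarrow> bool) \<Rightarrow>
    'q option \<Rightarrow> 'y option \<Rightarrow> ('x option list \<times> 'q option) option" where
  "end_marked_transducer tr fin (Some q) (Some a) =
    map_option (\<lambda>(xs, q'). (map Some xs, Some q')) (tr q a)"
| "end_marked_transducer tr fin (Some q) None = (if fin q then Some ([None], None) else None)"
| "end_marked_transducer tr fin None a = None"

lemma transduce_end_marked:
  "transduce (end_marked_transducer tr fin) (\<lambda>q. q = None) (Some q) (end_marked w) =
    map_option end_marked (transduce tr fin q w)"
proof (induction w arbitrary: q)
  case (Cons a w)
  show ?case
  proof (cases "tr q a")
    case (Some r)
    then show ?thesis
      using Cons by (cases r; cases "transduce tr fin (snd r) w") (simp_all add: end_marked_def)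
  qed (simp add: end_marked_def)
qed (simp add: end_marked_def)

lemma finite_end_marked_transducer:
  assumes "finite_transducer Y X tr Q"
  shows "finite_transducer (insert None (Some ` Y)) (insert None (Some ` X))
    (end_marked_transducer tr fin) (insert None (Some ` Q))"
  unfolding finite_transducer_def
proof (intro conjI ballI allI impI)
  show "finite (insert None (Some ` Q))" using assms by (simp add: finite_transducer_def)
  fix q y xs q'
  assume *: "q \<in> insert None (Some ` Q)" "y \<in> insert None (Some ` Y)"
    "end_marked_transducer tr fin q y = Some (xs, q')"
  show "xs \<in> lists (insert None (Some ` X))" "q' \<in> insert None (Some ` Q)"
    using * finite_transducerD[OF assms]
    by (cases "(tr, fin, q, y)" rule: end_marked_transducer.cases; fastforce split: if_splits)+
qed

text \<open>The same transducer runs on both tapes, and membership of the current state of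
  \<open>T\<close> in its sharp states serves as \<open>kind\<close>: the partition tells from which
  tape \<open>T\<close> takes its next letter.\<close>

theorem is_two_tape_language_transduce:
  fixes tr :: "'q::countable \<Rightarrow> 'y \<Rightarrow> ('x::countable list \<times> 'q) option"
  assumes "is_two_tape_language B R" "finite A" "finite_transducer A B tr Q" "q0 \<in> Q"
  shows "is_two_tape_language A {(u, v) \<in> lists A \<times> lists A. \<exists>u' v'.
    transduce tr fin q0 u = Some u' \<and> transduce tr fin q0 v = Some v' \<and> (u', v') \<in> R}"
proof -
  let ?tr = "end_marked_transducer tr fin" and ?fin = "\<lambda>q. q = None"
  let ?A = "insert None (Some ` A)" and ?q = "Some (([], Some q0), ([], Some q0))"
  obtain T :: "(nat, 'x, nat) two_tape_pda" and m where
    T: "wf_two_tape_pda B T" "R = two_tape_language B m T"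
    using assms(1) unfolding is_two_tape_language_def by blast
  have wf: "wf_dpda T" using T(1) unfolding wf_two_tape_pda_def by blast
  have "finite (insert None (Some ` B))"
    using wf_dpda_finite_input[OF wf] T(1) unfolding wf_two_tape_pda_def by (metis finite_PlusD(1))
  moreover have "tape_ok T s x \<longleftrightarrow> (s \<in> sharp_states T) = isl x" if "s \<in> states T" for s x
    using that T(1) unfolding tape_ok_def wf_two_tape_pda_def by auto
  ultimately have "\<exists>Q'. control_machine T (tape_ok T) (\<lambda>s. s \<in> sharp_states T)
      (tape_control ?tr ?fin) Q' ?q (?A <+> ?A)
      (\<lambda>q y. isl y = (case q of None \<Rightarrow> False | Some q \<Rightarrow> tape_side ?fin q))"
    by (intro control_machine_tape_control[OF wf _ _ finite_end_marked_transducer[OF assms(3)]])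
      (use assms(2,4) in simp_all)
  then obtain Q' where Q': "control_machine T (tape_ok T) (\<lambda>s. s \<in> sharp_states T)
      (tape_control ?tr ?fin) Q' ?q (?A <+> ?A)
      (\<lambda>q y. isl y = (case q of None \<Rightarrow> False | Some q \<Rightarrow> tape_side ?fin q))"
    by blast
  have prefix_free: "?tr q y = None" if "?fin q" for q y using that by simp
  have "(\<exists>w bs. lefts w = end_marked u \<and> rights w = end_marked v \<and>
        produces (tape_control ?tr ?fin) ?q w bs \<and>
        (\<forall>b \<in> set bs. accepts_from T m (tape_ok T) b [start_symbol T] (start_state T))) \<longleftrightarrow>
      (\<exists>u' v'. transduce tr fin q0 u = Some u' \<and> transduce tr fin q0 v = Some v' \<and> (u', v') \<in> R)"
    (is "?l \<longleftrightarrow> ?r") if uv: "(u, v) \<in> lists A \<times> lists A" for u v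
  proof
    assume ?l
    then obtain w bs where w: "lefts w = end_marked u" "rights w = end_marked v"
      "produces (tape_control ?tr ?fin) ?q w bs"
      "\<forall>b \<in> set bs. accepts_from T m (tape_ok T) b [start_symbol T] (start_state T)" by blast
    from produces_tape_control_sound[OF w(3)] obtain b where b: "bs = [b]"
      "transduce ?tr ?fin (Some q0) (end_marked u) = Some (lefts b)"
      "transduce ?tr ?fin (Some q0) (end_marked v) = Some (rights b)"
      using w(1,2) by auto
    obtain u' v' where uv': "transduce tr fin q0 u = Some u'" "lefts b = end_marked u'"
      "transduce tr fin q0 v = Some v'" "rights b = end_marked v'"
      using b(2,3) unfolding transduce_end_marked by auto
    moreover have "u' \<in> lists B" "v' \<in> lists B"
      using transduce_lists[OF assms(3,4)] uv uv'(1,3) by blast+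
    ultimately have "(u', v') \<in> R"
      using w(4) b(1) unfolding T(2) two_tape_language_accepts_from[OF wf] by auto
    then show ?r using uv' by blast
  next
    assume ?r
    then obtain u' v' where uv': "transduce tr fin q0 u = Some u'" "transduce tr fin q0 v = Some v'"
      "(u', v') \<in> R" by blast
    then obtain b where b: "lefts b = end_marked u'" "rights b = end_marked v'"
      "accepts_from T m (tape_ok T) b [start_symbol T] (start_state T)"
      unfolding T(2) two_tape_language_accepts_from[OF wf] by blast
    obtain w where "lefts w = end_marked u" "rights w = end_marked v"
      "produces (tape_control ?tr ?fin) ?q w [b]"
      using produces_tape_control_complete[of ?fin ?tr "Some q0" "end_marked u" "end_marked u'"
          "Some q0" "end_marked v" "end_marked v'" b "[]" "[]", OF prefix_free] uv' b
      by (auto simp: transduce_end_marked)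
    then show ?l using b(3) by (intro exI[of _ w] exI[of _ "[b]"]) simp
  qed
  then have "{(u, v) \<in> lists A \<times> lists A. \<exists>w bs. lefts w = end_marked u \<and> rights w = end_marked v \<and>
        produces (tape_control ?tr ?fin) ?q w bs \<and>
        (\<forall>b \<in> set bs. accepts_from T m (tape_ok T) b [start_symbol T] (start_state T))} =
      {(u, v) \<in> lists A \<times> lists A. \<exists>u' v'.
        transduce tr fin q0 u = Some u' \<and> transduce tr fin q0 v = Some v' \<and> (u', v') \<in> R}"
    by (intro Collect_cong) blast
  then show ?thesis using is_two_tape_language_control[OF Q', of m] by simp
qed

section \<open>Unique decomposition into blocks\<close>

lemma end_marked_eq_iff [simp]: "end_marked u = end_marked v \<longleftrightarrow> u = v"
  by (simp add: end_marked_def)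

lemma end_marked_neq_Nil [simp]: "end_marked u \<noteq> []"
  by (simp add: end_marked_def)

lemma end_marked_append_inj: "end_marked u @ xs = end_marked v @ ys \<Longrightarrow> u = v \<and> xs = ys"
proof (induction u arbitrary: v)
  case Nil
  then show ?case by (cases v) (simp_all add: end_marked_def)
next
  case (Cons a u)
  then show ?case by (cases v) (simp_all add: end_marked_def)
qed

lemma concat_end_marked_inj:
  "concat (map end_marked bs) = concat (map end_marked bs') \<longleftrightarrow> bs = bs'"
proof
  show "concat (map end_marked bs) = concat (map end_marked bs') \<Longrightarrow> bs = bs'"
  proof (induction bs arbitrary: bs')
    case Nil
    then show ?case by (cases bs') simp_all
  next
    case (Cons b bs)
    then show ?case by (cases bs') (auto dest: end_marked_append_inj)
  qed
qed simp

lemma concat_end_marked_eq_single: "concat (map end_marked bs) = end_marked u \<longleftrightarrow> bs = [u]"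
  using concat_end_marked_inj[of bs "[u]"] by simp

section \<open>Closure properties\<close>

lemma parallel_poly_pushdown_Int:
  "parallel_poly_pushdown A K \<Longrightarrow> parallel_poly_pushdown A L \<Longrightarrow> parallel_poly_pushdown A (K \<inter> L)"
  unfolding parallel_poly_pushdown_def
  by (elim exE, rename_tac F F', rule_tac x = "F \<union> F'" in exI) auto

lemma async_two_tape_Int:
  "async_two_tape_parallel_poly_pushdown A R \<Longrightarrow> async_two_tape_parallel_poly_pushdown A R' \<Longrightarrow>
    async_two_tape_parallel_poly_pushdown A (R \<inter> R')"
  unfolding async_two_tape_parallel_poly_pushdown_def
  by (elim exE, rename_tac F F', rule_tac x = "F \<union> F'" in exI) auto

text \<open>Intersections pass through because \<open>w\<close> determines \<open>bs\<close>: the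
  blocks found for different members of the family coincide by
  \<open>concat_end_marked_inj\<close>.\<close>

theorem parallel_poly_pushdown_blocks:
  fixes tr :: "'q::countable \<Rightarrow> 'y \<Rightarrow> ('x::countable option list \<times> 'q) option"
  assumes "parallel_poly_pushdown X K" "finite Y"
    "finite_transducer Y (insert None (Some ` X)) tr Q" "q0 \<in> Q"
    and "\<And>q y. fin q \<Longrightarrow> tr q y = None"
  shows "parallel_poly_pushdown Y {w \<in> lists Y. \<exists>bs.
    transduce tr fin q0 w = Some (concat (map end_marked bs)) \<and> set bs \<subseteq> K}"
proof -
  obtain F where F: "finite F" "F \<noteq> {}" "\<forall>K \<in> F. is_dpda_language X K" "K = \<Inter>F"
    using assms(1) unfolding parallel_poly_pushdown_def by blast
  let ?g = "\<lambda>K. {w \<in> lists Y. \<exists>bs.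
    transduce tr fin q0 w = Some (concat (map end_marked bs)) \<and> set bs \<subseteq> K}"
  have "?g K = \<Inter>(?g ` F)"
  proof (intro equalityI subsetI)
    fix w assume "w \<in> ?g K"
    then show "w \<in> \<Inter>(?g ` F)" using F(4) by blast
  next
    fix w assume w: "w \<in> \<Inter>(?g ` F)"
    have w': "w \<in> lists Y" "\<exists>bs. transduce tr fin q0 w = Some (concat (map end_marked bs)) \<and> set bs \<subseteq> K'"
      if "K' \<in> F" for K'
      using INT_D[OF w that] by simp_all
    obtain K0 where K0: "K0 \<in> F" using F(2) by blast
    obtain bs where bs: "transduce tr fin q0 w = Some (concat (map end_marked bs))"
      using w'(2)[OF K0] by blast
    have "set bs \<subseteq> K'" if K': "K' \<in> F" for K'
      using w'(2)[OF K'] bs by (auto simp: concat_end_marked_inj)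
    then show "w \<in> ?g K" using bs w'(1)[OF K0] F(4) by blast
  qed
  moreover have "\<forall>K \<in> ?g ` F. is_dpda_language Y K"
    using is_dpda_language_blocks[OF _ assms(2-5)] F(3) by blast
  ultimately show ?thesis
    unfolding parallel_poly_pushdown_def using F(1,2) by (intro exI[of _ "?g ` F"]) blast
qed

text \<open>Entering a final state announces the end of the input, so the delimiter can be emitted
  together with the last transition. A final start state admits only the empty input and emits no
  delimiter, hence the case distinction.\<close>

lemma transduce_append_end_mark:
  fixes tr :: "'q \<Rightarrow> 'y \<Rightarrow> ('x list \<times> 'q) option"
  assumes prefix_free: "\<And>q y. fin q \<Longrightarrow> tr q y = None"
  defines "tr' \<equiv> \<lambda>q y. map_option (\<lambda>(xs, q'). (map Some xs @ (if fin q' then [None] else []), q')) (tr q y)"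
  shows "transduce tr' fin q w =
    (if fin q then (if w = [] then Some [] else None) else map_option end_marked (transduce tr fin q w))"
proof (induction w arbitrary: q)
  case (Cons y w)
  show ?case
  proof (cases "tr q y")
    case None
    then show ?thesis by (simp add: tr'_def)
  next
    case (Some r)
    obtain xs q' where r: "r = (xs, q')" by (cases r)
    have "\<not> fin q" using prefix_free Some by fastforce
    moreover have "transduce tr fin q' w = (if w = [] then Some [] else None)" if "fin q'"
      using that prefix_free by (cases w) simp_all
    ultimately show ?thesis
      using Some r Cons[of q']
      by (cases "transduce tr fin q' w") (auto simp: tr'_def end_marked_def)
  qed
qed simp

text \<open>The block construction with exactly one block, delimited on entering a final state. With
  \<open>\<not> fin q0\<close> this delimiter is never missing.\<close>

theorem parallel_poly_pushdown_transduce: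
  fixes tr :: "'q::countable \<Rightarrow> 'y \<Rightarrow> ('x::countable list \<times> 'q) option"
  assumes "parallel_poly_pushdown X K" "finite Y" "finite_transducer Y X tr Q" "q0 \<in> Q"
    and "\<And>q y. fin q \<Longrightarrow> tr q y = None" and "\<not> fin q0"
  shows "parallel_poly_pushdown Y {w \<in> lists Y. \<exists>u. transduce tr fin q0 w = Some u \<and> u \<in> K}"
proof -
  let ?tr = "\<lambda>q y. map_option (\<lambda>(xs, q'). (map Some xs @ (if fin q' then [None] else []), q')) (tr q y)"
  have tr: "finite_transducer Y (insert None (Some ` X)) ?tr Q"
    unfolding finite_transducer_def
  proof (intro conjI ballI allI impI)
    show "finite Q" using assms(3) by (simp add: finite_transducer_def)
    fix q y ys q'
    assume *: "q \<in> Q" "y \<in> Y" "?tr q y = Some (ys, q')"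
    then obtain xs where xs: "tr q y = Some (xs, q')" "ys = map Some xs @ (if fin q' then [None] else [])"
      by auto
    show "q' \<in> Q" "ys \<in> lists (insert None (Some ` X))"
      using finite_transducerD[OF assms(3) *(1,2) xs(1)] xs(2) by (auto split: if_splits)
  qed
  have pf: "?tr q y = None" if "fin q" for q y using assms(5)[OF that] by simp
  have "transduce ?tr fin q0 w = map_option end_marked (transduce tr fin q0 w)" for w
    using transduce_append_end_mark[of fin tr q0 w] assms(5,6) by simp
  moreover have "(\<exists>bs. map_option end_marked t = Some (concat (map end_marked bs)) \<and> set bs \<subseteq> K) \<longleftrightarrow>
      (\<exists>u. t = Some u \<and> u \<in> K)" for t :: "'x list option"
    by (cases t) (auto simp: concat_end_marked_eq_single eq_commute[of "end_marked _"])
  ultimately show ?thesis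
    using parallel_poly_pushdown_blocks[where tr = ?tr and fin = fin, OF assms(1,2) tr assms(4) pf]
    by simp
qed

theorem async_two_tape_transduce:
  fixes tr :: "'q::countable \<Rightarrow> 'y \<Rightarrow> ('x::countable list \<times> 'q) option"
  assumes "async_two_tape_parallel_poly_pushdown B R" "finite A" "finite_transducer A B tr Q" "q0 \<in> Q"
  shows "async_two_tape_parallel_poly_pushdown A {(u, v) \<in> lists A \<times> lists A. \<exists>u' v'.
    transduce tr fin q0 u = Some u' \<and> transduce tr fin q0 v = Some v' \<and> (u', v') \<in> R}"
proof -
  obtain F where F: "finite F" "F \<noteq> {}" "\<forall>K \<in> F. is_two_tape_language B K" "R = \<Inter>F"
    using assms(1) unfolding async_two_tape_parallel_poly_pushdown_def by blast
  let ?g = "\<lambda>R. {(u, v) \<in> lists A \<times> lists A. \<exists>u' v'.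
    transduce tr fin q0 u = Some u' \<and> transduce tr fin q0 v = Some v' \<and> (u', v') \<in> R}"
  have "?g R = \<Inter>(?g ` F)"
  proof (rule Set.set_eqI)
    show "p \<in> ?g R \<longleftrightarrow> p \<in> \<Inter>(?g ` F)" for p
      by (cases "transduce tr fin q0 (fst p)"; cases "transduce tr fin q0 (snd p)")
        (use F(2) in \<open>auto simp: F(4) split_beta\<close>)
  qed
  moreover have "is_two_tape_language A (?g K)" if "K \<in> F" for K
    by (rule is_two_tape_language_transduce[OF _ assms(2-4)]) (use F(3) that in blast)
  ultimately show ?thesis
    unfolding async_two_tape_parallel_poly_pushdown_def
    using F(1,2) by (intro exI[of _ "?g ` F"]) blast
qed

section \<open>Conditions on one tape, and equality of the tapes\<close>

fun project_transducer ::
  "bool \<Rightarrow> bool option \<Rightarrow> 'a option + 'a option \<Rightarrow> ('a option list \<times> bool option) option" where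
  "project_transducer b (Some True) (Inl l) = Some (if b then [l] else [], Some (l \<noteq> None))"
| "project_transducer b (Some False) (Inr l) =
    Some (if b then [] else [l], if l = None then None else Some False)"
| "project_transducer b _ _ = None"

lemma end_marked_simps: "end_marked [] = [None]" "end_marked (a # u) = Some a # end_marked u"
  by (simp_all add: end_marked_def)

lemma transduce_project_second:
  "transduce (project_transducer b) (\<lambda>q. q = None) (Some False) w = Some xs \<longleftrightarrow>
    (\<exists>v. w = map Inr (end_marked v) \<and> xs = (if b then [] else end_marked v))"
proof
  show "transduce (project_transducer b) (\<lambda>q. q = None) (Some False) w = Some xs \<Longrightarrow>
    \<exists>v. w = map Inr (end_marked v) \<and> xs = (if b then [] else end_marked v)"
  proof (induction w arbitrary: xs)
    case (Cons x w)
    then obtain l where l: "x = Inr l"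
      by (cases x) auto
    show ?case
    proof (cases l)
      case None
      moreover have "w = []"
        using Cons.prems l None by (cases w) auto
      ultimately show ?thesis
        using Cons.prems l by (intro exI[of _ "[]"]) (auto simp: end_marked_simps)
    next
      case (Some a)
      then obtain xs' where xs': "transduce (project_transducer b) (\<lambda>q. q = None) (Some False) w = Some xs'"
        "xs = (if b then [] else [l]) @ xs'"
        using Cons.prems l by auto
      from Cons.IH[OF xs'(1)] obtain v where
        "w = map Inr (end_marked v)" "xs' = (if b then [] else end_marked v)" by blast
      then show ?thesis
        using xs'(2) l Some by (intro exI[of _ "a # v"]) (simp add: end_marked_simps)
    qed
  qed simp
next
  have "transduce (project_transducer b) (\<lambda>q. q = None) (Some False) (map Inr (end_marked v)) =
      Some (if b then [] else end_marked v)" for v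
    by (induction v) (simp_all add: end_marked_simps)
  then show "\<exists>v. w = map Inr (end_marked v) \<and> xs = (if b then [] else end_marked v) \<Longrightarrow>
      transduce (project_transducer b) (\<lambda>q. q = None) (Some False) w = Some xs"
    by blast
qed

lemma transduce_project:
  "transduce (project_transducer b) (\<lambda>q. q = None) (Some True) w = Some xs \<longleftrightarrow>
    (\<exists>u v. w = map Inl (end_marked u) @ map Inr (end_marked v) \<and>
      xs = (if b then end_marked u else end_marked v))"
proof
  show "transduce (project_transducer b) (\<lambda>q. q = None) (Some True) w = Some xs \<Longrightarrow>
    \<exists>u v. w = map Inl (end_marked u) @ map Inr (end_marked v) \<and>
      xs = (if b then end_marked u else end_marked v)"
  proof (induction w arbitrary: xs)
    case (Cons x w)
    then obtain l where l: "x = Inl l"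
      by (cases x) auto
    show ?case
    proof (cases l)
      case None
      then obtain xs' where xs': "transduce (project_transducer b) (\<lambda>q. q = None) (Some False) w = Some xs'"
        "xs = (if b then [l] else []) @ xs'"
        using Cons.prems l by auto
      from xs'(1) obtain v where "w = map Inr (end_marked v)" "xs' = (if b then [] else end_marked v)"
        unfolding transduce_project_second by blast
      then show ?thesis
        using xs'(2) l None by (intro exI[of _ "[]"] exI[of _ v]) (simp add: end_marked_simps)
    next
      case (Some a)
      then obtain xs' where xs': "transduce (project_transducer b) (\<lambda>q. q = None) (Some True) w = Some xs'"
        "xs = (if b then [l] else []) @ xs'"
        using Cons.prems l by auto
      from Cons.IH[OF xs'(1)] obtain u v where
        "w = map Inl (end_marked u) @ map Inr (end_marked v)"
        "xs' = (if b then end_marked u else end_marked v)" by blast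
      then show ?thesis
        using xs'(2) l Some by (intro exI[of _ "a # u"] exI[of _ v]) (simp add: end_marked_simps)
    qed
  qed simp
next
  have "transduce (project_transducer b) (\<lambda>q. q = None) (Some False) (map Inr (end_marked v)) =
      Some (if b then [] else end_marked v)" for v :: "'a list"
    unfolding transduce_project_second by blast
  then have "transduce (project_transducer b) (\<lambda>q. q = None) (Some True)
      (map Inl (end_marked u) @ map Inr (end_marked v)) =
      Some (if b then end_marked u else end_marked v)" for u v :: "'a list"
    by (induction u) (simp_all add: end_marked_simps)
  then show "\<exists>u v. w = map Inl (end_marked u) @ map Inr (end_marked v) \<and>
      xs = (if b then end_marked u else end_marked v) \<Longrightarrow>
      transduce (project_transducer b) (\<lambda>q. q = None) (Some True) w = Some xs"
    by blast
qed

text \<open>Acceptance asks only for some shuffle, so the sharp tape may be read completely before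
  the flat one. The tape selected by \<open>b\<close> becomes the only block; the other one is read
  and forgotten.\<close>

theorem async_two_tape_project:
  fixes A :: "'a::countable set"
  assumes "parallel_poly_pushdown A L" "finite A"
  shows "async_two_tape_parallel_poly_pushdown A
    {(u, v) \<in> lists A \<times> lists A. (if b then u else v) \<in> L}"
proof -
  obtain F where F: "finite F" "F \<noteq> {}" "\<forall>K \<in> F. is_dpda_language A K" "L = \<Inter>F"
    using assms(1) unfolding parallel_poly_pushdown_def by blast
  let ?g = "\<lambda>K. {(u, v) \<in> lists A \<times> lists A. (if b then u else v) \<in> K}"
  have "is_two_tape_language A (?g K)" if K: "K \<in> F" for K
  proof -
    have tr: "finite_transducer (insert None (Some ` A) <+> insert None (Some ` A))
      (insert None (Some ` A)) (project_transducer b) UNIV"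
      unfolding finite_transducer_def
    proof (intro conjI ballI allI impI)
      fix q y xs q'
      assume "y \<in> insert None (Some ` A) <+> insert None (Some ` A)"
        "project_transducer b q y = Some (xs, q')"
      then show "xs \<in> lists (insert None (Some ` A))"
        by (cases "(b, q, y)" rule: project_transducer.cases) (auto split: if_splits)
    qed simp_all
    have "is_two_tape_language A {(u, v) \<in> lists A \<times> lists A. \<exists>w bs.
      lefts w = end_marked u \<and> rights w = end_marked v \<and>
      transduce (project_transducer b) (\<lambda>q. q = None) (Some True) w = Some (concat (map end_marked bs)) \<and> set bs \<subseteq> K}"
    proof (rule is_two_tape_language_blocks[OF _ assms(2) _ tr, where side = "\<lambda>q. q = Some True"])
      show "isl y = (q = Some True)" if "project_transducer b q y = Some (xs, q')" for q y xs q'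
        using that by (cases "(b, q, y)" rule: project_transducer.cases) (auto split: if_splits)
    qed (use F(3) K in auto)
    moreover have "(\<exists>w bs. lefts w = end_marked u \<and> rights w = end_marked v \<and>
      transduce (project_transducer b) (\<lambda>q. q = None) (Some True) w = Some (concat (map end_marked bs)) \<and> set bs \<subseteq> K) \<longleftrightarrow>
      (if b then u else v) \<in> K" for u v
    proof
      assume "\<exists>w bs. lefts w = end_marked u \<and> rights w = end_marked v \<and>
        transduce (project_transducer b) (\<lambda>q. q = None) (Some True) w = Some (concat (map end_marked bs)) \<and> set bs \<subseteq> K"
      then obtain u' v' bs where
        *: "lefts (map Inl (end_marked u') @ map Inr (end_marked v')) = end_marked u"
        "rights (map Inl (end_marked u') @ map Inr (end_marked v')) = end_marked v"
        "concat (map end_marked bs) = (if b then end_marked u' else end_marked v')" "set bs \<subseteq> K"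
        unfolding transduce_project by blast
      then have "u' = u" "v' = v" by simp_all
      then show "(if b then u else v) \<in> K"
        using *(3,4) by (cases b) (simp_all add: concat_end_marked_eq_single)
    next
      assume "(if b then u else v) \<in> K"
      then show "\<exists>w bs. lefts w = end_marked u \<and> rights w = end_marked v \<and>
        transduce (project_transducer b) (\<lambda>q. q = None) (Some True) w = Some (concat (map end_marked bs)) \<and> set bs \<subseteq> K"
        unfolding transduce_project
        by (intro exI[of _ "map Inl (end_marked u) @ map Inr (end_marked v)"]
            exI[of _ "[if b then u else v]"]) auto
    qed
    ultimately show ?thesis by simp
  qed
  moreover have "?g L = \<Inter>(?g ` F)" using F(2) unfolding F(4) by auto
  ultimately show ?thesis
    unfolding async_two_tape_parallel_poly_pushdown_def
    using F(1,2) by (intro exI[of _ "?g ` F"]) blast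
qed

text \<open>\<open>Some None\<close> awaits a sharp letter, \<open>Some (Some l)\<close> remembers
  the sharp letter \<open>l\<close> to be matched on the flat tape, and \<open>None\<close> is
  reached after both end markers.\<close>

fun equality_transducer ::
  "'a option option option \<Rightarrow> 'a option + 'a option \<Rightarrow>
    ('x option list \<times> 'a option option option) option" where
  "equality_transducer (Some None) (Inl l) = Some ([], Some (Some l))"
| "equality_transducer (Some (Some l)) (Inr l') =
    (if l = l' then Some ([], if l = None then None else Some None) else None)"
| "equality_transducer _ _ = None"

lemma transduce_equality_sound:
  assumes "transduce equality_transducer (\<lambda>q. q = None) (Some None) w = Some (xs :: 'x option list)"
  shows "\<exists>u. lefts w = end_marked u \<and> rights w = end_marked u"
  using assms
\<comment> \<open>Each round consumes a pair of letters, so structural induction would stop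
  halfway.\<close>
proof (induction w arbitrary: xs rule: length_induct)
  case (1 w)
  obtain l w1 where w1: "w = Inl l # w1"
    using 1(2) by (cases w; cases "hd w") (auto split: option.splits)
  then have "transduce equality_transducer (\<lambda>q. q = None) (Some (Some l)) w1 = Some xs"
    using 1(2) by (auto split: option.splits)
  then obtain w2 where w2: "w1 = Inr l # w2"
    "transduce equality_transducer (\<lambda>q. q = None) (if l = None then None else Some None) w2 = Some xs"
    by (cases w1; cases "hd w1") (auto split: option.splits if_splits)
  show ?case
  proof (cases l)
    case None
    then have "w2 = []" using w2(2) by (cases w2) simp_all
    then show ?thesis using w1 w2 None by (intro exI[of _ "[]"]) (simp add: end_marked_simps)
  next
    case (Some a)
    then have "transduce equality_transducer (\<lambda>q. q = None) (Some None) w2 = Some xs"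
      using w2(2) by simp
    moreover have "length w2 < length w" using w1 w2(1) by simp
    ultimately obtain u where "lefts w2 = end_marked u" "rights w2 = end_marked u"
      using 1(1) by blast
    then show ?thesis using w1 w2 Some by (intro exI[of _ "a # u"]) (simp add: end_marked_simps)
  qed
qed

lemma transduce_equality_complete:
  "\<exists>w. lefts w = end_marked u \<and> rights w = end_marked u \<and>
    transduce equality_transducer (\<lambda>q. q = None) (Some None) w = Some ([] :: 'x option list)"
proof (induction u)
  case Nil
  show ?case
    by (rule exI[of _ "[Inl None, Inr None]"]) (simp add: end_marked_simps)
next
  case (Cons a u)
  then obtain w where "lefts w = end_marked u" "rights w = end_marked u"
    "transduce equality_transducer (\<lambda>q. q = None) (Some None) w = Some ([] :: 'x option list)" by blast
  then show ?case
    by (intro exI[of _ "Inl (Some a) # Inr (Some a) # w"]) (simp add: end_marked_simps)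
qed

text \<open>Letters are compared alternately within the finite control, and the list of blocks is
  empty. \<open>K\<close> supplies the automaton that the block construction is built
  around.\<close>

theorem async_two_tape_equality:
  fixes A :: "'a::countable set" and X :: "'x::countable set"
  assumes "finite A" and "is_dpda_language X K"
  shows "async_two_tape_parallel_poly_pushdown A {(u, v) \<in> lists A \<times> lists A. u = v}"
proof -
  let ?tr = "equality_transducer :: _ \<Rightarrow> 'a option + 'a option \<Rightarrow> ('x option list \<times> _) option"
  let ?A = "insert None (Some ` A)"
  have tr: "finite_transducer (?A <+> ?A) (insert None (Some ` X)) ?tr
    (insert None (Some ` insert None (Some ` ?A)))"
    unfolding finite_transducer_def
  proof (intro conjI ballI allI impI)
    fix q y and xs :: "'x option list" and q'
    assume "q \<in> insert None (Some ` insert None (Some ` ?A))" "y \<in> ?A <+> ?A" "?tr q y = Some (xs, q')"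
    then show "xs \<in> lists (insert None (Some ` X))" "q' \<in> insert None (Some ` insert None (Some ` ?A))"
      by (cases "(q, y)" rule: equality_transducer.cases; auto split: if_splits)+
  qed (use assms(1) in simp)
  have "is_two_tape_language A {(u, v) \<in> lists A \<times> lists A. \<exists>w bs.
      lefts w = end_marked u \<and> rights w = end_marked v \<and>
      transduce ?tr (\<lambda>q. q = None) (Some None) w = Some (concat (map end_marked bs)) \<and> set bs \<subseteq> K}"
  proof (rule is_two_tape_language_blocks[OF assms(2,1) _ tr, where side = "\<lambda>q. q = Some None"])
    show "isl y = (q = Some None)" if "?tr q y = Some (xs, q')" for q y xs q'
      using that by (cases "(q, y)" rule: equality_transducer.cases) (auto split: if_splits)
  qed auto
  moreover have "(\<exists>w bs. lefts w = end_marked u \<and> rights w = end_marked v \<and>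
      transduce ?tr (\<lambda>q. q = None) (Some None) w = Some (concat (map end_marked bs)) \<and> set bs \<subseteq> K)
      \<longleftrightarrow> u = v" (is "?l \<longleftrightarrow> _") for u v :: "'a list"
  proof
    assume ?l
    then show "u = v" using transduce_equality_sound by (metis end_marked_eq_iff)
  next
    assume "u = v"
    moreover obtain w where "lefts w = end_marked u" "rights w = end_marked u"
      "transduce ?tr (\<lambda>q. q = None) (Some None) w = Some []"
      using transduce_equality_complete by blast
    ultimately show ?l by (intro exI[of _ w] exI[of _ "[]"]) simp
  qed
  ultimately have "is_two_tape_language A {(u, v) \<in> lists A \<times> lists A. u = v}" by simp
  then show ?thesis
    unfolding async_two_tape_parallel_poly_pushdown_def by (intro exI[of _ "{_}"]) simp
qed

section \<open>A criterion for groups\<close>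

lemma word_value_simps [simp]:
  "word_value G f [] = \<one>\<^bsub>G\<^esub>" "word_value G f (a # w) = f a \<otimes>\<^bsub>G\<^esub> word_value G f w"
  by (simp_all add: word_value_def)

lemma word_value_closed:
  assumes "group G" "f \<in> A \<rightarrow> carrier G" "w \<in> lists A"
  shows "word_value G f w \<in> carrier G"
proof -
  interpret group G by fact
  show ?thesis using assms(3,2) by (induction w) auto
qed

lemma word_value_append:
  assumes "group G" "f \<in> A \<rightarrow> carrier G" "u \<in> lists A" "v \<in> lists A"
  shows "word_value G f (u @ v) = word_value G f u \<otimes>\<^bsub>G\<^esub> word_value G f v"
proof -
  interpret group G by fact
  show ?thesis
    using assms(3)
  proof (induction u)
    case Nil
    then show ?case using word_value_closed[OF assms(1,2,4)] by simp
  next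
    case (Cons a u)
    have "f a \<in> carrier G" using Cons assms(2) by auto
    then show ?case
      using Cons.IH word_value_closed[OF assms(1,2)] Cons.hyps assms(4) by (simp add: m_assoc)
  qed
qed

lemma word_value_comp: "word_value G (f \<circ> g) w = word_value G f (map g w)"
  by (induction w) simp_all

lemma transduce_comp: "transduce (\<lambda>q n. tr q (g n)) fin q w = transduce tr fin q (map g w)"
  by (induction w arbitrary: q) (auto split: option.split)

lemma finite_transducer_comp:
  "finite_transducer C X tr Q \<Longrightarrow> finite_transducer (to_nat ` C) X (\<lambda>q n. tr q (from_nat n)) Q"
  unfolding finite_transducer_def by auto

text \<open>It suffices that \<open>R\<close> is right on normal forms, which is all that
  transducers can easily guarantee: intersecting with the conditions that either component lies in
  \<open>L\<close> repairs it elsewhere. Generators of neutral value are settled here once and for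
  all by the equality relation, so later proofs need not treat markers as multipliers.\<close>

theorem parallel_poly_pushdown_group_criterion:
  fixes f :: "'c::countable \<Rightarrow> 'g"
  assumes "group G" "finite C" and f: "f \<in> C \<rightarrow> carrier G" and "L \<subseteq> lists C"
    and bij: "bij_betw (word_value G f) L (carrier G)"
    and L: "parallel_poly_pushdown (to_nat ` C) (map to_nat ` L)"
    and mult: "\<And>c. c \<in> C \<Longrightarrow> f c \<noteq> \<one>\<^bsub>G\<^esub> \<Longrightarrow> \<exists>R. async_two_tape_parallel_poly_pushdown (to_nat ` C) R \<and>
      (\<forall>w \<in> L. \<forall>w' \<in> L. (map to_nat w, map to_nat w') \<in> R \<longleftrightarrow>
        word_value G f w' = word_value G f (w @ [c]))"
  shows "parallel_poly_pushdown_group G"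
proof -
  interpret group G by fact
  let ?A = "to_nat ` C" and ?f = "f \<circ> from_nat" and ?L = "map to_nat ` L"
  have fin: "finite ?A" using assms(2) by simp
  have dec: "map from_nat (map to_nat w) = w" for w :: "'c list" by (simp add: comp_def map_idI)
  have val: "word_value G ?f (map to_nat w) = word_value G f w" for w
    unfolding word_value_comp dec ..
  have "map to_nat w \<in> lists ?A" if "w \<in> lists C" for w using that by auto
  then have LA: "?L \<subseteq> lists ?A" using assms(4) by blast
  have bij': "bij_betw (word_value G ?f) ?L (carrier G)"
  proof -
    have "bij_betw (map to_nat) L ?L"
      by (rule inj_on_imp_bij_betw) (metis dec inj_onI)
    then have "bij_betw (word_value G f \<circ> map from_nat) ?L (carrier G)"
    proof -
      have "bij_betw (map from_nat) ?L L"
        by (rule bij_betw_byWitness[where f' = "map to_nat"]) (auto simp: dec simp del: map_map)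
      then show ?thesis using bij by (rule bij_betw_trans)
    qed
    moreover have "word_value G ?f = word_value G f \<circ> map from_nat"
      by (rule ext) (simp only: word_value_comp comp_apply)
    ultimately show ?thesis by simp
  qed
  have f': "?f \<in> ?A \<rightarrow> carrier G" using f by auto
  have surj: "word_value G ?f ` lists ?A = carrier G"
    using LA bij' word_value_closed[OF assms(1) f'] unfolding bij_betw_def by blast
  have "async_two_tape_parallel_poly_pushdown ?A
        {(w, w'). w \<in> ?L \<and> w' \<in> ?L \<and> word_value G ?f w' = word_value G ?f (w @ [a])}"
    if "a \<in> ?A" for a
  proof -
    obtain c where c: "c \<in> C" "a = to_nat c" using \<open>a \<in> ?A\<close> by blast
    have app: "word_value G ?f (map to_nat w @ [a]) = word_value G f (w @ [c])" for w
      using val[of "w @ [c]"] c(2) by simp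
    obtain R where R: "async_two_tape_parallel_poly_pushdown ?A R"
      "\<And>w w'. w \<in> L \<Longrightarrow> w' \<in> L \<Longrightarrow> (map to_nat w, map to_nat w') \<in> R \<longleftrightarrow>
        word_value G f w' = word_value G f (w @ [c])"
    proof (cases "f c = \<one>\<^bsub>G\<^esub>")
      case True
      obtain K where "is_dpda_language ?A K"
        using L unfolding parallel_poly_pushdown_def by blast
      then have eq: "async_two_tape_parallel_poly_pushdown ?A {(u, v) \<in> lists ?A \<times> lists ?A. u = v}"
        by (rule async_two_tape_equality[OF fin])
      have "word_value G f (w @ [c]) = word_value G f w" if "w \<in> L" for w
        using word_value_append[OF assms(1) f, of w "[c]"] word_value_closed[OF assms(1) f, of w]
          that assms(4) c(1) True by auto
      moreover have "map to_nat w = map to_nat w' \<longleftrightarrow> w = w'" for w w' :: "'c list"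
        by (metis dec)
      moreover have "word_value G f w' = word_value G f w \<longleftrightarrow> w = w'" if "w \<in> L" "w' \<in> L" for w w'
        using bij that unfolding bij_betw_def by (auto dest: inj_onD)
      ultimately have "(map to_nat w, map to_nat w') \<in> {(u, v) \<in> lists ?A \<times> lists ?A. u = v} \<longleftrightarrow>
          word_value G f w' = word_value G f (w @ [c])" if "w \<in> L" "w' \<in> L" for w w'
        using that LA by (simp del: in_lists_conv_set) blast
      then show ?thesis using that[OF eq] by blast
    next
      case False
      then show ?thesis using mult[OF c(1)] that by blast
    qed
    have eq: "{(w, w'). w \<in> ?L \<and> w' \<in> ?L \<and> word_value G ?f w' = word_value G ?f (w @ [a])} =
        {(u, v) \<in> lists ?A \<times> lists ?A. (if True then u else v) \<in> ?L} \<inter>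
        ({(u, v) \<in> lists ?A \<times> lists ?A. (if False then u else v) \<in> ?L} \<inter> R)"
    proof -
      have "word_value G ?f w' = word_value G ?f (w @ [a]) \<longleftrightarrow> (w, w') \<in> R"
        if ww': "w \<in> ?L" "w' \<in> ?L" for w w'
      proof -
        obtain v v' where "w = map to_nat v" "v \<in> L" "w' = map to_nat v'" "v' \<in> L"
          using ww' by blast
        then show ?thesis using R(2)[of v v'] app val by simp
      qed
      then show ?thesis using LA by (auto simp del: in_lists_conv_set)
    qed
    show ?thesis
      unfolding eq by (intro async_two_tape_Int async_two_tape_project L fin R(1))
  qed
  then have "parallel_poly_pushdown_structure G ?A ?f ?L"
    unfolding parallel_poly_pushdown_structure_def using LA bij' L by blast
  then show ?thesis
    unfolding parallel_poly_pushdown_group_def using assms(1) fin f' surj by blast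
qed

text \<open>Structures on groups use alphabets of natural numbers; this carries a condition on words
  over \<open>C\<close> along the coding.\<close>

lemma Collect_lists_code:
  fixes C :: "'c::countable set"
  shows "{w \<in> lists (to_nat ` C). P (map from_nat w)} = map to_nat ` {w \<in> lists C. P w}"
proof -
  have dec: "map from_nat (map to_nat v) = v" for v :: "'c list" by (simp add: comp_def map_idI)
  have "w \<in> {w \<in> lists (to_nat ` C). P (map from_nat w)} \<longleftrightarrow>
      (\<exists>v \<in> lists C. w = map to_nat v \<and> P (map from_nat w))" for w
    unfolding lists_image by blast
  also have "\<dots> w \<longleftrightarrow> (\<exists>v \<in> lists C. w = map to_nat v \<and> P v)" for w
    using dec by metis
  finally show ?thesis by (intro Set.set_eqI) (simp only: image_iff mem_Collect_eq, blast)
qed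

lemma parallel_poly_pushdown_blocks_code:
  fixes tr :: "'q::countable \<Rightarrow> 'c::countable \<Rightarrow> ('x::countable option list \<times> 'q) option"
  assumes "parallel_poly_pushdown X K" "finite C"
    "finite_transducer C (insert None (Some ` X)) tr Q" "q0 \<in> Q"
    and "\<And>q y. fin q \<Longrightarrow> tr q y = None"
  shows "parallel_poly_pushdown (to_nat ` C) (map to_nat ` {w \<in> lists C. \<exists>bs.
    transduce tr fin q0 w = Some (concat (map end_marked bs)) \<and> set bs \<subseteq> K})"
proof -
  have "finite (to_nat ` C)" using assms(2) by simp
  moreover have "tr q (from_nat n) = None" if "fin q" for q n using assms(5)[OF that] .
  ultimately show ?thesis
    unfolding Collect_lists_code[symmetric] transduce_comp[symmetric]
    by (rule parallel_poly_pushdown_blocks[OF assms(1) _ finite_transducer_comp[OF assms(3)] assms(4)])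
qed

lemma parallel_poly_pushdown_transduce_code:
  fixes tr :: "'q::countable \<Rightarrow> 'c::countable \<Rightarrow> ('x::countable list \<times> 'q) option"
  assumes "parallel_poly_pushdown X K" "finite C" "finite_transducer C X tr Q" "q0 \<in> Q"
    and "\<And>q y. fin q \<Longrightarrow> tr q y = None" and "\<not> fin q0"
  shows "parallel_poly_pushdown (to_nat ` C)
    (map to_nat ` {w \<in> lists C. \<exists>u. transduce tr fin q0 w = Some u \<and> u \<in> K})"
proof -
  have "finite (to_nat ` C)" using assms(2) by simp
  moreover have "tr q (from_nat n) = None" if "fin q" for q n using assms(5)[OF that] .
  ultimately show ?thesis
    unfolding Collect_lists_code[symmetric] transduce_comp[symmetric]
    using parallel_poly_pushdown_transduce[OF assms(1) _ finite_transducer_comp[OF assms(3)] assms(4)]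
      assms(6) by blast
qed

lemma async_two_tape_transduce_code:
  fixes tr :: "'q::countable \<Rightarrow> 'c::countable \<Rightarrow> ('x::countable list \<times> 'q) option"
  assumes "async_two_tape_parallel_poly_pushdown B R" "finite C" "finite_transducer C B tr Q" "q0 \<in> Q"
  obtains R' where "async_two_tape_parallel_poly_pushdown (to_nat ` C) R'"
    "\<And>u v u' v'. u \<in> lists C \<Longrightarrow> v \<in> lists C \<Longrightarrow> transduce tr fin q0 u = Some u' \<Longrightarrow>
      transduce tr fin q0 v = Some v' \<Longrightarrow> (map to_nat u, map to_nat v) \<in> R' \<longleftrightarrow> (u', v') \<in> R"
proof -
  let ?tr = "\<lambda>q n. tr q (from_nat n)"
  let ?R = "{(u, v) \<in> lists (to_nat ` C) \<times> lists (to_nat ` C). \<exists>u' v'.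
    transduce ?tr fin q0 u = Some u' \<and> transduce ?tr fin q0 v = Some v' \<and> (u', v') \<in> R}"
  have dec: "map from_nat (map to_nat w) = w" for w :: "'c list" by (simp add: comp_def map_idI)
  have code: "map to_nat w \<in> lists (to_nat ` C)" if "w \<in> lists C" for w using that by auto
  have "finite (to_nat ` C)" using assms(2) by simp
  then have "async_two_tape_parallel_poly_pushdown (to_nat ` C) ?R"
    by (rule async_two_tape_transduce[OF assms(1) _ finite_transducer_comp[OF assms(3)] assms(4)])
  moreover have "(map to_nat u, map to_nat v) \<in> ?R \<longleftrightarrow> (u', v') \<in> R"
    if "u \<in> lists C" "v \<in> lists C" "transduce tr fin q0 u = Some u'" "transduce tr fin q0 v = Some v'"
    for u v u' v'
    using that(3,4) code[OF that(1)] code[OF that(2)]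
    by (simp add: transduce_comp dec del: in_lists_conv_set map_map)
  ultimately show ?thesis by (rule that)
qed

lemma word_value_snoc:
  assumes "group G" "f \<in> A \<rightarrow> carrier G" "u \<in> lists A" "a \<in> A"
  shows "word_value G f (u @ [a]) = word_value G f u \<otimes>\<^bsub>G\<^esub> f a"
proof -
  interpret group G by fact
  have "f a \<in> carrier G" using assms(2,4) by auto
  then show ?thesis using word_value_append[OF assms(1-3), of "[a]"] assms(4) by simp
qed

text \<open>The flag of a letter names its factor, \<open>True\<close> for the first and
  \<open>False\<close> for the second. All other constructors are markers and receive the neutral
  value.\<close>

datatype marked = Lt bool nat | Sep | Stop | Beg bool | Last bool

instance marked :: countable by countable_datatype

section \<open>Direct products\<close>

definition pair_word :: "nat list \<Rightarrow> nat list \<Rightarrow> marked list" where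
  "pair_word u v = map (Lt True) u @ Sep # map (Lt False) v @ [Stop]"

text \<open>For either \<open>b\<close> the whole format of a pair is verified; \<open>b\<close>
  only selects which component is emitted. The state holds the component being read, and
  \<open>None\<close> is the end.\<close>

fun component_transducer :: "bool \<Rightarrow> bool option \<Rightarrow> marked \<Rightarrow> (nat list \<times> bool option) option" where
  "component_transducer b (Some c) (Lt d a) =
    (if c = d then Some (if b = c then [a] else [], Some c) else None)"
| "component_transducer b (Some True) Sep = Some ([], Some False)"
| "component_transducer b (Some False) Stop = Some ([], None)"
| "component_transducer b _ _ = None"

lemma transduce_component_second:
  "transduce (component_transducer b) (\<lambda>q. q = None) (Some False) w = Some xs \<longleftrightarrow>
    (\<exists>v. w = map (Lt False) v @ [Stop] \<and> xs = (if b then [] else v))"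
proof
  show "transduce (component_transducer b) (\<lambda>q. q = None) (Some False) w = Some xs \<Longrightarrow>
    \<exists>v. w = map (Lt False) v @ [Stop] \<and> xs = (if b then [] else v)"
  proof (induction w arbitrary: xs)
    case (Cons x w)
    then consider a where "x = Lt False a" | "x = Stop"
      by (cases "(b, Some False, x)" rule: component_transducer.cases) (auto split: if_splits)
    then show ?case
    proof cases
      case 1
      then obtain xs' where xs': "transduce (component_transducer b) (\<lambda>q. q = None) (Some False) w = Some xs'"
        "xs = (if b then [] else [a]) @ xs'"
        using Cons.prems by auto
      from Cons.IH[OF xs'(1)] obtain v where "w = map (Lt False) v @ [Stop]" "xs' = (if b then [] else v)"
        by blast
      then show ?thesis using 1 xs'(2) by (intro exI[of _ "a # v"]) simp
    next
      case 2
      then show ?thesis using Cons.prems by (intro exI[of _ "[]"]; cases w) simp_all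
    qed
  qed simp
next
  have "transduce (component_transducer b) (\<lambda>q. q = None) (Some False) (map (Lt False) v @ [Stop]) =
      Some (if b then [] else v)" for v
    by (induction v) simp_all
  then show "\<exists>v. w = map (Lt False) v @ [Stop] \<and> xs = (if b then [] else v) \<Longrightarrow>
      transduce (component_transducer b) (\<lambda>q. q = None) (Some False) w = Some xs"
    by blast
qed

lemma transduce_component:
  "transduce (component_transducer b) (\<lambda>q. q = None) (Some True) w = Some xs \<longleftrightarrow>
    (\<exists>u v. w = pair_word u v \<and> xs = (if b then u else v))"
proof
  show "transduce (component_transducer b) (\<lambda>q. q = None) (Some True) w = Some xs \<Longrightarrow>
    \<exists>u v. w = pair_word u v \<and> xs = (if b then u else v)"
  proof (induction w arbitrary: xs)
    case (Cons x w)
    then consider a where "x = Lt True a" | "x = Sep"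
      by (cases "(b, Some True, x)" rule: component_transducer.cases) (auto split: if_splits)
    then show ?case
    proof cases
      case 1
      then obtain xs' where xs': "transduce (component_transducer b) (\<lambda>q. q = None) (Some True) w = Some xs'"
        "xs = (if b then [a] else []) @ xs'"
        using Cons.prems by auto
      from Cons.IH[OF xs'(1)] obtain u v where "w = pair_word u v" "xs' = (if b then u else v)"
        by blast
      then show ?thesis using 1 xs'(2) by (intro exI[of _ "a # u"] exI[of _ v]) (simp add: pair_word_def)
    next
      case 2
      then have "transduce (component_transducer b) (\<lambda>q. q = None) (Some False) w = Some xs"
        using Cons.prems by auto
      then obtain v where "w = map (Lt False) v @ [Stop]" "xs = (if b then [] else v)"
        unfolding transduce_component_second by blast
      then show ?thesis using 2 by (intro exI[of _ "[]"] exI[of _ v]) (simp add: pair_word_def)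
    qed
  qed simp
next
  have "transduce (component_transducer b) (\<lambda>q. q = None) (Some False) (map (Lt False) v @ [Stop]) =
      Some (if b then [] else v)" for v
    unfolding transduce_component_second by blast
  then have "transduce (component_transducer b) (\<lambda>q. q = None) (Some True) (pair_word u v) =
      Some (if b then u else v)" for u v
    unfolding pair_word_def by (induction u) simp_all
  then show "\<exists>u v. w = pair_word u v \<and> xs = (if b then u else v) \<Longrightarrow>
      transduce (component_transducer b) (\<lambda>q. q = None) (Some True) w = Some xs"
    by blast
qed

lemma pair_word_eq_iff: "pair_word u v = pair_word u' v' \<longleftrightarrow> u = u' \<and> v = v'"
proof
  assume eq: "pair_word u v = pair_word u' v'"
  have "transduce (component_transducer b) (\<lambda>q. q = None) (Some True) (pair_word u v) =
      Some (if b then u else v)" for b u v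
    unfolding transduce_component by blast
  from this[of True u v] this[of False u v] this[of True u' v'] this[of False u' v']
  show "u = u' \<and> v = v'" unfolding eq by simp
qed simp

definition letters :: "nat set \<Rightarrow> nat set \<Rightarrow> marked set" where
  "letters A A' = Lt True ` A \<union> Lt False ` A' \<union> {Sep, Stop, Beg True, Beg False, Last True, Last False}"

lemma finite_letters: "finite A \<Longrightarrow> finite A' \<Longrightarrow> finite (letters A A')"
  by (simp add: letters_def)

lemma Lt_letters [simp]: "Lt b a \<in> letters A A' \<longleftrightarrow> a \<in> (if b then A else A')"
  by (auto simp: letters_def)

lemma marker_letters [simp]: "Sep \<in> letters A A'" "Stop \<in> letters A A'"
    "Beg b \<in> letters A A'" "Last b \<in> letters A A'"
  by (cases b; simp add: letters_def)+

lemma pair_word_letters: "pair_word u v \<in> lists (letters A A') \<longleftrightarrow> u \<in> lists A \<and> v \<in> lists A'"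
  by (auto simp: pair_word_def)

lemma finite_component_transducer:
  "finite_transducer (letters A A') (if b then A else A') (component_transducer b) UNIV"
  unfolding finite_transducer_def
proof (intro conjI ballI allI impI)
  fix q y xs q'
  assume "y \<in> letters A A'" "component_transducer b q y = Some (xs, q')"
  then show "xs \<in> lists (if b then A else A')"
    by (cases "(b, q, y)" rule: component_transducer.cases) (auto split: if_splits)
qed simp_all

fun pair_value ::
  "('g, 'm) monoid_scheme \<Rightarrow> ('h, 'n) monoid_scheme \<Rightarrow> (nat \<Rightarrow> 'g) \<Rightarrow> (nat \<Rightarrow> 'h) \<Rightarrow> marked \<Rightarrow> 'g \<times> 'h" where
  "pair_value G G' f f' (Lt True a) = (f a, \<one>\<^bsub>G'\<^esub>)"
| "pair_value G G' f f' (Lt False a) = (\<one>\<^bsub>G\<^esub>, f' a)"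
| "pair_value G G' f f' _ = (\<one>\<^bsub>G\<^esub>, \<one>\<^bsub>G'\<^esub>)"

text \<open>Multiplication by a generator of one factor is the intersection of two preimages: the
  multiplication relation on the component of that factor and equality on the other one.\<close>

theorem parallel_poly_pushdown_group_DirProd:
  fixes G :: "('g, 'm) monoid_scheme" and G' :: "('h, 'n) monoid_scheme"
  assumes "parallel_poly_pushdown_group G" and "parallel_poly_pushdown_group G'"
  shows "parallel_poly_pushdown_group (G \<times>\<times> G')"
proof -
  interpret G: group G using assms(1) by (simp add: parallel_poly_pushdown_group_def)
  interpret G': group G' using assms(2) by (simp add: parallel_poly_pushdown_group_def)
  obtain A :: "nat set" and f L where A: "finite A" "f \<in> A \<rightarrow> carrier G" "L \<subseteq> lists A"
    "bij_betw (word_value G f) L (carrier G)" "parallel_poly_pushdown A L"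
    "\<And>a. a \<in> A \<Longrightarrow> async_two_tape_parallel_poly_pushdown A
        {(w, w'). w \<in> L \<and> w' \<in> L \<and> word_value G f w' = word_value G f (w @ [a])}"
    using assms(1) unfolding parallel_poly_pushdown_group_def parallel_poly_pushdown_structure_def by blast
  obtain A' :: "nat set" and f' L' where A': "finite A'" "f' \<in> A' \<rightarrow> carrier G'" "L' \<subseteq> lists A'"
    "bij_betw (word_value G' f') L' (carrier G')" "parallel_poly_pushdown A' L'"
    "\<And>a. a \<in> A' \<Longrightarrow> async_two_tape_parallel_poly_pushdown A'
        {(w, w'). w \<in> L' \<and> w' \<in> L' \<and> word_value G' f' w' = word_value G' f' (w @ [a])}"
    using assms(2) unfolding parallel_poly_pushdown_group_def parallel_poly_pushdown_structure_def by blast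
  let ?D = "G \<times>\<times> G'" and ?F = "pair_value G G' f f'" and ?C = "letters A A'"
  let ?W = "(\<lambda>(u, v). pair_word u v) ` (L \<times> L')"
  let ?t = "\<lambda>b. transduce (component_transducer b) (\<lambda>q. q = None) (Some True)"
  have t: "?t b (pair_word u v) = Some (if b then u else v)" for b u v
    unfolding transduce_component by blast
  have grp: "group ?D" by (rule DirProd_group) unfold_locales
  have F: "?F \<in> ?C \<rightarrow> carrier ?D"
  proof
    fix c assume "c \<in> ?C"
    then show "?F c \<in> carrier ?D"
      using A(2) A'(2) by (cases "(G, G', f, f', c)" rule: pair_value.cases) (auto simp: DirProd_def)
  qed
  have WC: "?W \<subseteq> lists ?C"
  proof
    fix w assume "w \<in> ?W"
    then obtain u v where w: "w = pair_word u v" "u \<in> L" "v \<in> L'" by auto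
    then have "u \<in> lists A" "v \<in> lists A'" using A(3) A'(3) by (simp_all only: subsetD)
    then show "w \<in> lists ?C" unfolding w(1) pair_word_letters by (rule conjI)
  qed
  have val1: "word_value ?D ?F (map (Lt True) u @ w) = (word_value G f u \<otimes>\<^bsub>G\<^esub> fst (word_value ?D ?F w), snd (word_value ?D ?F w))"
    if "u \<in> lists A" "w \<in> lists ?C" for u w
    using that(1)
  proof (induction u)
    case Nil
    then show ?case using word_value_closed[OF grp F that(2)] by (auto simp: DirProd_def)
  next
    case (Cons a u)
    then have "f a \<in> carrier G" using A(2) by auto
    then show ?case
      using Cons word_value_closed[OF grp F that(2)] word_value_closed[OF G.group_axioms A(2), of u]
      by (auto simp: DirProd_def G.m_assoc)
  qed
  have val2: "word_value ?D ?F (map (Lt False) v @ w) = (fst (word_value ?D ?F w), word_value G' f' v \<otimes>\<^bsub>G'\<^esub> snd (word_value ?D ?F w))"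
    if "v \<in> lists A'" "w \<in> lists ?C" for v w
    using that(1)
  proof (induction v)
    case Nil
    then show ?case using word_value_closed[OF grp F that(2)] by (auto simp: DirProd_def)
  next
    case (Cons a v)
    then have "f' a \<in> carrier G'" using A'(2) by auto
    then show ?case
      using Cons word_value_closed[OF grp F that(2)] word_value_closed[OF G'.group_axioms A'(2), of v]
      by (auto simp: DirProd_def G'.m_assoc)
  qed
  have val: "word_value ?D ?F (pair_word u v) = (word_value G f u, word_value G' f' v)"
    if uv: "u \<in> L" "v \<in> L'" for u v
  proof -
    have l: "u \<in> lists A" "v \<in> lists A'" using uv A(3) A'(3) by blast+
    then have "Sep # map (Lt False) v @ [Stop] \<in> lists ?C" "[Stop] \<in> lists ?C" by auto
    moreover have "word_value G f u \<in> carrier G" "word_value G' f' v \<in> carrier G'"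
      using word_value_closed[OF G.group_axioms A(2) l(1)] word_value_closed[OF G'.group_axioms A'(2) l(2)]
      by simp_all
    ultimately show ?thesis
      unfolding pair_word_def using val1[OF l(1)] val2[OF l(2)] by (simp add: DirProd_def)
  qed
  have bij: "bij_betw (word_value ?D ?F) ?W (carrier ?D)"
  proof (rule bij_betw_imageI)
    show "inj_on (word_value ?D ?F) ?W"
      using A(4) A'(4) unfolding bij_betw_def inj_on_def by (auto simp: val pair_word_eq_iff)
    have "word_value ?D ?F ` ?W = (\<lambda>(u, v). (word_value G f u, word_value G' f' v)) ` (L \<times> L')"
      unfolding image_image by (rule image_cong) (auto simp: val)
    also have "\<dots> = word_value G f ` L \<times> word_value G' f' ` L'" by auto
    finally show "word_value ?D ?F ` ?W = carrier ?D"
      using A(4) A'(4) by (simp add: bij_betw_def DirProd_def)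
  qed
  have W: "parallel_poly_pushdown (to_nat ` ?C) (map to_nat ` ?W)"
  proof -
    have "parallel_poly_pushdown (to_nat ` ?C) (map to_nat ` {w \<in> lists ?C. \<exists>u. ?t True w = Some u \<and> u \<in> L})"
      using finite_component_transducer[of A A' True] A(5)
      by (intro parallel_poly_pushdown_transduce_code[where X = A and Q = UNIV]) (use finite_letters A(1) A'(1) in simp_all)
    moreover have "parallel_poly_pushdown (to_nat ` ?C) (map to_nat ` {w \<in> lists ?C. \<exists>u. ?t False w = Some u \<and> u \<in> L'})"
      using finite_component_transducer[of A A' False] A'(5)
      by (intro parallel_poly_pushdown_transduce_code[where X = A' and Q = UNIV]) (use finite_letters A(1) A'(1) in simp_all)
    ultimately have "parallel_poly_pushdown (to_nat ` ?C) (map to_nat `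
        ({w \<in> lists ?C. \<exists>u. ?t True w = Some u \<and> u \<in> L} \<inter> {w \<in> lists ?C. \<exists>u. ?t False w = Some u \<and> u \<in> L'}))"
      using parallel_poly_pushdown_Int by (simp add: image_Int[OF inj_mapI[OF inj_to_nat]])
    moreover have "?W = {w \<in> lists ?C. \<exists>u. ?t True w = Some u \<and> u \<in> L} \<inter>
        {w \<in> lists ?C. \<exists>u. ?t False w = Some u \<and> u \<in> L'}" (is "_ = ?R")
    proof
      show "?W \<subseteq> ?R" using WC t by fastforce
      show "?R \<subseteq> ?W"
        unfolding transduce_component by (auto simp: pair_word_eq_iff image_iff)
    qed
    ultimately show ?thesis by simp
  qed
  have mult: "\<exists>R. async_two_tape_parallel_poly_pushdown (to_nat ` ?C) R \<and>
      (\<forall>w \<in> ?W. \<forall>w' \<in> ?W. (map to_nat w, map to_nat w') \<in> R \<longleftrightarrow>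
        word_value ?D ?F w' = word_value ?D ?F (w @ [c]))"
    if c: "c \<in> ?C" "?F c \<noteq> \<one>\<^bsub>?D\<^esub>" for c
  proof -
    have fin: "finite ?C" using finite_letters A(1) A'(1) by blast
    have app: "word_value ?D ?F (pair_word u v @ [c]) = (word_value G f u, word_value G' f' v) \<otimes>\<^bsub>?D\<^esub> ?F c"
      if "u \<in> L" "v \<in> L'" for u v
    proof -
      have "pair_word u v \<in> lists ?C" using that WC by auto
      moreover have "?F c \<in> carrier ?D" using F c(1) by auto
      ultimately show ?thesis
        using word_value_append[OF grp F, of "pair_word u v" "[c]"] c(1) val[OF that]
        by (auto simp: DirProd_def)
    qed
    have inj: "word_value G f u = word_value G f u' \<longleftrightarrow> u = u'" if "u \<in> L" "u' \<in> L" for u u'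
      using A(4) that by (auto simp: bij_betw_def dest: inj_onD)
    have inj': "word_value G' f' u = word_value G' f' u' \<longleftrightarrow> u = u'" if "u \<in> L'" "u' \<in> L'" for u u'
      using A'(4) that by (auto simp: bij_betw_def dest: inj_onD)
    have closed: "word_value G f u \<in> carrier G" if "u \<in> L" for u
      using word_value_closed[OF G.group_axioms A(2)] A(3) that by blast
    have closed': "word_value G' f' u \<in> carrier G'" if "u \<in> L'" for u
      using word_value_closed[OF G'.group_axioms A'(2)] A'(3) that by blast
    \<comment> \<open>Requested by \<open>async_two_tape_equality\<close>; the alphabet of
      \<open>K\<close> may differ from that of the words compared.\<close>
    obtain K where K: "is_dpda_language A K" using A(5) unfolding parallel_poly_pushdown_def by blast
    \<comment> \<open>Markers have neutral value, so a generator of nontrivial value is a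
      letter.\<close>
    consider a where "c = Lt True a" "a \<in> A" | a where "c = Lt False a" "a \<in> A'"
      using c by (cases "(G, G', f, f', c)" rule: pair_value.cases) (auto simp: DirProd_def)
    then show ?thesis
    proof cases
      case 1
      let ?Ra = "{(w, w'). w \<in> L \<and> w' \<in> L \<and> word_value G f w' = word_value G f (w @ [a])}"
      have tr: "finite_transducer ?C A (component_transducer True) UNIV"
        "finite_transducer ?C A' (component_transducer False) UNIV"
        using finite_component_transducer[of A A'] by (metis (full_types))+
      obtain R1 where R1: "async_two_tape_parallel_poly_pushdown (to_nat ` ?C) R1"
          "\<And>u v u' v'. u \<in> lists ?C \<Longrightarrow> v \<in> lists ?C \<Longrightarrow> ?t True u = Some u' \<Longrightarrow> ?t True v = Some v' \<Longrightarrow>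
            (map to_nat u, map to_nat v) \<in> R1 \<longleftrightarrow> (u', v') \<in> ?Ra"
        by (fact async_two_tape_transduce_code[OF A(6)[OF 1(2)] fin tr(1) UNIV_I,
            where fin = "\<lambda>q. q = None" and ?q0.0 = "Some True"])
      obtain R2 where R2: "async_two_tape_parallel_poly_pushdown (to_nat ` ?C) R2"
          "\<And>u v u' v'. u \<in> lists ?C \<Longrightarrow> v \<in> lists ?C \<Longrightarrow> ?t False u = Some u' \<Longrightarrow> ?t False v = Some v' \<Longrightarrow>
            (map to_nat u, map to_nat v) \<in> R2 \<longleftrightarrow> (u', v') \<in> {(u, v) \<in> lists A' \<times> lists A'. u = v}"
        by (fact async_two_tape_transduce_code[OF async_two_tape_equality[OF A'(1) K] fin tr(2) UNIV_I,
            where fin = "\<lambda>q. q = None" and ?q0.0 = "Some True"])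
      have "(map to_nat (pair_word u v), map to_nat (pair_word u' v')) \<in> R1 \<inter> R2 \<longleftrightarrow>
          word_value ?D ?F (pair_word u' v') = word_value ?D ?F (pair_word u v @ [c])"
        if uv: "u \<in> L" "v \<in> L'" "u' \<in> L" "v' \<in> L'" for u v u' v'
      proof -
        have l: "pair_word u v \<in> lists ?C" "pair_word u' v' \<in> lists ?C" using uv WC by auto
        have "word_value ?D ?F (pair_word u' v') = word_value ?D ?F (pair_word u v @ [c]) \<longleftrightarrow>
            word_value G f u' = word_value G f (u @ [a]) \<and> v = v'"
          unfolding val[OF uv(3,4)] app[OF uv(1,2)] unfolding 1(1)
            word_value_snoc[OF G.group_axioms A(2) subsetD[OF A(3) uv(1)] 1(2)]
          by (auto simp: DirProd_def closed'[OF uv(2)] inj'[OF uv(4,2)])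
        moreover have "v \<in> lists A'" "v' \<in> lists A'" using uv A'(3) by blast+
        ultimately show ?thesis
          using R1(2)[OF l t t] R2(2)[OF l t t] uv by (simp del: in_lists_conv_set)
      qed
      then show ?thesis using async_two_tape_Int[OF R1(1) R2(1)] by (intro exI[of _ "R1 \<inter> R2"]) auto
    next
      case 2
      let ?Ra = "{(w, w'). w \<in> L' \<and> w' \<in> L' \<and> word_value G' f' w' = word_value G' f' (w @ [a])}"
      have tr: "finite_transducer ?C A (component_transducer True) UNIV"
        "finite_transducer ?C A' (component_transducer False) UNIV"
        using finite_component_transducer[of A A'] by (metis (full_types))+
      obtain R1 where R1: "async_two_tape_parallel_poly_pushdown (to_nat ` ?C) R1"
          "\<And>u v u' v'. u \<in> lists ?C \<Longrightarrow> v \<in> lists ?C \<Longrightarrow> ?t False u = Some u' \<Longrightarrow> ?t False v = Some v' \<Longrightarrow>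
            (map to_nat u, map to_nat v) \<in> R1 \<longleftrightarrow> (u', v') \<in> ?Ra"
        by (fact async_two_tape_transduce_code[OF A'(6)[OF 2(2)] fin tr(2) UNIV_I,
            where fin = "\<lambda>q. q = None" and ?q0.0 = "Some True"])
      obtain R2 where R2: "async_two_tape_parallel_poly_pushdown (to_nat ` ?C) R2"
          "\<And>u v u' v'. u \<in> lists ?C \<Longrightarrow> v \<in> lists ?C \<Longrightarrow> ?t True u = Some u' \<Longrightarrow> ?t True v = Some v' \<Longrightarrow>
            (map to_nat u, map to_nat v) \<in> R2 \<longleftrightarrow> (u', v') \<in> {(u, v) \<in> lists A \<times> lists A. u = v}"
        by (fact async_two_tape_transduce_code[OF async_two_tape_equality[OF A(1) K] fin tr(1) UNIV_I,
            where fin = "\<lambda>q. q = None" and ?q0.0 = "Some True"])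
      have "(map to_nat (pair_word u v), map to_nat (pair_word u' v')) \<in> R1 \<inter> R2 \<longleftrightarrow>
          word_value ?D ?F (pair_word u' v') = word_value ?D ?F (pair_word u v @ [c])"
        if uv: "u \<in> L" "v \<in> L'" "u' \<in> L" "v' \<in> L'" for u v u' v'
      proof -
        have l: "pair_word u v \<in> lists ?C" "pair_word u' v' \<in> lists ?C" using uv WC by auto
        have "word_value ?D ?F (pair_word u' v') = word_value ?D ?F (pair_word u v @ [c]) \<longleftrightarrow>
            word_value G' f' v' = word_value G' f' (v @ [a]) \<and> u = u'"
          unfolding val[OF uv(3,4)] app[OF uv(1,2)] unfolding 2(1)
            word_value_snoc[OF G'.group_axioms A'(2) subsetD[OF A'(3) uv(2)] 2(2)]
          by (auto simp: DirProd_def closed[OF uv(1)] inj[OF uv(3,1)])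
        moreover have "u \<in> lists A" "u' \<in> lists A" using uv A(3) by blast+
        ultimately show ?thesis
          using R1(2)[OF l t t] R2(2)[OF l t t] uv by (simp del: in_lists_conv_set)
      qed
      then show ?thesis using async_two_tape_Int[OF R1(1) R2(1)] by (intro exI[of _ "R1 \<inter> R2"]) auto
    qed
  qed
  show ?thesis
    by (rule parallel_poly_pushdown_group_criterion[OF grp _ F WC bij W mult])
      (use finite_letters A(1) A'(1) in blast)
qed

section \<open>Free products\<close>

text \<open>
  A reduced word is written block by block, each block opened by a marker that tells its side and
  whether it is the last one. Right multiplication by a generator only affects the last block, and
  that marker lets a two-tape automaton skip all earlier blocks deterministically.
\<close>

fun block_word :: "(bool \<times> nat list) list \<Rightarrow> marked list" where
  "block_word [] = [Stop]"
| "block_word ((c, u) # bs) =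
    (if bs = [] then Last c else Beg c) # map (Lt c) u @ Sep # block_word bs"

datatype parse_state = Between "bool option" | Inside bool bool "nat list" | After | Final

instance parse_state :: countable by countable_datatype

text \<open>
  In \<^term>\<open>Inside c l z\<close> the word \<open>z\<close> is the part of the block read so far, cut off one letter beyond
  the length of the forbidden word \<open>e c\<close>: this keeps the set of states finite.
\<close>

fun parse :: "(bool \<Rightarrow> nat list) \<Rightarrow> bool \<Rightarrow> parse_state \<Rightarrow> marked \<Rightarrow> (nat option list \<times> parse_state) option"
  where
  "parse e b (Between p) (Beg c) = (if p = Some c then None else Some ([], Inside c False []))"
| "parse e b (Between p) (Last c) = (if p = Some c then None else Some ([], Inside c True []))"
| "parse e b (Between p) Stop = (if p = None then Some ([], Final) else None)"
| "parse e b (Inside c l z) (Lt d a) =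
    (if c = d then Some (if b = c then [Some a] else [], Inside c l (take (Suc (length (e c))) (z @ [a])))
     else None)"
| "parse e b (Inside c l z) Sep =
    (if z = e c then None
     else Some (if b = c then [None] else [], if l then After else Between (Some c)))"
| "parse e b After Stop = Some ([], Final)"
| "parse e b _ _ = None"

abbreviation "parse_run e b \<equiv> transduce (parse e b) (\<lambda>q. q = Final)"

lemma take_take_append: "take n (take n xs @ ys) = take n (xs @ ys)"
  by (cases "length xs \<le> n") simp_all

text \<open>Truncation commutes with appending (\<open>take_take_append\<close>), so the comparison
  made at \<open>Sep\<close> concerns the truncation of the whole block, although only a bounded
  prefix is remembered.\<close>

lemma parse_run_Inside:
  "parse_run e b (Inside c l z) w = Some xs \<Longrightarrow> take (Suc (length (e c))) z = z \<Longrightarrow>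
    \<exists>u r xs'. w = map (Lt c) u @ Sep # r \<and> take (Suc (length (e c))) (z @ u) \<noteq> e c \<and>
      parse_run e b (if l then After else Between (Some c)) r = Some xs' \<and>
      xs = (if b = c then end_marked u else []) @ xs'"
proof (induction w arbitrary: z xs)
  case (Cons x w)
  consider a where "x = Lt c a" | "x = Sep" "z \<noteq> e c"
    using Cons.prems(1)
    by (cases "(e, b, Inside c l z, x)" rule: parse.cases) (auto split: if_splits)
  then show ?case
  proof cases
    case 1
    let ?z = "take (Suc (length (e c))) (z @ [a])"
    obtain xs' where xs': "parse_run e b (Inside c l ?z) w = Some xs'"
      "xs = (if b = c then [Some a] else []) @ xs'"
      using Cons.prems(1) 1 by auto
    have "take (Suc (length (e c))) ?z = ?z" by (simp only: take_take min.idem)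
    from Cons.IH[OF xs'(1) this] obtain u r xs'' where u: "w = map (Lt c) u @ Sep # r"
      "take (Suc (length (e c))) (?z @ u) \<noteq> e c"
      "parse_run e b (if l then After else Between (Some c)) r = Some xs''"
      "xs' = (if b = c then end_marked u else []) @ xs''"
      by blast
    have "take (Suc (length (e c))) (z @ a # u) \<noteq> e c"
      using u(2) unfolding take_take_append by simp
    then show ?thesis
      using u xs'(2) 1
      by (intro exI[of _ "a # u"] exI[of _ r] exI[of _ xs'']) (simp add: end_marked_simps)
  next
    case 2
    then obtain xs' where "parse_run e b (if l then After else Between (Some c)) w = Some xs'"
      "xs = (if b = c then [None] else []) @ xs'"
      using Cons.prems(1) by auto
    then show ?thesis
      using 2 Cons.prems(2)
      by (intro exI[of _ "[]"] exI[of _ w] exI[of _ xs']) (simp add: end_marked_simps)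
  qed
qed simp

lemma parse_run_Inside_block:
  assumes "parse_run e b (if l then After else Between (Some c)) r = Some xs"
    and "take (Suc (length (e c))) z = z" "take (Suc (length (e c))) (z @ u) \<noteq> e c"
  shows "parse_run e b (Inside c l z) (map (Lt c) u @ Sep # r) =
    Some ((if b = c then end_marked u else []) @ xs)"
  using assms(2,3)
proof (induction u arbitrary: z)
  case Nil
  then show ?case using assms(1) by (simp add: end_marked_simps)
next
  case (Cons a u)
  let ?z = "take (Suc (length (e c))) (z @ [a])"
  have "take (Suc (length (e c))) (?z @ u) \<noteq> e c"
    using Cons.prems(2) unfolding take_take_append by simp
  moreover have "take (Suc (length (e c))) ?z = ?z" by (simp only: take_take min.idem)
  ultimately have "parse_run e b (Inside c l ?z) (map (Lt c) u @ Sep # r) =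
      Some ((if b = c then end_marked u else []) @ xs)"
    by (intro Cons.IH)
  then show ?case by (simp add: end_marked_simps del: take_append)
qed

lemma parse_run_After: "parse_run e b After w = Some xs \<longleftrightarrow> w = [Stop] \<and> xs = []"
proof
  assume *: "parse_run e b After w = Some xs"
  then obtain w' where w: "w = Stop # w'"
    by (cases w; cases "hd w") auto
  then show "w = [Stop] \<and> xs = []" using * by (cases w') auto
qed simp

text \<open>The additional letter keeps proper extensions of \<open>e\<close> from being mistaken
  for \<open>e\<close>.\<close>

lemma take_Suc_length_eq_iff: "take (Suc (length e)) u = e \<longleftrightarrow> u = e"
proof
  assume *: "take (Suc (length e)) u = e"
  then have "length u \<le> length e"
    by (metis Suc_leI length_take min.absorb2 n_not_Suc_n not_le)
  then show "u = e" using * by simp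
qed simp

text \<open>\<open>e c\<close> will be the normal form of the neutral element of factor
  \<open>c\<close>. Its exclusion makes every block a nontrivial letter of a reduced word.\<close>

fun alternating :: "(bool \<Rightarrow> nat list) \<Rightarrow> bool option \<Rightarrow> (bool \<times> nat list) list \<Rightarrow> bool" where
  "alternating e p [] \<longleftrightarrow> True"
| "alternating e p ((c, u) # bs) \<longleftrightarrow> p \<noteq> Some c \<and> u \<noteq> e c \<and> alternating e (Some c) bs"

definition side_blocks :: "bool \<Rightarrow> (bool \<times> nat list) list \<Rightarrow> nat list list" where
  "side_blocks b bs = map snd (filter (\<lambda>x. fst x = b) bs)"

lemma side_blocks_simps [simp]:
  "side_blocks b [] = []"
  "side_blocks b ((c, u) # bs) = (if b = c then u # side_blocks b bs else side_blocks b bs)"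
  by (auto simp: side_blocks_def)

lemma parse_run_block_word:
  "parse_run e b (Between p) w = Some xs \<longleftrightarrow>
    (\<exists>bs. w = block_word bs \<and> (bs = [] \<longrightarrow> p = None) \<and> alternating e p bs \<and>
      xs = concat (map end_marked (side_blocks b bs)))"
proof
  show "parse_run e b (Between p) w = Some xs \<Longrightarrow>
    \<exists>bs. w = block_word bs \<and> (bs = [] \<longrightarrow> p = None) \<and> alternating e p bs \<and>
      xs = concat (map end_marked (side_blocks b bs))"
  proof (induction "length w" arbitrary: w p xs rule: less_induct)
    case less
    obtain x w' where w: "w = x # w'" using less.prems by (cases w) auto
    consider c where "x = Beg c" "p \<noteq> Some c" | c where "x = Last c" "p \<noteq> Some c" | "x = Stop" "p = None"
      using less.prems w
      by (cases "(e, b, Between p, x)" rule: parse.cases) (auto split: if_splits)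
    then show ?case
    proof cases
      case 1
      then have "parse_run e b (Inside c False []) w' = Some xs"
        using less.prems w by auto
      from parse_run_Inside[OF this] obtain u r xs' where u: "w' = map (Lt c) u @ Sep # r"
        "u \<noteq> e c" "parse_run e b (Between (Some c)) r = Some xs'"
        "xs = (if b = c then end_marked u else []) @ xs'"
        by (auto simp: take_Suc_length_eq_iff)
      have "length r < length w" using w u(1) by simp
      from less.hyps[OF this u(3)] obtain bs where "r = block_word bs" "bs \<noteq> []"
        "alternating e (Some c) bs" "xs' = concat (map end_marked (side_blocks b bs))" by blast
      then show ?thesis using w u 1 by (intro exI[of _ "(c, u) # bs"]) simp
    next
      case 2
      then have "parse_run e b (Inside c True []) w' = Some xs"
        using less.prems w by auto
      from parse_run_Inside[OF this] obtain u r xs' where u: "w' = map (Lt c) u @ Sep # r"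
        "u \<noteq> e c" "parse_run e b After r = Some xs'"
        "xs = (if b = c then end_marked u else []) @ xs'"
        by (auto simp: take_Suc_length_eq_iff)
      then show ?thesis using w 2 unfolding parse_run_After by (intro exI[of _ "[(c, u)]"]) simp
    next
      case 3
      then have "parse_run e b Final w' = Some xs" using less.prems w by auto
      then have "w' = []" "xs = []" by (cases w'; simp)+
      then show ?thesis using w 3 by (intro exI[of _ "[]"]) simp
    qed
  qed
next
  have "parse_run e b (Between p) (block_word bs) = Some (concat (map end_marked (side_blocks b bs)))"
    if "bs = [] \<longrightarrow> p = None" "alternating e p bs" for bs
    using that
  proof (induction bs arbitrary: p)
    case (Cons d bs)
    obtain c u where d: "d = (c, u)" by (cases d)
    have u: "take (Suc (length (e c))) ([] @ u) \<noteq> e c"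
      using Cons.prems(2) d by (simp add: take_Suc_length_eq_iff)
    have p: "p \<noteq> Some c" "alternating e (Some c) bs" using Cons.prems(2) d by simp_all
    show ?case
    proof (cases "bs = []")
      case True
      have "parse_run e b (Inside c True []) (map (Lt c) u @ Sep # [Stop]) =
          Some ((if b = c then end_marked u else []) @ [])"
        by (rule parse_run_Inside_block[where e = e and c = c and z = "[]" and u = u, OF _ _ u]) (simp_all add: parse_run_After)
      then show ?thesis using True d p by simp
    next
      case False
      have "parse_run e b (Inside c False []) (map (Lt c) u @ Sep # block_word bs) =
          Some ((if b = c then end_marked u else []) @ concat (map end_marked (side_blocks b bs)))"
        by (rule parse_run_Inside_block[where e = e and c = c and z = "[]" and u = u, OF _ _ u]) (use Cons.IH p(2) False in simp_all)
      then show ?thesis using False d p by simp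
    qed
  qed simp
  then show "\<exists>bs. w = block_word bs \<and> (bs = [] \<longrightarrow> p = None) \<and> alternating e p bs \<and>
      xs = concat (map end_marked (side_blocks b bs)) \<Longrightarrow>
    parse_run e b (Between p) w = Some xs" by blast
qed

lemma finite_parse:
  assumes "finite (A True)" "finite (A False)"
  shows "\<exists>Q. finite_transducer (letters (A True) (A False)) (insert None (Some ` A b)) (parse e b) Q \<and>
    Between None \<in> Q"
proof -
  \<comment> \<open>The truncation depends on the side, so the larger of the two bounds is
    taken.\<close>
  let ?N = "Suc (max (length (e True)) (length (e False)))"
  define B where "B = {z. set z \<subseteq> A True \<union> A False \<and> length z \<le> ?N}"
  define Q where "Q = range Between \<union> (\<lambda>(c, l, z). Inside c l z) ` (UNIV \<times> UNIV \<times> B) \<union> {After, Final}"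
  have B: "take (Suc (length (e c))) (z @ [a]) \<in> B" if "z \<in> B" "a \<in> A c" for c z a
  proof -
    have "set (take (Suc (length (e c))) (z @ [a])) \<subseteq> set (z @ [a])" by (rule set_take_subset)
    moreover have "set (z @ [a]) \<subseteq> A True \<union> A False" using that by (cases c) (auto simp: B_def)
    moreover have "length (take (Suc (length (e c))) (z @ [a])) \<le> ?N" by (cases c) auto
    ultimately show ?thesis unfolding B_def by blast
  qed
  have Q_Inside: "Inside c l z \<in> Q \<longleftrightarrow> z \<in> B" for c l z
    by (auto simp: Q_def intro: rev_image_eqI[where x = "(c, l, z)"])
  have Q_other: "Between p \<in> Q" "After \<in> Q" "Final \<in> Q" for p by (auto simp: Q_def)
  have "finite_transducer (letters (A True) (A False)) (insert None (Some ` A b)) (parse e b) Q"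
    unfolding finite_transducer_def
  proof (intro conjI ballI allI impI)
    have "finite B" using assms unfolding B_def by (intro finite_lists_length_le) simp
    then show "finite Q" by (simp add: Q_def)
    fix q y xs q'
    assume *: "q \<in> Q" "y \<in> letters (A True) (A False)" "parse e b q y = Some (xs, q')"
    have "[] \<in> B" by (simp add: B_def)
    then have "xs \<in> lists (insert None (Some ` A b)) \<and> q' \<in> Q"
      using *
    proof (cases "(e, b, q, y)" rule: parse.cases)
      case (4 e' b' c l z d a)
      then have "a \<in> A c" "z \<in> B" using * Q_Inside by (auto split: if_splits)
      then show ?thesis using 4 * B by (auto simp: Q_Inside split: if_splits)
    qed (auto simp: Q_Inside Q_other split: if_splits)
    then show "xs \<in> lists (insert None (Some ` A b))" "q' \<in> Q" by simp_all
  qed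
  then show ?thesis using Q_other by blast
qed

subsection \<open>The last block and the rest\<close>

text \<open>State \<open>True\<close> means that the last block has begun and lies on side
  \<open>b\<close>. If this never happens, \<open>Stop\<close> emits the substitute
  \<open>e\<close>.\<close>

fun last_transducer :: "nat list \<Rightarrow> bool \<Rightarrow> bool \<Rightarrow> marked \<Rightarrow> (nat list \<times> bool) option" where
  "last_transducer e b False (Last c) = Some ([], c = b)"
| "last_transducer e b False Stop = Some (e, False)"
| "last_transducer e b True (Lt d a) = Some (if d = b then [a] else [], True)"
| "last_transducer e b q _ = Some ([], q)"

text \<open>A last block of the other side is copied with \<open>Beg\<close> in place of
  \<open>Last\<close>: in the product the same block may be followed by a new block on side
  \<open>b\<close>, so the copies to be compared must not depend on which block closes the word.
  State \<open>True\<close> discards a last block on side \<open>b\<close>.\<close>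

fun rest_transducer :: "bool \<Rightarrow> bool \<Rightarrow> marked \<Rightarrow> (marked list \<times> bool) option" where
  "rest_transducer b True y = Some ([], True)"
| "rest_transducer b False (Last c) = Some (if c = b then [] else [Beg c], c = b)"
| "rest_transducer b False Stop = Some ([], False)"
| "rest_transducer b False y = Some ([y], False)"

definition last_block :: "nat list \<Rightarrow> bool \<Rightarrow> (bool \<times> nat list) list \<Rightarrow> nat list" where
  "last_block e b bs = (if bs \<noteq> [] \<and> fst (last bs) = b then snd (last bs) else e)"

definition other_blocks :: "bool \<Rightarrow> (bool \<times> nat list) list \<Rightarrow> (bool \<times> nat list) list" where
  "other_blocks b bs = (if bs \<noteq> [] \<and> fst (last bs) = b then butlast bs else bs)"

definition plain_word :: "(bool \<times> nat list) list \<Rightarrow> marked list" where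
  "plain_word bs = concat (map (\<lambda>(c, u). Beg c # map (Lt c) u @ [Sep]) bs)"

lemma map_option_append [simp]: "map_option ((@) []) t = t" "map_option ((@) [x]) t = map_option ((#) x) t"
  by (cases t; simp)+

lemma plain_word_simps [simp]:
  "plain_word [] = []"
  "plain_word ((c, u) # bs) = Beg c # map (Lt c) u @ Sep # plain_word bs"
  by (simp_all add: plain_word_def)

lemma transduce_last_skip:
  "transduce (last_transducer e b) (\<lambda>_. True) False (map (Lt c) u @ Sep # w) =
    transduce (last_transducer e b) (\<lambda>_. True) False w"
  by (induction u) simp_all

lemma transduce_last_block_word:
  "transduce (last_transducer e b) (\<lambda>_. True) False (block_word bs) = Some (last_block e b bs)"
proof (induction bs)
  case (Cons d bs)
  obtain c u where d: "d = (c, u)" by (cases d)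
  have last: "transduce (last_transducer e b) (\<lambda>_. True) True (map (Lt b) u @ [Sep, Stop]) = Some u"
    for u by (induction u) simp_all
  show ?case
  proof (cases "bs = []")
    case True
    then show ?thesis
      using d last[of u] by (simp add: last_block_def transduce_last_skip)
  next
    case False
    then show ?thesis
      using d Cons by (simp add: last_block_def transduce_last_skip)
  qed
qed (simp add: last_block_def)

lemma transduce_rest_copy:
  "transduce (rest_transducer b) (\<lambda>_. True) False (map (Lt c) u @ Sep # w) =
    map_option (\<lambda>xs. map (Lt c) u @ Sep # xs) (transduce (rest_transducer b) (\<lambda>_. True) False w)"
  by (induction u) (simp_all add: option.map_comp comp_def)

lemma transduce_rest_block_word:
  "transduce (rest_transducer b) (\<lambda>_. True) False (block_word bs) = Some (plain_word (other_blocks b bs))"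
proof (induction bs)
  case (Cons d bs)
  obtain c u where d: "d = (c, u)" by (cases d)
  have last: "transduce (rest_transducer b) (\<lambda>_. True) True w = Some []" for w
    by (induction w) simp_all
  show ?case
  proof (cases "bs = []")
    case True
    then show ?thesis
      using d last by (simp add: other_blocks_def transduce_rest_copy)
  next
    case False
    then show ?thesis
      using d Cons by (simp add: other_blocks_def transduce_rest_copy)
  qed
qed (simp add: other_blocks_def)

lemma map_Lt_append_eq: "map (Lt c) u @ Sep # w = map (Lt c) v @ Sep # w' \<Longrightarrow> u = v \<and> w = w'"
proof (induction u arbitrary: v)
  case Nil
  then show ?case by (cases v) simp_all
next
  case (Cons a u)
  then show ?case by (cases v) simp_all
qed

lemma plain_word_eq_iff: "plain_word bs = plain_word bs' \<longleftrightarrow> bs = bs'"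
proof
  show "plain_word bs = plain_word bs' \<Longrightarrow> bs = bs'"
  proof (induction bs arbitrary: bs')
    case Nil
    then show ?case by (cases bs' rule: block_word.cases) simp_all
  next
    case (Cons d bs)
    then show ?case
      by (cases bs' rule: block_word.cases; cases d) (auto dest: map_Lt_append_eq)
  qed
qed simp

lemma finite_last_transducer:
  assumes "e \<in> lists (A b)"
  shows "finite_transducer (letters (A True) (A False)) (A b) (last_transducer e b) UNIV"
  unfolding finite_transducer_def
proof (intro conjI ballI allI impI)
  fix q y xs q'
  assume "y \<in> letters (A True) (A False)" "last_transducer e b q y = Some (xs, q')"
  then show "xs \<in> lists (A b)"
    using assms by (cases "(e, b, q, y)" rule: last_transducer.cases) (auto split: if_splits)
qed simp_all

lemma finite_rest_transducer: "finite_transducer (letters A A') (letters A A') (rest_transducer b) UNIV"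
  unfolding finite_transducer_def
proof (intro conjI ballI allI impI)
  fix q y xs q'
  assume "y \<in> letters A A'" "rest_transducer b q y = Some (xs, q')"
  then show "xs \<in> lists (letters A A')"
    by (cases "(b, q, y)" rule: rest_transducer.cases) (auto split: if_splits)
qed simp_all

lemma block_word_letters:
  "block_word bs \<in> lists (letters (A True) (A False)) \<longleftrightarrow> (\<forall>(c, u) \<in> set bs. u \<in> lists (A c))"
  by (induction bs rule: block_word.induct) (auto split: if_splits)

lemma plain_word_letters:
  "(\<forall>(c, u) \<in> set bs. u \<in> lists (A c)) \<Longrightarrow> plain_word bs \<in> lists (letters (A True) (A False))"
  by (induction bs) (auto split: if_splits)

text \<open>Replaces the recursion from the left by a local condition on neighbours, since
  multiplication acts at the right end.\<close>

lemma alternating_iff: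
  "alternating e p bs \<longleftrightarrow> successively (\<lambda>x y. fst x \<noteq> fst y) bs \<and> (\<forall>(c, u) \<in> set bs. u \<noteq> e c) \<and>
    (bs = [] \<or> p \<noteq> Some (fst (hd bs)))"
proof (induction bs arbitrary: p)
  case (Cons d bs)
  then show ?case by (cases d; cases bs) auto
qed simp

lemma alternating_snoc:
  "alternating e None (bs @ [(b, u)]) \<longleftrightarrow>
    alternating e None bs \<and> u \<noteq> e b \<and> (bs = [] \<or> fst (last bs) \<noteq> b)"
  by (auto simp: alternating_iff successively_append_iff)

lemma other_blocks_snoc:
  "other_blocks b (bs @ [(c, u)]) = (if c = b then bs else bs @ [(c, u)])"
  "last_block e b (bs @ [(c, u)]) = (if c = b then u else e)"
  by (simp_all add: other_blocks_def last_block_def)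

section \<open>Normal forms of the free product and their multiplication\<close>

locale free_product_structure = two_groups G H
  for G :: "('g, 'm) monoid_scheme" and H :: "('h, 'n) monoid_scheme" +
  fixes A :: "bool \<Rightarrow> nat set" and f :: "nat \<Rightarrow> 'g" and f' :: "nat \<Rightarrow> 'h"
    and L :: "bool \<Rightarrow> nat list set" and e :: "bool \<Rightarrow> nat list"
  assumes finite_A: "finite (A b)"
    and f: "f \<in> A True \<rightarrow> carrier G" and f': "f' \<in> A False \<rightarrow> carrier H"
    and L_lists: "L b \<subseteq> lists (A b)"
    and bij: "bij_betw (word_value G f) (L True) (carrier G)"
    and bij': "bij_betw (word_value H f') (L False) (carrier H)"
    and e: "e b \<in> L b" and e_True: "word_value G f (e True) = \<one>\<^bsub>G\<^esub>"
    and e_False: "word_value H f' (e False) = \<one>\<^bsub>H\<^esub>"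
    and L_pushdown: "parallel_poly_pushdown (A b) (L b)"
    and mult_True: "a \<in> A True \<Longrightarrow> async_two_tape_parallel_poly_pushdown (A True)
      {(w, w'). w \<in> L True \<and> w' \<in> L True \<and> word_value G f w' = word_value G f (w @ [a])}"
    and mult_False: "a \<in> A False \<Longrightarrow> async_two_tape_parallel_poly_pushdown (A False)
      {(w, w'). w \<in> L False \<and> w' \<in> L False \<and> word_value H f' w' = word_value H f' (w @ [a])}"
begin

abbreviation "FP \<equiv> free_product G H"

definition block_letter :: "bool \<times> nat list \<Rightarrow> 'g + 'h" where
  "block_letter x = (if fst x then Inl (word_value G f (snd x)) else Inr (word_value H f' (snd x)))"

definition embed :: "'g + 'h \<Rightarrow> ('g + 'h) list" where
  "embed x = push_letter G H x []"

fun letter_value :: "marked \<Rightarrow> ('g + 'h) list" where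
  "letter_value (Lt b a) = embed (if b then Inl (f a) else Inr (f' a))"
| "letter_value _ = []"

definition blocks :: "(bool \<times> nat list) list set" where
  "blocks = {bs. alternating e None bs \<and> (\<forall>(c, u) \<in> set bs. u \<in> L c)}"

abbreviation "Y \<equiv> letters (A True) (A False)"

lemma isl_block_letter [simp]: "isl (block_letter (c, u)) = c"
  by (simp add: block_letter_def)

lemma block_letter_closed: "u \<in> lists (A b) \<Longrightarrow> block_letter (b, u) \<in> cG"
  using word_value_closed[OF G.group_axioms f] word_value_closed[OF H.group_axioms f']
  by (cases b) (simp_all add: block_letter_def InlI InrI del: in_lists_conv_set)

lemma block_letter_inj: "u \<in> L b \<Longrightarrow> v \<in> L b \<Longrightarrow> block_letter (b, u) = block_letter (b, v) \<longleftrightarrow> u = v"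
  using bij bij' by (cases b) (auto simp: block_letter_def bij_betw_def dest: inj_onD)

lemma block_letter_surj:
  assumes "u \<in> lists (A b)"
  obtains u' where "u' \<in> L b" "block_letter (b, u') = block_letter (b, u)"
proof (cases b)
  case True
  have "word_value G f u \<in> carrier G"
    by (rule word_value_closed[OF G.group_axioms f]) (use assms True in simp)
  then have "word_value G f u \<in> word_value G f ` L True" using bij by (simp add: bij_betw_def)
  then obtain u' where "u' \<in> L True" "word_value G f u' = word_value G f u" by (metis imageE)
  then show ?thesis using that True by (simp add: block_letter_def)
next
  case False
  have "word_value H f' u \<in> carrier H"
    by (rule word_value_closed[OF H.group_axioms f']) (use assms False in simp)
  then have "word_value H f' u \<in> word_value H f' ` L False" using bij' by (simp add: bij_betw_def)
  then obtain u' where "u' \<in> L False" "word_value H f' u' = word_value H f' u" by (metis imageE)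
  then show ?thesis using that False by (simp add: block_letter_def)
qed

lemma block_letter_e: "block_letter (b, e b) = (if b then Inl \<one>\<^bsub>G\<^esub> else Inr \<one>\<^bsub>H\<^esub>)"
  by (simp add: block_letter_def e_True e_False)

text \<open>Words in \<open>L b\<close> are determined by their values, so \<open>e b\<close> is the
  only one with neutral value.\<close>

lemma block_letter_nontrivial:
  assumes "u \<in> L b"
  shows "block_letter (b, u) \<in> free_product_letters G H \<longleftrightarrow> u \<noteq> e b"
proof -
  have "block_letter (b, u) \<in> cG" using block_letter_closed L_lists assms by blast
  then have "block_letter (b, u) \<in> free_product_letters G H \<longleftrightarrow> block_letter (b, u) \<noteq> block_letter (b, e b)"
    by (cases b) (auto simp: block_letter_e block_letter_def e_True e_False)
  then show ?thesis using block_letter_inj[OF assms e] by simp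
qed

lemma embed_reduced: "x \<in> cG \<Longrightarrow> embed x \<in> RW"
  by (auto simp: embed_def push_letter_def Cons_reduced)

lemma embed_mult: "x \<in> cG \<Longrightarrow> w \<in> RW \<Longrightarrow> foldr mg (embed x) w = mg x w"
  by (auto simp: embed_def push_letter_def mg_one)

lemma mg_Nil: "mg x [] = embed x"
  by (cases x) (simp_all add: embed_def)

text \<open>Multiplication within a factor carries over to the free product; this is
  \<open>mg_Inl_Inl\<close> or \<open>mg_Inr_Inr\<close> at the empty word.\<close>

lemma embed_block_append:
  assumes "u \<in> lists (A b)" "v \<in> lists (A b)"
  shows "mg (block_letter (b, u)) (embed (block_letter (b, v))) = embed (block_letter (b, u @ v))"
proof (cases b)
  case True
  then show ?thesis
    using assms word_value_closed[OF G.group_axioms f] word_value_append[OF G.group_axioms f]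
      mg_Inl_Inl[of "word_value G f u" "word_value G f v" "[]"]
    by (simp add: block_letter_def mg_Nil embed_def del: in_lists_conv_set)
next
  case False
  then show ?thesis
    using assms word_value_closed[OF H.group_axioms f'] word_value_append[OF H.group_axioms f']
      mg_Inr_Inr[of "word_value H f' u" "word_value H f' v" "[]"]
    by (simp add: block_letter_def mg_Nil embed_def del: in_lists_conv_set)
qed

lemma letter_value_block: "a \<in> A b \<Longrightarrow> letter_value (Lt b a) = embed (block_letter (b, [a]))"
  using Pi_mem[OF f, of a] Pi_mem[OF f', of a] by (cases b) (simp_all add: block_letter_def)

lemma letter_value_closed: "letter_value \<in> Y \<rightarrow> carrier FP"
proof
  fix y assume y: "y \<in> Y"
  show "letter_value y \<in> carrier FP"
  proof (cases y)
    case (Lt b a)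
    then have "a \<in> A b" using y by (cases b) simp_all
    then have "[a] \<in> lists (A b)" by simp
    then show ?thesis
      using Lt letter_value_block[OF \<open>a \<in> A b\<close>] embed_reduced[OF block_letter_closed] by simp
  qed simp_all
qed

lemma group_FP: "group FP"
  by (rule group_free_product)

lemma word_value_block:
  assumes "u \<in> lists (A b)"
  shows "word_value FP letter_value (map (Lt b) u) = embed (block_letter (b, u))"
  using assms
proof (induction u)
  case Nil
  then show ?case by (simp add: block_letter_def embed_def push_letter_def)
next
  case (Cons a u)
  then have a: "[a] \<in> lists (A b)" "a \<in> A b" by simp_all
  have "foldr mg (embed (block_letter (b, [a]))) (embed (block_letter (b, u))) =
      mg (block_letter (b, [a])) (embed (block_letter (b, u)))"
    using Cons a by (intro embed_mult embed_reduced block_letter_closed) simp_all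
  then show ?case
    using Cons embed_block_append[OF a(1) Cons.hyps(2)] letter_value_block[OF a(2)] by simp
qed

definition blocks_value :: "(bool \<times> nat list) list \<Rightarrow> ('g + 'h) list" where
  "blocks_value bs = foldr mg (map block_letter bs) []"

lemma map_block_letter_lists:
  "\<forall>(c, u) \<in> set bs. u \<in> lists (A c) \<Longrightarrow> map block_letter bs \<in> lists cG"
  using block_letter_closed by (induction bs) (auto simp del: in_lists_conv_set intro: lists.intros)

lemma blocks_value_reduced: "\<forall>(c, u) \<in> set bs. u \<in> lists (A c) \<Longrightarrow> blocks_value bs \<in> RW"
  unfolding blocks_value_def by (intro foldr_reduced map_block_letter_lists) simp_all

lemma word_value_block_word:
  assumes "\<forall>(c, u) \<in> set bs. u \<in> lists (A c)"
  shows "word_value FP letter_value (block_word bs) = blocks_value bs"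
  using assms
proof (induction bs)
  case Nil
  then show ?case by (simp add: blocks_value_def)
next
  case (Cons d bs)
  obtain c u where d: "d = (c, u)" by (cases d)
  have u: "u \<in> lists (A c)" and bs: "\<forall>(c, u) \<in> set bs. u \<in> lists (A c)" using Cons.prems d by auto
  have lists: "map (Lt c) u \<in> lists Y" "Sep # block_word bs \<in> lists Y"
  proof -
    show "map (Lt c) u \<in> lists Y" using u by (cases c) auto
    show "Sep # block_word bs \<in> lists Y" using block_word_letters[of bs A] bs by simp
  qed
  have "word_value FP letter_value (map (Lt c) u @ Sep # block_word bs) =
      foldr mg (embed (block_letter (c, u))) (blocks_value bs)"
    using word_value_append[OF group_FP letter_value_closed lists] word_value_block[OF u] Cons.IH[OF bs]
    by simp
  also have "\<dots> = mg (block_letter (c, u)) (blocks_value bs)"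
    by (rule embed_mult[OF block_letter_closed[OF u] blocks_value_reduced[OF bs]])
  finally have *: "word_value FP letter_value (map (Lt c) u @ Sep # block_word bs) = blocks_value (d # bs)"
    by (simp add: blocks_value_def d)
  then show ?case using d by simp
qed

lemma blocks_value_snoc:
  assumes "\<forall>(c, u) \<in> set bs. u \<in> lists (A c)" "v \<in> lists (A b)"
  shows "blocks_value (bs @ [(b, v)]) = foldr mg (blocks_value bs) (embed (block_letter (b, v)))"
  using foldr_assoc[OF map_block_letter_lists[OF assms(1)], of "[]" "embed (block_letter (b, v))"]
    embed_reduced[OF block_letter_closed[OF assms(2)]]
  by (simp add: blocks_value_def mg_Nil embed_def)

text \<open>The conditions match letter by letter: sides of neighbouring blocks correspond to
  factors of neighbouring letters, and blocks other than \<open>e c\<close> to nontrivial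
  letters.\<close>

lemma map_block_letter_reduced:
  assumes "\<forall>(c, u) \<in> set bs. u \<in> L c"
  shows "map block_letter bs \<in> RW \<longleftrightarrow> alternating e None bs"
proof -
  \<comment> \<open>Generalised over the side \<open>p\<close> of a preceding block, as the
    induction requires.\<close>
  have "map block_letter bs \<in> RW \<and> (bs = [] \<or> p \<noteq> Some (fst (hd bs))) \<longleftrightarrow> alternating e p bs" for p
    using assms
  proof (induction bs arbitrary: p)
    case (Cons d bs)
    obtain c u where d: "d = (c, u)" by (cases d)
    have "u \<in> L c" "\<forall>(c, u) \<in> set bs. u \<in> L c" using Cons.prems d by auto
    moreover have "map block_letter bs = [] \<or> c \<noteq> isl (hd (map block_letter bs)) \<longleftrightarrow>
        bs = [] \<or> Some c \<noteq> Some (fst (hd bs))"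
      by (cases bs) auto
    ultimately show ?case
      using d Cons.IH[of "Some c"] block_letter_nontrivial[of u c] by (auto simp: Cons_reduced)
  qed simp
  from this[of None] show ?thesis by simp
qed

lemma blocks_lists: "bs \<in> blocks \<Longrightarrow> \<forall>(c, u) \<in> set bs. u \<in> lists (A c)"
  using L_lists unfolding blocks_def by blast

text \<open>On normal forms nothing merges, so the value is the reduced word read off letter by
  letter. Bijectivity then comes from the two factors.\<close>

lemma blocks_value_blocks: "bs \<in> blocks \<Longrightarrow> blocks_value bs = map block_letter bs"
  using map_block_letter_reduced foldr_Nil unfolding blocks_def blocks_value_def by blast

lemma blocks_value_inj:
  assumes "bs \<in> blocks" "bs' \<in> blocks" "blocks_value bs = blocks_value bs'"
  shows "bs = bs'"
proof -
  have "inj_on block_letter {(c, u). u \<in> L c}"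
  proof (rule inj_onI)
    fix x y assume *: "x \<in> {(c, u). u \<in> L c}" "y \<in> {(c, u). u \<in> L c}" "block_letter x = block_letter y"
    then have "fst x = fst y" using isl_block_letter by (metis prod.collapse)
    then show "x = y" using * block_letter_inj by (cases x; cases y) auto
  qed
  moreover have "map block_letter bs = map block_letter bs'"
    using assms by (simp add: blocks_value_blocks)
  moreover have "set bs \<union> set bs' \<subseteq> {(c, u). u \<in> L c}"
    using assms(1,2) by (auto simp: blocks_def)
  ultimately show ?thesis using map_inj_on inj_on_subset by metis
qed

lemma blocks_value_surj:
  assumes "v \<in> RW"
  shows "\<exists>bs \<in> blocks. blocks_value bs = v"
proof -
  have "\<exists>x. (case x of (c, u) \<Rightarrow> u \<in> L c) \<and> block_letter x = y"
    if y: "y \<in> free_product_letters G H" for y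
  proof (cases y)
    case (Inl g)
    then have "g \<in> word_value G f ` L True" using y bij by (simp add: bij_betw_def)
    then obtain u where "u \<in> L True" "word_value G f u = g" by blast
    then show ?thesis using Inl by (intro exI[of _ "(True, u)"]) (simp add: block_letter_def)
  next
    case (Inr h)
    then have "h \<in> word_value H f' ` L False" using y bij' by (simp add: bij_betw_def)
    then obtain u where "u \<in> L False" "word_value H f' u = h" by blast
    then show ?thesis using Inr by (intro exI[of _ "(False, u)"]) (simp add: block_letter_def)
  qed
  then obtain r where r: "\<And>y. y \<in> free_product_letters G H \<Longrightarrow>
      (case r y of (c, u) \<Rightarrow> u \<in> L c) \<and> block_letter (r y) = y" by metis
  have "\<forall>y \<in> set v. y \<in> free_product_letters G H" using assms by (auto simp: reduced_words_def)
  then have *: "\<forall>(c, u) \<in> set (map r v). u \<in> L c" "map block_letter (map r v) = v"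
    using r by (auto intro!: map_idI)
  then have "map r v \<in> blocks"
    using map_block_letter_reduced[OF *(1)] assms by (simp add: blocks_def)
  then show ?thesis using blocks_value_blocks *(2) by metis
qed

lemma snoc_mem_blocks:
  "bs @ [(b, u)] \<in> blocks \<longleftrightarrow> bs \<in> blocks \<and> u \<in> L b \<and> u \<noteq> e b \<and> (bs = [] \<or> fst (last bs) \<noteq> b)"
  by (auto simp: blocks_def alternating_snoc)

text \<open>If no block on side \<open>b\<close> closes the sequence, \<open>e b\<close> takes its
  place; its embedding is the empty word, so one formula covers both cases.\<close>

lemma blocks_split:
  assumes "bs \<in> blocks"
  shows "other_blocks b bs \<in> blocks" "last_block (e b) b bs \<in> L b"
    "other_blocks b bs = [] \<or> fst (last (other_blocks b bs)) \<noteq> b"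
    "blocks_value bs = foldr mg (blocks_value (other_blocks b bs)) (embed (block_letter (b, last_block (e b) b bs)))"
proof -
  have "other_blocks b bs \<in> blocks \<and> last_block (e b) b bs \<in> L b \<and>
    (other_blocks b bs = [] \<or> fst (last (other_blocks b bs)) \<noteq> b) \<and>
    blocks_value bs = foldr mg (blocks_value (other_blocks b bs)) (embed (block_letter (b, last_block (e b) b bs)))"
  proof (cases "bs \<noteq> [] \<and> fst (last bs) = b")
    case True
    then obtain xs u where bs: "bs = xs @ [(b, u)]"
      by (cases bs rule: rev_cases) auto
    then have xs: "xs \<in> blocks" "u \<in> L b" "xs = [] \<or> fst (last xs) \<noteq> b"
      using assms snoc_mem_blocks by blast+
    moreover have "blocks_value bs = foldr mg (blocks_value xs) (embed (block_letter (b, u)))"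
      unfolding bs using xs blocks_lists L_lists by (intro blocks_value_snoc) blast+
    ultimately show ?thesis by (simp add: bs other_blocks_snoc)
  next
    case False
    have "embed (block_letter (b, e b)) = []"
      by (simp add: block_letter_e embed_def push_letter_def)
    moreover have "blocks_value bs \<in> RW" using blocks_value_reduced blocks_lists assms by blast
    ultimately show ?thesis
      using False assms e foldr_Nil by (auto simp: other_blocks_def last_block_def)
  qed
  then show "other_blocks b bs \<in> blocks" "last_block (e b) b bs \<in> L b"
    "other_blocks b bs = [] \<or> fst (last (other_blocks b bs)) \<noteq> b"
    "blocks_value bs = foldr mg (blocks_value (other_blocks b bs)) (embed (block_letter (b, last_block (e b) b bs)))"
    by blast+
qed

text \<open>The product has the explicit normal form \<open>bs''\<close>, and both directions
  compare \<open>bs'\<close> with it through injectivity of \<open>blocks_value\<close>.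
  Cancellation cannot reach further, since the other blocks do not end on side
  \<open>b\<close>.\<close>

lemma blocks_mult:
  assumes bs: "bs \<in> blocks" and bs': "bs' \<in> blocks" and a: "a \<in> A b"
  shows "blocks_value bs' = foldr mg (blocks_value bs) (embed (block_letter (b, [a]))) \<longleftrightarrow>
    other_blocks b bs = other_blocks b bs' \<and>
    block_letter (b, last_block (e b) b bs') = block_letter (b, last_block (e b) b bs @ [a])"
proof -
  let ?r = "other_blocks b bs" and ?u = "last_block (e b) b bs"
  note split = blocks_split[OF bs, of b]
  have u: "?u \<in> lists (A b)" "[a] \<in> lists (A b)" "?u @ [a] \<in> lists (A b)"
  proof -
    show "?u \<in> lists (A b)" using split(2) L_lists by blast
    then show "[a] \<in> lists (A b)" "?u @ [a] \<in> lists (A b)" using a by simp_all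
  qed
  have r: "blocks_value ?r \<in> RW" using blocks_value_reduced blocks_lists split(1) by blast
  \<comment> \<open>Associativity moves the generator to the last block, where the multiplication
    takes place within one factor.\<close>
  have "foldr mg (blocks_value bs) (embed (block_letter (b, [a]))) =
      foldr mg (blocks_value ?r) (foldr mg (embed (block_letter (b, ?u))) (embed (block_letter (b, [a]))))"
    unfolding split(4)
    by (intro foldr_assoc reduced_lists[OF r] embed_reduced block_letter_closed u)
  also have "foldr mg (embed (block_letter (b, ?u))) (embed (block_letter (b, [a]))) =
      embed (block_letter (b, ?u @ [a]))"
    using embed_mult[OF block_letter_closed[OF u(1)] embed_reduced[OF block_letter_closed[OF u(2)]]]
      embed_block_append[OF u(1,2)] by simp
  finally have prod: "foldr mg (blocks_value bs) (embed (block_letter (b, [a]))) =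
      foldr mg (blocks_value ?r) (embed (block_letter (b, ?u @ [a])))" .
  obtain u' where u': "u' \<in> L b" "block_letter (b, u') = block_letter (b, ?u @ [a])"
    using block_letter_surj[OF u(3)] .
  \<comment> \<open>A last block that becomes trivial must disappear, because \<open>e b\<close> is
    forbidden as a block; what remains is a normal form already.\<close>
  define bs'' where "bs'' = (if u' = e b then ?r else ?r @ [(b, u')])"
  have bs'': "bs'' \<in> blocks"
    using split(1,3) u'(1) by (simp add: bs''_def snoc_mem_blocks)
  have other: "other_blocks b bs'' = ?r" and last: "last_block (e b) b bs'' = u'"
    using split(3) by (auto simp: bs''_def other_blocks_snoc) (auto simp: other_blocks_def last_block_def)
  have "blocks_value bs'' = foldr mg (blocks_value bs) (embed (block_letter (b, [a])))"
    using blocks_split(4)[OF bs'', of b] unfolding other last prod u'(2) .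
  moreover have "bs' = bs''" if "other_blocks b bs' = ?r" "block_letter (b, last_block (e b) b bs') = block_letter (b, u')"
  proof -
    have "blocks_value bs' = blocks_value bs''"
      using blocks_split(4)[OF bs', of b] blocks_split(4)[OF bs'', of b] that other last by simp
    then show ?thesis by (rule blocks_value_inj[OF bs' bs''])
  qed
  ultimately show ?thesis
    using blocks_value_inj[OF bs' bs''] other last u'(2) by metis
qed

lemma finite_Y: "finite Y"
  using finite_letters finite_A by blast

text \<open>The blocks of the two sides need different automata, so each parser emits only one side;
  both verify the common format.\<close>

lemma block_words_eq:
  "block_word ` blocks = {w \<in> lists Y. \<exists>us. parse_run e True (Between None) w = Some (concat (map end_marked us)) \<and> set us \<subseteq> L True} \<inter>
    {w \<in> lists Y. \<exists>us. parse_run e False (Between None) w = Some (concat (map end_marked us)) \<and> set us \<subseteq> L False}"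
  (is "_ = ?R True \<inter> ?R False")
proof (intro equalityI subsetI)
  fix w assume "w \<in> block_word ` blocks"
  then obtain bs where bs: "w = block_word bs" "bs \<in> blocks" by blast
  have "w \<in> ?R b" for b
  proof -
    have "parse_run e b (Between None) w = Some (concat (map end_marked (side_blocks b bs)))"
      unfolding parse_run_block_word using bs by (auto simp: blocks_def)
    moreover have "set (side_blocks b bs) \<subseteq> L b"
      using bs(2) by (auto simp: blocks_def side_blocks_def)
    moreover have "w \<in> lists Y"
      using block_word_letters blocks_lists[OF bs(2)] bs(1) by blast
    ultimately show ?thesis by blast
  qed
  then show "w \<in> ?R True \<inter> ?R False" by blast
next
  fix w assume w: "w \<in> ?R True \<inter> ?R False"
  then obtain us where us: "parse_run e True (Between None) w = Some (concat (map end_marked us))" "set us \<subseteq> L True"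
    by blast
  obtain us' where us': "parse_run e False (Between None) w = Some (concat (map end_marked us'))" "set us' \<subseteq> L False"
    using w by blast
  obtain bs where bs: "w = block_word bs" "alternating e None bs" "us = side_blocks True bs"
    using us(1) unfolding parse_run_block_word concat_end_marked_inj by blast
  \<comment> \<open>Running the other parser on the word of the same \<open>bs\<close> identifies
    \<open>us'\<close> as its blocks on side \<open>False\<close>.\<close>
  have "parse_run e False (Between None) w = Some (concat (map end_marked (side_blocks False bs)))"
    unfolding parse_run_block_word using bs by blast
  then have "us' = side_blocks False bs" using us'(1) concat_end_marked_inj by (metis option.inject)
  have "u \<in> L c" if "(c, u) \<in> set bs" for c u
  proof -
    have "u \<in> set (side_blocks c bs)" using that by (force simp: side_blocks_def)
    then show ?thesis using us(2) us'(2) bs(3) \<open>us' = side_blocks False bs\<close> by (cases c) auto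
  qed
  then show "w \<in> block_word ` blocks" using bs by (auto simp: blocks_def)
qed

lemma parallel_poly_pushdown_block_words:
  "parallel_poly_pushdown (to_nat ` Y) (map to_nat ` block_word ` blocks)"
proof -
  have "parallel_poly_pushdown (to_nat ` Y) (map to_nat ` {w \<in> lists Y. \<exists>us.
      parse_run e b (Between None) w = Some (concat (map end_marked us)) \<and> set us \<subseteq> L b})" for b
  proof -
    obtain Q where Q: "finite_transducer Y (insert None (Some ` A b)) (parse e b) Q" "Between None \<in> Q"
      using finite_parse[of A b e] finite_A by blast
    show ?thesis
      by (rule parallel_poly_pushdown_blocks_code[OF L_pushdown finite_Y Q]) simp
  qed
  then show ?thesis
    unfolding block_words_eq image_Int[OF inj_mapI[OF inj_to_nat]] by (intro parallel_poly_pushdown_Int)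
qed

lemma async_two_tape_block_mult:
  assumes a: "a \<in> A b"
  shows "async_two_tape_parallel_poly_pushdown (A b)
    {(w, w'). w \<in> L b \<and> w' \<in> L b \<and> block_letter (b, w') = block_letter (b, w @ [a])}"
  using mult_True[of a] mult_False[of a] a by (cases b) (simp_all add: block_letter_def)

text \<open>\<open>R1\<close> relates the closing blocks on side \<open>b\<close> and
  \<open>R2\<close> compares all other blocks; by \<open>blocks_mult\<close> they describe the
  multiplication together.\<close>

lemma async_two_tape_block_words:
  assumes a: "a \<in> A b"
  shows "\<exists>R. async_two_tape_parallel_poly_pushdown (to_nat ` Y) R \<and>
    (\<forall>w \<in> block_word ` blocks. \<forall>w' \<in> block_word ` blocks. (map to_nat w, map to_nat w') \<in> R \<longleftrightarrow>
      word_value FP letter_value w' = word_value FP letter_value (w @ [Lt b a]))"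
proof -
  let ?last = "transduce (last_transducer (e b) b) (\<lambda>_. True) False"
  let ?rest = "transduce (rest_transducer b) (\<lambda>_. True) False"
  let ?Ra = "{(w, w'). w \<in> L b \<and> w' \<in> L b \<and> block_letter (b, w') = block_letter (b, w @ [a])}"
  obtain K where K: "is_dpda_language (A b) K"
    using L_pushdown[of b] unfolding parallel_poly_pushdown_def by blast
  have last: "finite_transducer Y (A b) (last_transducer (e b) b) UNIV"
    using e[of b] L_lists[of b] by (intro finite_last_transducer) blast
  obtain R1 where R1: "async_two_tape_parallel_poly_pushdown (to_nat ` Y) R1"
      "\<And>u v u' v'. u \<in> lists Y \<Longrightarrow> v \<in> lists Y \<Longrightarrow> ?last u = Some u' \<Longrightarrow> ?last v = Some v' \<Longrightarrow>
        (map to_nat u, map to_nat v) \<in> R1 \<longleftrightarrow> (u', v') \<in> ?Ra"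
    by (fact async_two_tape_transduce_code[OF async_two_tape_block_mult[OF a] finite_Y last UNIV_I,
          where fin = "\<lambda>_. True" and ?q0.0 = False])
  obtain R2 where R2: "async_two_tape_parallel_poly_pushdown (to_nat ` Y) R2"
      "\<And>u v u' v'. u \<in> lists Y \<Longrightarrow> v \<in> lists Y \<Longrightarrow> ?rest u = Some u' \<Longrightarrow> ?rest v = Some v' \<Longrightarrow>
        (map to_nat u, map to_nat v) \<in> R2 \<longleftrightarrow> (u', v') \<in> {(u, v) \<in> lists Y \<times> lists Y. u = v}"
    by (fact async_two_tape_transduce_code[OF async_two_tape_equality[OF finite_Y K] finite_Y
          finite_rest_transducer UNIV_I, where fin = "\<lambda>_. True" and ?q0.0 = False])
  have "(map to_nat (block_word bs), map to_nat (block_word bs')) \<in> R1 \<inter> R2 \<longleftrightarrow>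
      word_value FP letter_value (block_word bs') = word_value FP letter_value (block_word bs @ [Lt b a])"
    if bs: "bs \<in> blocks" "bs' \<in> blocks" for bs bs'
  proof -
    note l = blocks_lists[OF bs(1)] blocks_lists[OF bs(2)]
    have wl: "block_word bs \<in> lists Y" "block_word bs' \<in> lists Y"
      using block_word_letters l by blast+
    have "Lt b a \<in> Y" using a by (cases b) simp_all
    then have "word_value FP letter_value (block_word bs @ [Lt b a]) =
        foldr mg (blocks_value bs) (embed (block_letter (b, [a])))"
      using word_value_snoc[OF group_FP letter_value_closed wl(1)] word_value_block_word[OF l(1)]
        letter_value_block[OF a] by simp
    moreover have "plain_word (other_blocks b bs) \<in> lists Y" "plain_word (other_blocks b bs') \<in> lists Y"
      using plain_word_letters blocks_lists blocks_split(1) bs by blast+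
    ultimately show ?thesis
      using R1(2)[OF wl transduce_last_block_word transduce_last_block_word]
        R2(2)[OF wl transduce_rest_block_word transduce_rest_block_word]
        blocks_mult[OF bs a] blocks_split(2)[OF bs(1)] blocks_split(2)[OF bs(2)]
        word_value_block_word[OF l(2)]
      by (auto simp: plain_word_eq_iff simp del: in_lists_conv_set)
  qed
  then show ?thesis using async_two_tape_Int[OF R1(1) R2(1)] by (intro exI[of _ "R1 \<inter> R2"]) blast
qed

lemma bij_block_words: "bij_betw (word_value FP letter_value) (block_word ` blocks) (carrier FP)"
proof (rule bij_betw_imageI)
  have val: "word_value FP letter_value (block_word bs) = blocks_value bs" if "bs \<in> blocks" for bs
    using word_value_block_word blocks_lists[OF that] by blast
  show "inj_on (word_value FP letter_value) (block_word ` blocks)"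
  proof (rule inj_onI)
    fix w w' assume "w \<in> block_word ` blocks" "w' \<in> block_word ` blocks"
      and eq: "word_value FP letter_value w = word_value FP letter_value w'"
    then obtain bs bs' where bs: "w = block_word bs" "w' = block_word bs'" "bs \<in> blocks" "bs' \<in> blocks"
      by blast
    then have "blocks_value bs = blocks_value bs'" using eq val by (simp only:)
    then show "w = w'" using blocks_value_inj bs by blast
  qed
  have "word_value FP letter_value ` block_word ` blocks = blocks_value ` blocks"
    unfolding image_image by (rule image_cong) (use val in simp_all)
  also have "\<dots> = RW"
    using blocks_value_surj blocks_value_reduced blocks_lists by blast
  finally show "word_value FP letter_value ` block_word ` blocks = carrier FP" by simp
qed

theorem parallel_poly_pushdown_group_FP: "parallel_poly_pushdown_group FP"
proof (rule parallel_poly_pushdown_group_criterion[OF group_FP finite_Y letter_value_closed _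
      bij_block_words parallel_poly_pushdown_block_words])
  show "block_word ` blocks \<subseteq> lists Y"
    using block_word_letters blocks_lists by blast
  fix c assume c: "c \<in> Y" "letter_value c \<noteq> \<one>\<^bsub>FP\<^esub>"
  then obtain b a where ba: "c = Lt b a" by (cases c) simp_all
  then have "a \<in> A b" using c(1) by (cases b) simp_all
  then show "\<exists>R. async_two_tape_parallel_poly_pushdown (to_nat ` Y) R \<and>
    (\<forall>w \<in> block_word ` blocks. \<forall>w' \<in> block_word ` blocks. (map to_nat w, map to_nat w') \<in> R \<longleftrightarrow>
      word_value FP letter_value w' = word_value FP letter_value (w @ [c]))"
    unfolding ba by (rule async_two_tape_block_words)
qed

end

theorem parallel_poly_pushdown_group_free_product:
  fixes G :: "('g, 'm) monoid_scheme" and G' :: "('h, 'n) monoid_scheme"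
  assumes "parallel_poly_pushdown_group G" and "parallel_poly_pushdown_group G'"
  shows "parallel_poly_pushdown_group (free_product G G')"
proof -
  interpret two_groups G G'
    using assms by (simp add: two_groups_def parallel_poly_pushdown_group_def)
  obtain A :: "nat set" and f L where A: "finite A" "f \<in> A \<rightarrow> carrier G" "L \<subseteq> lists A"
    "bij_betw (word_value G f) L (carrier G)" "parallel_poly_pushdown A L"
    "\<And>a. a \<in> A \<Longrightarrow> async_two_tape_parallel_poly_pushdown A
        {(w, w'). w \<in> L \<and> w' \<in> L \<and> word_value G f w' = word_value G f (w @ [a])}"
    using assms(1) unfolding parallel_poly_pushdown_group_def parallel_poly_pushdown_structure_def by blast
  obtain A' :: "nat set" and f' L' where A': "finite A'" "f' \<in> A' \<rightarrow> carrier G'" "L' \<subseteq> lists A'"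
    "bij_betw (word_value G' f') L' (carrier G')" "parallel_poly_pushdown A' L'"
    "\<And>a. a \<in> A' \<Longrightarrow> async_two_tape_parallel_poly_pushdown A'
        {(w, w'). w \<in> L' \<and> w' \<in> L' \<and> word_value G' f' w' = word_value G' f' (w @ [a])}"
    using assms(2) unfolding parallel_poly_pushdown_group_def parallel_poly_pushdown_structure_def by blast
  \<comment> \<open>The normal forms of the neutral elements of the two factors, which blocks have
    to avoid.\<close>
  obtain e where e: "e \<in> L" "word_value G f e = \<one>\<^bsub>G\<^esub>"
    using A(4) G.one_closed unfolding bij_betw_def by (metis imageE)
  obtain e' where e': "e' \<in> L'" "word_value G' f' e' = \<one>\<^bsub>G'\<^esub>"
    using A'(4) H.one_closed unfolding bij_betw_def by (metis imageE)
  interpret free_product_structure G G' "\<lambda>b. if b then A else A'" f f' "\<lambda>b. if b then L else L'"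
    "\<lambda>b. if b then e else e'"
    by unfold_locales (use A A' e e' in \<open>simp_all del: in_lists_conv_set\<close>)
  show ?thesis by (rule parallel_poly_pushdown_group_FP)
qed

theorem theorem5p1:
  fixes G :: "('g, 'm) monoid_scheme" and G' :: "('h, 'n) monoid_scheme"
  assumes "parallel_poly_pushdown_group G" and "parallel_poly_pushdown_group G'"
  shows "parallel_poly_pushdown_group (G \<times>\<times> G') \<and>
         parallel_poly_pushdown_group (free_product G G')"
  using assms parallel_poly_pushdown_group_DirProd parallel_poly_pushdown_group_free_product by blast

end
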